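(* Let $\Lambda$ be one of the following two $\mathfrak o_F$-lattice sequences in $V$: either $\Lambda(3i)=\varpi^iN_0$, $\Lambda(3i+1)=\varpi^iN_1$, $\Lambda(3i+2)=\varpi^{i+1}N_1^\#$ ($i\in\mathbf Z$), or $\Lambda(3i)=\varpi^iN_1$, $\Lambda(3i+1)=\varpi^iN_2$, $\Lambda(3i+2)=\varpi^{i+1}N_1^\#$ ($i\in\mathbf Z$). Let $n$ be a positive integer coprime to $3$, and let $[\Lambda,n,[n/2],\beta]$ and $[\Lambda,n,[n/2],\gamma]$ be fundamental skew strata. Suppose that there exists an irreducible smooth representation of $G$ which contains both $[\Lambda,n,[n/2],\beta]$ and $[\Lambda,n,[n/2],\gamma]$. Then $(P_{\Lambda,[n/2]+1},\psi_\gamma)$ is a $P_{\Lambda,0}$-conjugate of $(P_{\Lambda,[n/2]+1},\psi_\beta)$, i.e. there is $g\in P_{\Lambda,0}$ with $\psi_\gamma(x)=\psi_\beta(gxg^{-1})$ for all $x\in P_{\Lambda,[n/2]+1}$.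
   Context: Let $F_0$ be a non-archimedean local field of odd residual characteristic, with ring of integers $\mathfrak o_0$, maximal ideal $\mathfrak p_0$ and residue field $k_0$ of cardinality $q$. Let $\varepsilon\in\mathfrak o_0^\times$ be a nonsquare and $F=F_0[\sqrt\varepsilon]$ the unramified quadratic extension, with corresponding objects $\mathfrak o_F,\mathfrak p_F,k_F$; $x\mapsto\overline x$ is Galois conjugation, and $\varpi$ is a common uniformizer of $F_0$ and $F$. Let $V=F^4$ (column vectors) with standard basis $e_1,\dots,e_4$, $A=M_4(F)=\mathrm{End}_F(V)$ with matrix units $E_{ij}$, $H=E_{14}+E_{23}+E_{32}+E_{41}$, $f(x,y)={}^t\overline xHy$ on $V$, $\sigma(X)=H^{-1}\,{}^t\overline X H$ on $A$, $G=U(2,2)=\{g\in GL_4(F): g\sigma(g)=1\}$ and $\mathfrak g=\{X\in A: X+\sigma(X)=0\}$. An $\mathfrak o_F$-lattice sequence in $V$ is a function $\Lambda$ from $\mathbf Z$ to the set of $\mathfrak o_F$-lattices in $V$ with $\Lambda(i)\supseteq\Lambda(i+1)$ for all $i$ and for which there is a positive integer $e(\Lambda)$ (the period) with $\varpi\Lambda(i)=\Lambda(i+e(\Lambda))$ for all $i$. For a lattice $L$, $L^\#=\{v\in V: f(v,L)\subset\mathfrak o_F\}$. $\Lambda$ is self-dual if there is an integer $d(\Lambda)$ with $\Lambda(i)^\#=\Lambda(d(\Lambda)-i)$ for all $i$. Put $N_0=\mathfrak o_Fe_1\oplus\mathfrak o_Fe_2\oplus\mathfrak o_Fe_3\oplus\mathfrak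 o_Fe_4$, $N_1=\mathfrak o_Fe_1\oplus\mathfrak o_Fe_2\oplus\mathfrak o_Fe_3\oplus\mathfrak p_Fe_4$, $N_2=\mathfrak o_Fe_1\oplus\mathfrak o_Fe_2\oplus\mathfrak p_Fe_3\oplus\mathfrak p_Fe_4$. For a lattice sequence $\Lambda$ put $\mathfrak a_n(\Lambda)=\{X\in A: X\Lambda(i)\subset\Lambda(i+n)\ \forall i\}$. For $\Lambda$ self-dual put $\mathfrak g_{\Lambda,n}=\mathfrak g\cap\mathfrak a_n(\Lambda)$, $P_{\Lambda,0}=G\cap\mathfrak a_0(\Lambda)$ and $P_{\Lambda,n}=G\cap(1+\mathfrak a_n(\Lambda))$ for $n\ge1$ (an open normal subgroup of $P_{\Lambda,0}$). A stratum is a 4-tuple $[\Lambda,n,r,\beta]$ with $\Lambda$ an $\mathfrak o_F$-lattice sequence in $V$, integers $n>r\ge0$ and $\beta\in\mathfrak a_{-n}(\Lambda)$; it is skew if $\Lambda$ is self-dual and $\beta\in\mathfrak g_{\Lambda,-n}$. With $k=\gcd(e(\Lambda),n)$ put $y_\beta=\varpi^{n/k}\beta^{e(\Lambda)/k}\in\mathfrak a_0(\Lambda)$; its characteristic polynomial $\Phi_\beta(X)$ lies in $\mathfrak o_F[X]$ and $\phi_\beta(X)\in k_F[X]$ denotes its reduction modulo $\mathfrak p_F$. The stratum is fundamental if $\phi_\beta(X)\ne X^4$. Fix an additive character $\Omega$ of $F_0$ with conductor $\mathfrak p_0$ (trivial on $\mathfrak p_0$, not on $\mathfrak o_0$), and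 let $\mathrm{tr}_{A/F_0}=\mathrm{tr}_{F/F_0}\circ\mathrm{tr}_{A/F}$. For a skew stratum with $n>r\ge[n/2]$, $\psi_\beta(p)=\Omega(\mathrm{tr}_{A/F_0}(\beta(p-1)))$ is a character of $P_{\Lambda,r+1}$ trivial on $P_{\Lambda,n+1}$. A smooth complex representation $\pi$ of $G$ contains $[\Lambda,n,r,\beta]$ (with $n>r\ge[n/2]$) if the restriction of $\pi$ to $P_{\Lambda,r+1}$ contains $\psi_\beta$. *)

theory Defs
  imports "HOL-Analysis.Analysis" "HOL-Computational_Algebra.Polynomial"
begin

text \<open>
  A normalized discrete valuation is a function \<open>v\<close> into the integers whose value at 0 is
  irrelevant: the value infinity at 0 is encoded in \<open>frac_ideal\<close>, the power of exponent \<open>m\<close>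
  of the maximal ideal (a fractional ideal for negative \<open>m\<close>, the ring of integers for \<open>m = 0\<close>).
\<close>

definition frac_ideal :: "('k::field \<Rightarrow> int) \<Rightarrow> int \<Rightarrow> 'k set" where
  "frac_ideal v m = {x. x = 0 \<or> m \<le> v x}"

text \<open>The residue class of \<open>x\<close> modulo the maximal ideal, as a coset.\<close>

definition res_class :: "('k::field \<Rightarrow> int) \<Rightarrow> 'k \<Rightarrow> 'k set" where
  "res_class v x = {y. y - x \<in> frac_ideal v 1}"

definition residue_field :: "('k::field \<Rightarrow> int) \<Rightarrow> 'k set set" where
  "residue_field v = res_class v ` frac_ideal v 0"

definition residue_char :: "('k::field \<Rightarrow> int) \<Rightarrow> nat" where
  "residue_char v = (LEAST p. 0 < p \<and> res_class v (of_nat p) = res_class v 0)"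

locale nonarch_local_field =
  fixes v :: "'k::field \<Rightarrow> int"
  assumes v_mult: "x \<noteq> 0 \<Longrightarrow> y \<noteq> 0 \<Longrightarrow> v (x * y) = v x + v y"
    and v_add: "x \<noteq> 0 \<Longrightarrow> y \<noteq> 0 \<Longrightarrow> x + y \<noteq> 0 \<Longrightarrow> min (v x) (v y) \<le> v (x + y)"
    and v_normalized: "\<exists>x. x \<noteq> 0 \<and> v x = 1"
    and v_complete:
      "(\<And>N. \<exists>M. \<forall>m\<ge>M. \<forall>n\<ge>M. X m - X n \<in> frac_ideal v N) \<Longrightarrow>
        \<exists>L. \<forall>N. \<exists>M. \<forall>n\<ge>M. X (n::nat) - L \<in> frac_ideal v N"
    and finite_residue_field: "finite (residue_field v)"

text \<open>
  The data fixed throughout: the valuation of \<open>F\<^sub>0 = 'a\<close>, the embedding of \<open>F\<^sub>0\<close> into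
  \<open>F = 'f\<close>, the nonsquare unit, a square root of it in \<open>F\<close>, the uniformizer (in \<open>F\<^sub>0\<close>) and
  the additive character of \<open>F\<^sub>0\<close>.
\<close>

record ('a, 'f) unram_data =
  val :: "'a \<Rightarrow> int"
  emb :: "'a \<Rightarrow> 'f"
  eps :: 'a
  sqrt_eps :: 'f
  unif :: 'a
  Omega :: "'a \<Rightarrow> complex"

text \<open>
  Continuity and unitarity of \<open>Omega\<close>, and its not vanishing anywhere, follow from additivity
  and triviality on the maximal ideal.
\<close>

locale unram_setting = nonarch_local_field "val D"
  for D :: "('a::field, 'f::field) unram_data" +
  assumes odd_residue_char: "odd (residue_char (val D))"
    and emb_one: "emb D 1 = 1"
    and emb_add: "emb D (a + b) = emb D a + emb D b"
    and emb_mult: "emb D (a * b) = emb D a * emb D b"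
    and eps_unit: "eps D \<noteq> 0" "val D (eps D) = 0"
    and eps_nonsquare: "\<nexists>a. a ^ 2 = eps D"
    and sqrt_eps: "sqrt_eps D ^ 2 = emb D (eps D)"
    and F_generated: "\<exists>a b. x = emb D a + emb D b * sqrt_eps D"
    and unif: "unif D \<noteq> 0" "val D (unif D) = 1"
    and Omega_add: "Omega D (a + b) = Omega D a * Omega D b"
    and Omega_trivial: "a \<in> frac_ideal (val D) 1 \<Longrightarrow> Omega D a = 1"
    and Omega_nontrivial: "\<exists>a \<in> frac_ideal (val D) 0. Omega D a \<noteq> 1"

definition cnjF :: "('a::field, 'f::field) unram_data \<Rightarrow> 'f \<Rightarrow> 'f" where
  "cnjF D x = (THE y. \<exists>a b. x = emb D a + emb D b * sqrt_eps D \<and>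
                            y = emb D a - emb D b * sqrt_eps D)"

definition normF :: "('a::field, 'f::field) unram_data \<Rightarrow> 'f \<Rightarrow> 'a" where
  "normF D x = (THE a. emb D a = x * cnjF D x)"

definition traceF :: "('a::field, 'f::field) unram_data \<Rightarrow> 'f \<Rightarrow> 'a" where
  "traceF D x = (THE a. emb D a = x + cnjF D x)"

text \<open>
  The unique extension of the valuation to the quadratic extension is half the valuation of
  the norm; it is integer-valued (the division is exact) because the extension is unramified.
\<close>

definition valF :: "('a::field, 'f::field) unram_data \<Rightarrow> 'f \<Rightarrow> int" where
  "valF D x = val D (normF D x) div 2"

definition oF :: "('a::field, 'f::field) unram_data \<Rightarrow> 'f set" where
  "oF D = frac_ideal (valF D) 0"

definition pF :: "('a::field, 'f::field) unram_data \<Rightarrow> 'f set" where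
  "pF D = frac_ideal (valF D) 1"

definition unifF :: "('a::field, 'f::field) unram_data \<Rightarrow> 'f" where
  "unifF D = emb D (unif D)"

text \<open>
  Indices range over the four-element type \<open>4\<close>, whose elements are \<open>1, 2, 3, 4\<close> (with \<open>4 = 0\<close>).
  On vectors and matrices \<open>*\<close>, \<open>^\<close> and \<open>1\<close> are entrywise in the library, so products,
  powers and identities of matrices are written with \<open>**\<close>, \<open>mat_pow\<close> and \<open>mat 1\<close>.
\<close>

definition mat_unit :: "4 \<Rightarrow> 4 \<Rightarrow> 'f::field^4^4" where
  "mat_unit i j = (\<chi> k l. if k = i \<and> l = j then 1 else 0)"

definition matH :: "'f::field^4^4" where
  "matH = mat_unit 1 4 + mat_unit 2 3 + mat_unit 3 2 + mat_unit 4 1"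

definition herm :: "('a::field, 'f::field) unram_data \<Rightarrow> 'f^4 \<Rightarrow> 'f^4 \<Rightarrow> 'f" where
  "herm D x y = (\<Sum>i\<in>UNIV. \<Sum>j\<in>UNIV. cnjF D (x $ i) * matH $ i $ j * y $ j)"

definition sigma :: "('a::field, 'f::field) unram_data \<Rightarrow> 'f^4^4 \<Rightarrow> 'f^4^4" where
  "sigma D X = matrix_inv matH ** transpose (map_matrix (cnjF D) X) ** matH"

definition U22 :: "('a::field, 'f::field) unram_data \<Rightarrow> ('f^4^4) set" where
  "U22 D = {g. invertible g \<and> g ** sigma D g = mat 1}"

definition lie_U22 :: "('a::field, 'f::field) unram_data \<Rightarrow> ('f^4^4) set" where
  "lie_U22 D = {X. X + sigma D X = 0}"

text \<open>Lattices are the finitely generated \<open>oF\<close>-submodules of \<open>V\<close> that span \<open>V\<close> over \<open>F\<close>.\<close>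

definition is_lattice :: "('a::field, 'f::field) unram_data \<Rightarrow> ('f^4) set \<Rightarrow> bool" where
  "is_lattice D L \<longleftrightarrow>
     (\<exists>B. finite B \<and> vec.span B = UNIV \<and>
          L = {(\<Sum>b\<in>B. c b *s b) | c. \<forall>b\<in>B. c b \<in> oF D})"

definition scale_set :: "'f::field \<Rightarrow> ('f^4) set \<Rightarrow> ('f^4) set" where
  "scale_set c L = (\<lambda>x. c *s x) ` L"

definition lattice_dual :: "('a::field, 'f::field) unram_data \<Rightarrow> ('f^4) set \<Rightarrow> ('f^4) set" where
  "lattice_dual D L = {x. \<forall>y\<in>L. herm D x y \<in> oF D}"

definition is_period ::
  "('a::field, 'f::field) unram_data \<Rightarrow> (int \<Rightarrow> ('f^4) set) \<Rightarrow> nat \<Rightarrow> bool" where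
  "is_period D \<Lambda> e \<longleftrightarrow> 0 < e \<and> (\<forall>i. scale_set (unifF D) (\<Lambda> i) = \<Lambda> (i + int e))"

definition lattice_seq ::
  "('a::field, 'f::field) unram_data \<Rightarrow> (int \<Rightarrow> ('f^4) set) \<Rightarrow> bool" where
  "lattice_seq D \<Lambda> \<longleftrightarrow>
     (\<forall>i. is_lattice D (\<Lambda> i)) \<and> (\<forall>i. \<Lambda> (i + 1) \<subseteq> \<Lambda> i) \<and> (\<exists>e. is_period D \<Lambda> e)"

text \<open>The period of a lattice sequence is unique, since no lattice sequence is constant.\<close>

definition period :: "('a::field, 'f::field) unram_data \<Rightarrow> (int \<Rightarrow> ('f^4) set) \<Rightarrow> nat" where
  "period D \<Lambda> = (THE e. is_period D \<Lambda> e)"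

definition self_dual ::
  "('a::field, 'f::field) unram_data \<Rightarrow> (int \<Rightarrow> ('f^4) set) \<Rightarrow> bool" where
  "self_dual D \<Lambda> \<longleftrightarrow> (\<exists>d. \<forall>i. lattice_dual D (\<Lambda> i) = \<Lambda> (d - i))"

definition N0 :: "('a::field, 'f::field) unram_data \<Rightarrow> ('f^4) set" where
  "N0 D = {x. x $ 1 \<in> oF D \<and> x $ 2 \<in> oF D \<and> x $ 3 \<in> oF D \<and> x $ 4 \<in> oF D}"

definition N1 :: "('a::field, 'f::field) unram_data \<Rightarrow> ('f^4) set" where
  "N1 D = {x. x $ 1 \<in> oF D \<and> x $ 2 \<in> oF D \<and> x $ 3 \<in> oF D \<and> x $ 4 \<in> pF D}"

definition N2 :: "('a::field, 'f::field) unram_data \<Rightarrow> ('f^4) set" where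
  "N2 D = {x. x $ 1 \<in> oF D \<and> x $ 2 \<in> oF D \<and> x $ 3 \<in> pF D \<and> x $ 4 \<in> pF D}"

definition filt :: "(int \<Rightarrow> ('f::field^4) set) \<Rightarrow> int \<Rightarrow> ('f^4^4) set" where
  "filt \<Lambda> n = {X. \<forall>i. (\<lambda>x. X *v x) ` \<Lambda> i \<subseteq> \<Lambda> (i + n)}"

definition lie_filt ::
  "('a::field, 'f::field) unram_data \<Rightarrow> (int \<Rightarrow> ('f^4) set) \<Rightarrow> int \<Rightarrow> ('f^4^4) set" where
  "lie_filt D \<Lambda> n = lie_U22 D \<inter> filt \<Lambda> n"

definition grp_filt ::
  "('a::field, 'f::field) unram_data \<Rightarrow> (int \<Rightarrow> ('f^4) set) \<Rightarrow> nat \<Rightarrow> ('f^4^4) set" where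
  "grp_filt D \<Lambda> n =
     (if n = 0 then U22 D \<inter> filt \<Lambda> 0
      else U22 D \<inter> {mat 1 + X | X. X \<in> filt \<Lambda> (int n)})"

definition stratum ::
  "('a::field, 'f::field) unram_data \<Rightarrow> (int \<Rightarrow> ('f^4) set) \<Rightarrow> nat \<Rightarrow> nat \<Rightarrow> 'f^4^4 \<Rightarrow> bool" where
  "stratum D \<Lambda> n r \<beta> \<longleftrightarrow> lattice_seq D \<Lambda> \<and> r < n \<and> \<beta> \<in> filt \<Lambda> (- int n)"

definition skew_stratum ::
  "('a::field, 'f::field) unram_data \<Rightarrow> (int \<Rightarrow> ('f^4) set) \<Rightarrow> nat \<Rightarrow> nat \<Rightarrow> 'f^4^4 \<Rightarrow> bool" where
  "skew_stratum D \<Lambda> n r \<beta> \<longleftrightarrow>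
     stratum D \<Lambda> n r \<beta> \<and> self_dual D \<Lambda> \<and> \<beta> \<in> lie_filt D \<Lambda> (- int n)"

primrec mat_pow :: "'f::field^4^4 \<Rightarrow> nat \<Rightarrow> 'f^4^4" where
  "mat_pow X 0 = mat 1"
| "mat_pow X (Suc m) = X ** mat_pow X m"

definition charpoly :: "'f::field^4^4 \<Rightarrow> 'f poly" where
  "charpoly X = det (mat [:0, 1:] - map_matrix (\<lambda>x. [:x:]) X)"

definition stratum_y ::
  "('a::field, 'f::field) unram_data \<Rightarrow> (int \<Rightarrow> ('f^4) set) \<Rightarrow> nat \<Rightarrow> 'f^4^4 \<Rightarrow> 'f^4^4" where
  "stratum_y D \<Lambda> n \<beta> =
     (let e = period D \<Lambda>; k = gcd e n
      in mat (unifF D ^ (n div k)) ** mat_pow \<beta> (e div k))"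

text \<open>
  The reduction of a polynomial over \<open>oF\<close>, given by its sequence of coefficients in the
  residue field of \<open>F\<close>.
\<close>

definition reduction :: "('a::field, 'f::field) unram_data \<Rightarrow> 'f poly \<Rightarrow> nat \<Rightarrow> 'f set" where
  "reduction D p = (\<lambda>i. res_class (valF D) (coeff p i))"

definition fundamental ::
  "('a::field, 'f::field) unram_data \<Rightarrow> (int \<Rightarrow> ('f^4) set) \<Rightarrow> nat \<Rightarrow> 'f^4^4 \<Rightarrow> bool" where
  "fundamental D \<Lambda> n \<beta> \<longleftrightarrow>
     reduction D (charpoly (stratum_y D \<Lambda> n \<beta>)) \<noteq> reduction D (monom 1 4)"

definition psi :: "('a::field, 'f::field) unram_data \<Rightarrow> 'f^4^4 \<Rightarrow> 'f^4^4 \<Rightarrow> complex" where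
  "psi D \<beta> p = Omega D (traceF D (trace (\<beta> ** (p - mat 1))))"

text \<open>Openness of a subset of the unitary group, for the valuation topology on matrices.\<close>

definition open_in_U22 :: "('a::field, 'f::field) unram_data \<Rightarrow> ('f^4^4) set \<Rightarrow> bool" where
  "open_in_U22 D S \<longleftrightarrow> S \<subseteq> U22 D \<and>
     (\<forall>g\<in>S. \<exists>m. \<forall>h\<in>U22 D. (\<forall>i j. h $ i $ j - g $ i $ j \<in> frac_ideal (valF D) m) \<longrightarrow> h \<in> S)"

text \<open>
  The representation space is the whole type \<open>'v\<close>, with complex scalar multiplication \<open>smul\<close>.
\<close>

definition smooth_rep ::
  "('a::field, 'f::field) unram_data \<Rightarrow> (complex \<Rightarrow> 'v::ab_group_add \<Rightarrow> 'v) \<Rightarrow>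
    ('f^4^4 \<Rightarrow> 'v \<Rightarrow> 'v) \<Rightarrow> bool" where
  "smooth_rep D smul \<pi> \<longleftrightarrow>
     vector_space smul \<and>
     (\<forall>g\<in>U22 D. Vector_Spaces.linear smul smul (\<pi> g)) \<and>
     \<pi> (mat 1) = id \<and>
     (\<forall>g\<in>U22 D. \<forall>h\<in>U22 D. \<pi> (g ** h) = \<pi> g \<circ> \<pi> h) \<and>
     (\<forall>w. open_in_U22 D {g \<in> U22 D. \<pi> g w = w})"

definition irreducible_smooth_rep ::
  "('a::field, 'f::field) unram_data \<Rightarrow> (complex \<Rightarrow> 'v::ab_group_add \<Rightarrow> 'v) \<Rightarrow>
    ('f^4^4 \<Rightarrow> 'v \<Rightarrow> 'v) \<Rightarrow> bool" where
  "irreducible_smooth_rep D smul \<pi> \<longleftrightarrow>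
     smooth_rep D smul \<pi> \<and> (\<exists>w::'v. w \<noteq> 0) \<and>
     (\<forall>W. module.subspace smul W \<and> (\<forall>g\<in>U22 D. \<pi> g ` W \<subseteq> W) \<longrightarrow> W = {0} \<or> W = UNIV)"

definition contains_stratum ::
  "('a::field, 'f::field) unram_data \<Rightarrow> (complex \<Rightarrow> 'v::ab_group_add \<Rightarrow> 'v) \<Rightarrow>
    ('f^4^4 \<Rightarrow> 'v \<Rightarrow> 'v) \<Rightarrow> (int \<Rightarrow> ('f^4) set) \<Rightarrow> nat \<Rightarrow> nat \<Rightarrow> 'f^4^4 \<Rightarrow> bool" where
  "contains_stratum D smul \<pi> \<Lambda> n r \<beta> \<longleftrightarrow>
     n div 2 \<le> r \<and> r < n \<and>
     (\<exists>w. w \<noteq> 0 \<and> (\<forall>p \<in> grp_filt D \<Lambda> (r + 1). \<pi> p w = smul (psi D \<beta> p) w))"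

end

theory Submission
  imports Defs
begin

text \<open>
  The group elements that intertwine the two characters already stabilize the lattice sequence.

  Both sequences have period 3 and are split by the standard basis, with graded pieces of dimensions
  1, 2, 1. As \<open>n\<close> is prime to 3, the leading term of an element \<open>\<gamma>\<close> of degree \<open>-n\<close> runs round a cycle:
  from a line \<open>L\<close> to a hermitian plane, from the plane to the dual line \<open>L'\<close>, and from \<open>L'\<close> back to \<open>L\<close>. If \<open>\<gamma>\<close>
  is skew, the first map is given by a vector \<open>B\<close> of the plane, the second is minus its adjoint
  \<open>w \<mapsto> -f(B, w)\<close>, and the third is a scalar \<open>a\<close>. Going once round the cycle is an operator with
  eigenvalues \<open>-a f(B, B)\<close>, three times, and \<open>0\<close>; so the stratum is fundamental exactly if \<open>a\<close> and
  \<open>f(B, B)\<close> do not vanish to leading order (\<open>fundamental_nondegenerate\<close> is the direction used here).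

  If they do not vanish, some power \<open>\<gamma>\<^sup>k\<close> takes any given vector \<open>v\<close>, without loss of level, to a vector
  whose leading term lies in the plane and is anisotropic: a vector on \<open>L\<close> goes to a multiple of \<open>B\<close>, and
  an isotropic vector of the plane is not orthogonal to \<open>B\<close>, so that it survives to \<open>L'\<close>. The valuation
  of \<open>f(\<gamma>\<^sup>k v, \<gamma>\<^sup>k v)\<close> is then the least that the level of \<open>v\<close> permits (\<open>extremal_norm\<close>). An isometry \<open>g\<close> with
  \<open>c g = g b\<close>, where \<open>c\<close> has the leading term of \<open>\<gamma>\<close> and \<open>b\<close> has degree \<open>-n\<close>, preserves these values of the
  form, hence cannot lower levels (\<open>intertwiner_preserves_sequence\<close>).

  Such a \<open>g\<close> comes from the representation. By irreducibility and averaging over a compact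
  group, some \<open>g\<close> in \<open>G\<close> makes \<open>\<psi>\<^sub>\<gamma>\<close> agree with the conjugate of \<open>\<psi>\<^sub>\<beta>\<close> by \<open>g\<close> on the intersection of their
  domains (\<open>common_representation_intertwines\<close>). The Cayley transform and the duality of lattices
  under the trace turn this into an equation \<open>\<gamma> - U = g (\<beta> + U') g\<inverse>\<close> with \<open>U\<close> and \<open>U'\<close> of degree \<open>-[n/2]\<close>,
  which leaves the leading terms alone (\<open>intertwining_elements\<close>). So \<open>g\<close> stabilizes the
  sequence; it therefore normalizes the domain of the characters, which then agree everywhere.
\<close>

section \<open>Discrete valuations and their filtration in thirds\<close>

locale discrete_valuation =
  fixes v :: "'k::field \<Rightarrow> int"
  assumes v_mult: "x \<noteq> 0 \<Longrightarrow> y \<noteq> 0 \<Longrightarrow> v (x * y) = v x + v y"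
    and v_add: "x \<noteq> 0 \<Longrightarrow> y \<noteq> 0 \<Longrightarrow> x + y \<noteq> 0 \<Longrightarrow> min (v x) (v y) \<le> v (x + y)"
begin

lemma v_one [simp]: "v 1 = 0"
  using v_mult[of 1 1] by simp

lemma v_minus_one [simp]: "v (- 1) = 0"
  using v_mult[of "- 1" "- 1"] by simp

lemma v_minus [simp]: "v (- x) = v x"
proof (cases "x = 0")
  case False
  then show ?thesis using v_mult[of "- 1" x] by simp
qed simp

lemma v_inverse: "x \<noteq> 0 \<Longrightarrow> v (inverse x) = - v x"
  using v_mult[of x "inverse x"] by simp

lemma v_divide: "x \<noteq> 0 \<Longrightarrow> y \<noteq> 0 \<Longrightarrow> v (x / y) = v x - v y"
  by (simp add: divide_inverse v_mult v_inverse)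

lemma v_power: "x \<noteq> 0 \<Longrightarrow> v (x ^ k) = int k * v x"
  by (induction k) (simp_all add: v_mult algebra_simps)

lemma v_power_int: "x \<noteq> 0 \<Longrightarrow> v (x powi k) = k * v x"
  by (cases "0 \<le> k") (simp_all add: power_int_def v_power v_inverse)

lemma frac_0 [simp]: "0 \<in> frac_ideal v m"
  by (simp add: frac_ideal_def)

lemma frac_add: "x \<in> frac_ideal v m \<Longrightarrow> y \<in> frac_ideal v m \<Longrightarrow> x + y \<in> frac_ideal v m"
  using v_add[of x y] by (cases "x = 0"; cases "y = 0"; cases "x + y = 0") (simp_all add: frac_ideal_def)

lemma frac_uminus: "x \<in> frac_ideal v m \<Longrightarrow> - x \<in> frac_ideal v m"
  by (simp add: frac_ideal_def)

lemma frac_diff: "x \<in> frac_ideal v m \<Longrightarrow> y \<in> frac_ideal v m \<Longrightarrow> x - y \<in> frac_ideal v m"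
  using frac_add[OF _ frac_uminus] by fastforce

lemma frac_mult: "x \<in> frac_ideal v a \<Longrightarrow> y \<in> frac_ideal v b \<Longrightarrow> x * y \<in> frac_ideal v (a + b)"
  using v_mult[of x y] by (cases "x = 0"; cases "y = 0") (simp_all add: frac_ideal_def)

lemma frac_mono: "x \<in> frac_ideal v b \<Longrightarrow> a \<le> b \<Longrightarrow> x \<in> frac_ideal v a"
  unfolding frac_ideal_def by auto

lemma frac_eq_0:
  assumes "\<And>m. x \<in> frac_ideal v m"
  shows "x = 0"
  using assms[of "v x + 1"] by (simp add: frac_ideal_def)

lemma res_class_eq:
  assumes "x - y \<in> frac_ideal v 1"
  shows "res_class v x = res_class v y"
proof -
  have "z - x \<in> frac_ideal v 1 \<longleftrightarrow> z - y \<in> frac_ideal v 1" for z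
    using frac_add[OF _ assms, of "z - x"] frac_diff[OF _ assms, of "z - y"] by auto
  then show ?thesis unfolding res_class_def by auto
qed

lemma v_add_less:
  assumes "x \<noteq> 0" "y \<noteq> 0" "v x < v y"
  shows "x + y \<noteq> 0" "v (x + y) = v x"
proof -
  show nz: "x + y \<noteq> 0"
  proof
    assume "x + y = 0"
    then have "y = - x" by (simp add: eq_neg_iff_add_eq_0 add.commute)
    then show False using assms by simp
  qed
  have "min (v x) (v y) \<le> v (x + y)" using v_add nz assms by blast
  moreover have "min (v (x + y)) (v (- y)) \<le> v (x + y + - y)"
    using v_add[of "x + y" "- y"] nz assms by simp
  ultimately show "v (x + y) = v x" using assms by simp
qed

end

text \<open>
  Elements whose valuation is at least \<open>a/3\<close>. For a lattice sequence of period 3 all the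
  exponents that occur are such fractions; keeping \<open>a\<close> instead of its rounding makes the sets multiply
  additively, and rounding becomes the step \<open>thirds_Suc\<close>.
\<close>

definition thirds :: "('k::field \<Rightarrow> int) \<Rightarrow> int \<Rightarrow> 'k set" where
  "thirds v a = {x. x = 0 \<or> a \<le> 3 * v x}"

context discrete_valuation
begin

lemma thirds_frac: "thirds v (3 * m) = frac_ideal v m"
  by (simp add: thirds_def frac_ideal_def)

lemma thirds_frac_0: "thirds v 0 = frac_ideal v 0"
  by (simp add: thirds_def frac_ideal_def)

lemma thirds_frac_1: "thirds v 1 = frac_ideal v 1"
  by (auto simp: thirds_def frac_ideal_def)

lemma thirds_0 [simp]: "0 \<in> thirds v a"
  by (simp add: thirds_def)

lemma thirds_add: "x \<in> thirds v a \<Longrightarrow> y \<in> thirds v a \<Longrightarrow> x + y \<in> thirds v a"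
  using v_add[of x y] by (cases "x = 0"; cases "y = 0"; cases "x + y = 0") (auto simp: thirds_def)

lemma thirds_uminus_iff [simp]: "- x \<in> thirds v a \<longleftrightarrow> x \<in> thirds v a"
  by (simp add: thirds_def)

lemma thirds_diff: "x \<in> thirds v a \<Longrightarrow> y \<in> thirds v a \<Longrightarrow> x - y \<in> thirds v a"
  using thirds_add[of x a "- y"] by simp

lemma thirds_sum: "(\<And>i. i \<in> I \<Longrightarrow> f i \<in> thirds v a) \<Longrightarrow> sum f I \<in> thirds v a"
  by (induction I rule: infinite_finite_induct) (auto intro: thirds_add)

lemma thirds_mult: "x \<in> thirds v a \<Longrightarrow> y \<in> thirds v b \<Longrightarrow> x * y \<in> thirds v (a + b)"
  using v_mult[of x y] by (cases "x = 0"; cases "y = 0") (simp_all add: thirds_def)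

lemma thirds_mult': "x \<in> thirds v a \<Longrightarrow> y \<in> thirds v b \<Longrightarrow> c \<le> a + b \<Longrightarrow> x * y \<in> thirds v c"
  using thirds_mult[of x a y b] by (auto simp: thirds_def)

lemma thirds_mono: "x \<in> thirds v b \<Longrightarrow> a \<le> b \<Longrightarrow> x \<in> thirds v a"
  unfolding thirds_def by auto

lemma thirds_Suc: "x \<in> thirds v a \<Longrightarrow> \<not> 3 dvd a \<Longrightarrow> x \<in> thirds v (a + 1)"
  unfolding thirds_def by auto presburger

lemma thirds_mult_notin:
  "x \<notin> thirds v (a + 1) \<Longrightarrow> y \<notin> thirds v (b + 1) \<Longrightarrow> x * y \<notin> thirds v (a + b + 1)"
  unfolding thirds_def by (auto simp: v_mult)

lemma thirds_eq_0:
  assumes "\<And>a. x \<in> thirds v a"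
  shows "x = 0"
  using assms[of "3 * v x + 1"] by (simp add: thirds_def)

lemma thirds_ex: "\<exists>a. x \<in> thirds v a"
  unfolding thirds_def by auto

end

sublocale nonarch_local_field \<subseteq> discrete_valuation v
  by unfold_locales (fact v_mult, fact v_add)

section \<open>The unramified quadratic extension\<close>

context unram_setting
begin

abbreviation "v0 \<equiv> val D"
abbreviation "s \<equiv> sqrt_eps D"

lemma v0_two: "(2::'a) \<noteq> 0" "v0 2 = 0"
proof -
  have "(2::'a) \<notin> frac_ideal v0 1"
  proof
    assume two: "(2::'a) \<in> frac_ideal v0 1"
    have eq: "(0 < (p::nat) \<and> res_class v0 (of_nat p) = res_class v0 0) \<longleftrightarrow>
          0 < p \<and> of_nat p \<in> frac_ideal v0 1" for p
    proof -
      have "of_nat p \<in> res_class v0 0 \<longleftrightarrow> of_nat p \<in> frac_ideal v0 1"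
        and "of_nat p \<in> res_class v0 (of_nat p)" by (simp_all add: res_class_def)
      then show ?thesis using res_class_eq[of "of_nat p" 0] by (metis diff_zero)
    qed
    have "residue_char v0 = 2"
      unfolding residue_char_def eq
    proof (rule Least_equality)
      show "0 < (2::nat) \<and> of_nat 2 \<in> frac_ideal v0 1" using two by simp
      fix y :: nat assume y: "0 < y \<and> of_nat y \<in> frac_ideal v0 1"
      have "y \<noteq> 1" using y by (auto simp: frac_ideal_def)
      then show "2 \<le> y" using y by auto
    qed
    then show False using odd_residue_char by simp
  qed
  moreover have "(2::'a) \<in> frac_ideal v0 0"
    using frac_add[of 1 0 1] by (simp add: frac_ideal_def)
  ultimately show "(2::'a) \<noteq> 0" "v0 2 = 0" by (auto simp: frac_ideal_def)
qed

text \<open>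
  Hensel's lemma for square roots, by Newton's iteration: if \<open>eps\<close> were a square modulo the maximal
  ideal, completeness would provide a square root in the field, since the derivative \<open>2 x\<close> is a
  unit in odd residue characteristic.
\<close>

lemma eps_nonsquare_residue:
  assumes t: "t \<noteq> 0" "v0 t = 0"
  shows "t ^ 2 - eps D \<notin> frac_ideal v0 1"
proof
  assume t1: "t ^ 2 - eps D \<in> frac_ideal v0 1"
  define h where "h x = (x ^ 2 - eps D) / (2 * x)" for x
  define X where "X = rec_nat t (\<lambda>_ x. x - h x)"
  have X0: "X 0 = t" and XS: "X (Suc k) = X k - h (X k)" for k by (simp_all add: X_def)
  have hfrac: "h x \<in> frac_ideal v0 m"
    if "x \<noteq> 0" "v0 x = 0" "x ^ 2 - eps D \<in> frac_ideal v0 m" for x m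
  proof -
    have "v0 (2 * x) = 0" using that v0_two by (simp add: v_mult)
    then have "inverse (2 * x) \<in> frac_ideal v0 0"
      unfolding frac_ideal_def by (metis (mono_tags, lifting) mem_Collect_eq neg_equal_0_iff_equal order_refl v_inverse inverse_zero)
    then show ?thesis unfolding h_def divide_inverse using frac_mult[OF that(3)] by fastforce
  qed
  have inv: "X k \<noteq> 0 \<and> v0 (X k) = 0 \<and> X k ^ 2 - eps D \<in> frac_ideal v0 (int k + 1)" for k
  proof (induction k)
    case 0
    then show ?case using t t1 by (simp add: X0)
  next
    case (Suc k)
    have h: "h (X k) \<in> frac_ideal v0 (int k + 1)" using hfrac Suc.IH by blast
    have "X (Suc k) \<noteq> 0 \<and> v0 (X (Suc k)) = 0"
    proof (cases "h (X k) = 0")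
      case False
      then have "v0 (X k) < v0 (- h (X k))" using h Suc.IH by (auto simp: frac_ideal_def)
      from v_add_less[OF _ _ this] show ?thesis using Suc.IH False by (simp add: XS)
    qed (use Suc.IH in \<open>simp add: XS\<close>)
    \<comment> \<open>the error of the next step is the square of the correction\<close>
    moreover have "X (Suc k) ^ 2 - eps D = h (X k) * h (X k)"
    proof -
      have "2 * X k * h (X k) = X k ^ 2 - eps D"
        using Suc.IH v0_two by (simp add: h_def)
      then show ?thesis by (simp add: XS power2_eq_square algebra_simps)
    qed
    moreover have "h (X k) * h (X k) \<in> frac_ideal v0 (int (Suc k) + 1)"
      using frac_mono[OF frac_mult[OF h h]] by simp
    ultimately show ?case by simp
  qed
  have step: "X (n + j) - X n \<in> frac_ideal v0 (int n + 1)" for n j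
  proof (induction j)
    case (Suc j)
    have "h (X (n + j)) \<in> frac_ideal v0 (int (n + j) + 1)" using hfrac inv by blast
    then have "h (X (n + j)) \<in> frac_ideal v0 (int n + 1)" by (rule frac_mono) simp
    from frac_diff[OF Suc.IH this] show ?case by (simp add: XS algebra_simps)
  qed simp
  have "\<exists>M. \<forall>m\<ge>M. \<forall>n\<ge>M. X m - X n \<in> frac_ideal v0 N" for N
  proof (intro exI allI impI)
    fix m n assume "nat N \<le> m" "nat N \<le> n"
    then have "X m - X (nat N) \<in> frac_ideal v0 N" "X n - X (nat N) \<in> frac_ideal v0 N"
      using step[of "nat N" "m - nat N"] step[of "nat N" "n - nat N"]
      by (auto elim: frac_mono)
    from frac_diff[OF this] show "X m - X n \<in> frac_ideal v0 N" by simp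
  qed
  from v_complete[of X, OF this] obtain L
    where L: "\<forall>N. \<exists>M. \<forall>n\<ge>M. X n - L \<in> frac_ideal v0 N" by blast
  have "L ^ 2 - eps D \<in> frac_ideal v0 N" for N
  proof -
    obtain M where M: "\<forall>n\<ge>M. X n - L \<in> frac_ideal v0 (max 0 N)" using L by blast
    define k where "k = max M (nat N)"
    have d: "X k - L \<in> frac_ideal v0 (max 0 N)" using M by (simp add: k_def)
    have "X k \<in> frac_ideal v0 0" using inv by (simp add: frac_ideal_def)
    from frac_diff[OF frac_add[OF this this] frac_mono[OF d]]
    have "X k + L \<in> frac_ideal v0 0" by (simp add: algebra_simps)
    from frac_mult[OF d this] have "(X k - L) * (X k + L) \<in> frac_ideal v0 N"
      by (auto elim: frac_mono)
    moreover have "X k ^ 2 - eps D \<in> frac_ideal v0 N"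
      using inv[of k] by (auto simp: k_def elim: frac_mono)
    ultimately have "X k ^ 2 - eps D - (X k - L) * (X k + L) \<in> frac_ideal v0 N"
      by (rule frac_diff[rotated])
    moreover have "X k ^ 2 - eps D - (X k - L) * (X k + L) = L ^ 2 - eps D"
      by (simp add: power2_eq_square algebra_simps)
    ultimately show ?thesis by (simp only:)
  qed
  then have "L ^ 2 - eps D = 0" by (rule frac_eq_0)
  then show False using eps_nonsquare by auto
qed

lemma emb_0 [simp]: "emb D 0 = 0"
  using emb_add[of 0 0] by (simp only: add_0 add_cancel_right_right)

lemma emb_uminus: "emb D (- a) = - emb D a"
  using emb_add[of a "- a"] by (simp add: eq_neg_iff_add_eq_0 add.commute)

lemma emb_diff: "emb D (a - b) = emb D a - emb D b"
  using emb_add[of a "- b"] by (simp add: emb_uminus)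

lemma emb_eq_0_iff [simp]: "emb D a = 0 \<longleftrightarrow> a = 0"
proof
  assume "emb D a = 0"
  then have "emb D (a * inverse a) = 0" by (simp add: emb_mult)
  then show "a = 0" using emb_one by (cases "a = 0") auto
qed simp

lemma emb_inj [simp]: "emb D a = emb D b \<longleftrightarrow> a = b"
  using emb_eq_0_iff[of "a - b"] by (simp add: emb_diff)

lemma emb_eqI: "emb D a = emb D b \<Longrightarrow> a = b"
  by simp

lemma s_square: "s * s = emb D (eps D)"
  using sqrt_eps by (simp add: power2_eq_square)

lemma coords_eq_iff [simp]:
  "emb D a + emb D b * s = emb D c + emb D d * s \<longleftrightarrow> a = c \<and> b = d"
proof
  assume eq: "emb D a + emb D b * s = emb D c + emb D d * s"
  have "b = d"
  proof (rule ccontr)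
    assume "b \<noteq> d"
    then have nz: "emb D (b - d) \<noteq> 0" by simp
    have eq2: "emb D (b - d) * s = emb D (c - a)" using eq by (simp add: emb_diff algebra_simps)
    have "s = emb D ((c - a) / (b - d))"
    proof -
      have "emb D (b - d) * emb D ((c - a) / (b - d)) = emb D (c - a)"
        using \<open>b \<noteq> d\<close> by (simp flip: emb_mult)
      then show ?thesis using eq2 nz by (metis mult_left_cancel)
    qed
    then have "emb D (((c - a) / (b - d)) ^ 2) = emb D (eps D)"
      using s_square by (simp only: power2_eq_square emb_mult)
    then show False using eps_nonsquare emb_eqI by blast
  qed
  then show "a = c \<and> b = d" using eq by simp
qed auto

lemma F_coords: obtains a b where "x = emb D a + emb D b * s"
  using F_generated by blast

lemma cnjF_coords: "cnjF D (emb D a + emb D b * s) = emb D a - emb D b * s"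
  unfolding cnjF_def by (rule the_equality) auto

lemma cnjF_emb [simp]: "cnjF D (emb D a) = emb D a"
  using cnjF_coords[of a 0] by simp

lemma cnjF_0 [simp]: "cnjF D 0 = 0" and cnjF_1 [simp]: "cnjF D 1 = 1"
  using cnjF_emb[of 0] cnjF_emb[of 1] by (simp_all add: emb_one)

lemma cnjF_add: "cnjF D (x + y) = cnjF D x + cnjF D y"
proof -
  obtain a b c d where "x = emb D a + emb D b * s" "y = emb D c + emb D d * s"
    using F_coords by metis
  note xy = this
  have "x + y = emb D (a + c) + emb D (b + d) * s"
    by (simp add: xy emb_add algebra_simps)
  then have "cnjF D (x + y) = emb D (a + c) - emb D (b + d) * s"
    by (simp only: cnjF_coords)
  also have "\<dots> = cnjF D x + cnjF D y"
    unfolding xy cnjF_coords by (simp add: emb_add algebra_simps)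
  finally show ?thesis .
qed

lemma cnjF_mult: "cnjF D (x * y) = cnjF D x * cnjF D y"
proof -
  obtain a b c d where xy: "x = emb D a + emb D b * s" "y = emb D c + emb D d * s"
    using F_coords by metis
  have "x * y = emb D (a * c + b * d * eps D) + emb D (a * d + b * c) * s"
    unfolding xy by (simp add: emb_add emb_mult algebra_simps flip: s_square)
  moreover have "cnjF D x * cnjF D y
      = emb D (a * c + b * d * eps D) - emb D (a * d + b * c) * s"
    unfolding xy cnjF_coords by (simp add: emb_add emb_mult algebra_simps flip: s_square)
  ultimately show ?thesis by (simp only: cnjF_coords)
qed

lemma cnjF_cnjF [simp]: "cnjF D (cnjF D x) = x"
proof -
  obtain a b where x: "x = emb D a + emb D b * s" using F_coords by metis
  show ?thesis using cnjF_coords[of a "- b"] by (simp add: x cnjF_coords emb_uminus)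
qed

lemma cnjF_uminus: "cnjF D (- x) = - cnjF D x"
  using cnjF_add[of x "- x"] by (simp add: eq_neg_iff_add_eq_0 add.commute)

lemma cnjF_diff: "cnjF D (x - y) = cnjF D x - cnjF D y"
  using cnjF_add[of x "- y"] by (simp add: cnjF_uminus)

lemma cnjF_sum: "cnjF D (sum f I) = (\<Sum>i\<in>I. cnjF D (f i))"
  by (induction I rule: infinite_finite_induct) (simp_all add: cnjF_add)

lemma cnjF_eq_0_iff [simp]: "cnjF D x = 0 \<longleftrightarrow> x = 0"
  by (metis cnjF_cnjF cnjF_0)

lemma normF_coords: "normF D (emb D a + emb D b * s) = a ^ 2 - eps D * b ^ 2"
proof -
  have "emb D (a ^ 2 - eps D * b ^ 2)
      = (emb D a + emb D b * s) * cnjF D (emb D a + emb D b * s)"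
    unfolding cnjF_coords
    by (simp add: emb_diff emb_mult power2_eq_square algebra_simps flip: s_square)
  then show ?thesis unfolding normF_def by (metis (mono_tags, lifting) emb_eqI the_equality)
qed

lemma emb_normF: "emb D (normF D x) = x * cnjF D x"
proof -
  obtain a b where x: "x = emb D a + emb D b * s" using F_coords by metis
  show ?thesis unfolding x normF_coords cnjF_coords
    by (simp add: emb_diff emb_mult power2_eq_square algebra_simps flip: s_square)
qed

lemma normF_mult: "normF D (x * y) = normF D x * normF D y"
  by (rule emb_eqI) (simp add: emb_mult emb_normF cnjF_mult)

lemma normF_eq_0_iff [simp]: "normF D x = 0 \<longleftrightarrow> x = 0"
  using emb_eq_0_iff[of "normF D x"] emb_normF[of x] by (metis cnjF_eq_0_iff mult_eq_0_iff)

lemma normF_cnjF: "normF D (cnjF D x) = normF D x"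
  by (rule emb_eqI) (simp add: emb_normF mult.commute)

lemma emb_two: "emb D 2 = 2"
  using emb_add[of 1 1] by (simp add: emb_one)

lemma traceF_coords: "traceF D (emb D a + emb D b * s) = 2 * a"
proof -
  have "emb D (2 * a) = (emb D a + emb D b * s) + cnjF D (emb D a + emb D b * s)"
    unfolding cnjF_coords by (simp add: emb_mult emb_two)
  then show ?thesis unfolding traceF_def by (metis (mono_tags, lifting) emb_eqI the_equality)
qed

lemma emb_traceF: "emb D (traceF D x) = x + cnjF D x"
proof -
  obtain a b where x: "x = emb D a + emb D b * s" using F_coords by metis
  show ?thesis unfolding x traceF_coords cnjF_coords by (simp add: emb_mult emb_two)
qed

lemma traceF_add: "traceF D (x + y) = traceF D x + traceF D y"
  by (rule emb_eqI) (simp add: emb_traceF emb_add cnjF_add algebra_simps)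

text \<open>
  The two terms of \<open>a\<^sup>2 - eps * b\<^sup>2\<close> cannot cancel to first order, which is what it means for the
  extension to be unramified; so the valuation of an element is the smaller one of those of its
  two coordinates.
\<close>

lemma val_normF:
  assumes "a \<noteq> 0" "b \<noteq> 0"
  shows "v0 (a ^ 2 - eps D * b ^ 2) = 2 * min (v0 a) (v0 b)"
proof -
  have va: "v0 (a ^ 2) = 2 * v0 a" and vb: "v0 (- (eps D * b ^ 2)) = 2 * v0 b"
    using assms eps_unit by (simp_all add: v_power v_mult)
  have nz: "a ^ 2 \<noteq> 0" "- (eps D * b ^ 2) \<noteq> 0" using assms eps_unit by simp_all
  consider "v0 a < v0 b" | "v0 b < v0 a" | "v0 a = v0 b" by linarith
  then show ?thesis
  proof cases
    case 1
    then show ?thesis using v_add_less(2)[OF nz] va vb by simp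
  next
    case 2
    then show ?thesis using v_add_less(2)[OF nz(2) nz(1)] va vb by simp
  next
    case 3
    define t where "t = a / b"
    have t: "t \<noteq> 0" "v0 t = 0" using 3 assms by (simp_all add: t_def v_divide)
    have "t ^ 2 \<in> frac_ideal v0 0" "eps D \<in> frac_ideal v0 0"
      using t eps_unit by (simp_all add: frac_ideal_def v_power)
    from frac_diff[OF this] eps_nonsquare_residue[OF t]
    have u: "t ^ 2 - eps D \<noteq> 0" "v0 (t ^ 2 - eps D) = 0" by (auto simp: frac_ideal_def)
    have "a ^ 2 - eps D * b ^ 2 = b ^ 2 * (t ^ 2 - eps D)"
      using assms by (simp add: t_def field_simps)
    then show ?thesis using u assms 3 by (simp add: v_mult v_power)
  qed
qed

abbreviation "vF \<equiv> valF D"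

lemma frac_coords:
  "emb D a + emb D b * s \<in> frac_ideal vF m \<longleftrightarrow> a \<in> frac_ideal v0 m \<and> b \<in> frac_ideal v0 m"
proof -
  have "emb D a + emb D b * s = 0 \<longleftrightarrow> a = 0 \<and> b = 0" using coords_eq_iff[of a b 0 0] by simp
  moreover have "vF (emb D a + emb D b * s) =
      (if b = 0 then v0 a else if a = 0 then v0 b else min (v0 a) (v0 b))"
    if "\<not> (a = 0 \<and> b = 0)"
    unfolding valF_def normF_coords
    using that val_normF[of a b] eps_unit by (auto simp: v_power v_mult)
  ultimately show ?thesis by (cases "a = 0"; cases "b = 0") (simp_all add: frac_ideal_def)
qed

lemma normF_even: "x \<noteq> 0 \<Longrightarrow> v0 (normF D x) = 2 * vF x"
proof -
  assume "x \<noteq> 0"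
  obtain a b where x: "x = emb D a + emb D b * s" using F_coords by metis
  have "even (v0 (normF D x))" unfolding x normF_coords
    using \<open>x \<noteq> 0\<close> val_normF[of a b] eps_unit x
    by (cases "a = 0"; cases "b = 0") (auto simp: v_power v_mult)
  then show ?thesis by (simp add: valF_def)
qed

end

sublocale unram_setting \<subseteq> F: discrete_valuation "valF D"
proof
  fix x y :: 'f assume nz: "x \<noteq> 0" "y \<noteq> 0"
  have "2 * vF (x * y) = 2 * vF x + 2 * vF y"
    using nz by (simp add: normF_mult v_mult flip: normF_even)
  then show "vF (x * y) = vF x + vF y" by simp
  assume nz2: "x + y \<noteq> 0"
  obtain a b c d where xy: "x = emb D a + emb D b * s" "y = emb D c + emb D d * s"
    using F_coords by metis
  define m where "m = min (vF x) (vF y)"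
  have "x \<in> frac_ideal vF m" "y \<in> frac_ideal vF m" by (simp_all add: frac_ideal_def m_def)
  then have "emb D (a + c) + emb D (b + d) * s \<in> frac_ideal vF m"
    unfolding xy frac_coords by (auto intro: frac_add)
  moreover have "emb D (a + c) + emb D (b + d) * s = x + y"
    by (simp add: xy emb_add algebra_simps)
  ultimately show "min (vF x) (vF y) \<le> vF (x + y)"
    using nz2 by (simp add: frac_ideal_def m_def)
qed

context unram_setting
begin

abbreviation "th \<equiv> thirds vF"

lemma vF_cnjF [simp]: "vF (cnjF D x) = vF x"
  by (simp add: valF_def normF_cnjF)

lemma thirds_cnjF [simp]: "cnjF D x \<in> th a \<longleftrightarrow> x \<in> th a"
  by (simp add: thirds_def)

lemma vF_emb: "a \<noteq> 0 \<Longrightarrow> vF (emb D a) = v0 a"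
  using normF_coords[of a 0] by (simp add: valF_def v_power)

lemma unifF: "unifF D \<noteq> 0" "vF (unifF D) = 1"
  using unif by (simp_all add: unifF_def vF_emb)

lemma F_two: "(2::'f) \<noteq> 0" "vF 2 = 0"
  using v0_two vF_emb[of 2] emb_eq_0_iff[of 2] by (simp_all add: emb_two)

lemma thirds_half: "x / 2 \<in> th a \<longleftrightarrow> x \<in> th a"
  using F_two by (cases "x = 0") (simp_all add: thirds_def F.v_divide)

lemma traceF_frac: "x \<in> th 1 \<Longrightarrow> traceF D x \<in> frac_ideal v0 1"
proof -
  assume x1: "x \<in> th 1"
  obtain a b where x: "x = emb D a + emb D b * s" using F_coords by metis
  have "a \<in> frac_ideal v0 1" using x1 unfolding x F.thirds_frac_1 frac_coords by simp
  then show ?thesis unfolding x traceF_coords mult_2 by (intro frac_add)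
qed

lemma Omega_0 [simp]: "Omega D 0 = 1"
  by (intro Omega_trivial) simp

lemma Omega_nonzero [simp]: "Omega D a \<noteq> 0"
  using Omega_add[of a "- a"] by auto

lemma Omega_traceF_trivial: "x \<in> th 1 \<Longrightarrow> Omega D (traceF D x) = 1"
  by (intro Omega_trivial traceF_frac)

lemma Omega_traceF_cong:
  assumes "x - y \<in> th 1"
  shows "Omega D (traceF D x) = Omega D (traceF D y)"
  using Omega_traceF_trivial[OF assms] Omega_add[of "traceF D (x - y)" "traceF D y"]
  by (simp flip: traceF_add)

text \<open>
  The conductor of \<open>\<Omega> \<circ> tr\<close> on the quadratic extension is again the maximal ideal: a
  multiple of any given element outside it is \<open>a/2\<close> with \<open>\<Omega> a \<noteq> 1\<close>, and its trace is \<open>a\<close>.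
\<close>

lemma Omega_traceF_nondegenerate:
  assumes "\<And>a. a \<in> th 0 \<Longrightarrow> Omega D (traceF D (a * x)) = 1"
  shows "x \<in> th 1"
proof (rule ccontr)
  assume x: "x \<notin> th 1"
  then have x0: "x \<noteq> 0" "vF x \<le> 0" by (auto simp: thirds_def)
  obtain a where a: "a \<in> frac_ideal v0 0" "Omega D a \<noteq> 1" using Omega_nontrivial by blast
  have "a / 2 \<in> frac_ideal v0 0" using a(1) v0_two
    by (cases "a = 0") (simp_all add: frac_ideal_def v_divide)
  then have "emb D (a / 2) / x \<in> th 0"
    using x0 vF_emb[of "a / 2"]
    by (cases "a = 0") (simp_all add: v0_two thirds_def frac_ideal_def F.v_divide)
  then have "Omega D (traceF D (emb D (a / 2))) = 1" using assms x0 by fastforce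
  moreover have "traceF D (emb D (a / 2)) = a"
    using traceF_coords[of "a / 2" 0] v0_two by simp
  ultimately show False using a by simp
qed

end

section \<open>The unitary group in coordinates\<close>

lemma matrix_diff_ldistrib: "A ** (B - C) = A ** B - A ** (C :: 'b::comm_ring_1^'n^'m)"
  by (simp add: vec_eq_iff matrix_matrix_mult_def sum_subtractf algebra_simps)

lemma matrix_add_rdistrib: "(A + B) ** C = A ** C + B ** (C :: 'b::comm_ring_1^'n^'m)"
  by (simp add: vec_eq_iff matrix_matrix_mult_def sum.distrib algebra_simps)

lemma matrix_diff_rdistrib: "(A - B) ** C = A ** C - B ** (C :: 'b::comm_ring_1^'n^'m)"
  by (simp add: vec_eq_iff matrix_matrix_mult_def sum_subtractf algebra_simps)

lemmas matrix_distribs =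
  matrix_add_ldistrib matrix_add_rdistrib matrix_diff_ldistrib matrix_diff_rdistrib

lemma matrix_mult_nth: "(A ** B) $ i $ j = (\<Sum>k\<in>UNIV. A $ i $ k * B $ k $ j)"
  by (simp add: matrix_matrix_mult_def)

lemma matrix_vector_nth: "(A *v x) $ i = (\<Sum>k\<in>UNIV. A $ i $ k * x $ k)"
  by (simp add: matrix_vector_mult_def)

lemma matrix_inv_unique:
  fixes A B :: "'b::field^'n^'n"
  assumes "A ** B = mat 1"
  shows "matrix_inv A = B"
proof -
  have BA: "B ** A = mat 1" using assms matrix_left_right_inverse by blast
  then have "\<exists>C. A ** C = mat 1 \<and> C ** A = mat 1" using assms by blast
  then have "matrix_inv A ** A = mat 1"
    unfolding matrix_inv_def by (rule someI2_ex) blast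
  then have "matrix_inv A ** (A ** B) = B" by (simp add: matrix_mul_assoc)
  then show ?thesis using assms by simp
qed

text \<open>
  With the indices \<open>1, 2, 3, 4\<close> read modulo 4, the involution \<open>i \<mapsto> 5 - i\<close> is \<open>i \<mapsto> 1 - i\<close>; the
  form pairs the basis vectors that it exchanges.
\<close>

lemma matH_nth: "matH $ i $ j = (if j = 1 - i then 1 else (0::'b::field))"
  using exhaust_4[of i] exhaust_4[of j] by (elim disjE) (simp_all add: matH_def mat_unit_def)

lemma sum_star: "(\<Sum>k\<in>UNIV. f (1 - k)) = (\<Sum>k\<in>(UNIV::4 set). f k)"
  by (rule sum.reindex_bij_witness[of _ "\<lambda>k. 1 - k" "\<lambda>k. 1 - k"]) auto

lemma matH_mult_left: "(matH ** X) $ i $ j = (X $ (1 - i) $ j :: 'b::field)"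
  by (simp add: matrix_mult_nth matH_nth if_distrib[of "\<lambda>x. x * _"] cong: if_cong)

lemma matH_mult_right: "(X ** matH) $ i $ j = (X $ i $ (1 - j) :: 'b::field)"
proof -
  have "(j = 1 - k) = (k = 1 - j)" for k by auto
  then show ?thesis
    by (simp add: matrix_mult_nth matH_nth if_distrib[of "\<lambda>x. _ * x"] cong: if_cong)
qed

lemma matH_square: "matH ** matH = (mat 1 :: 'b::field^4^4)"
  by (simp add: vec_eq_iff matH_mult_left matH_nth mat_def)

context unram_setting
begin

lemma sigma_nth: "sigma D X $ i $ j = cnjF D (X $ (1 - j) $ (1 - i))"
  by (simp add: sigma_def matrix_inv_unique[OF matH_square] matH_mult_left matH_mult_right
      transpose_def map_matrix_def flip: matrix_mul_assoc)

lemma sigma_mult: "sigma D (X ** Y) = sigma D Y ** sigma D X"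
proof -
  have "(\<Sum>k\<in>UNIV. cnjF D (X $ j $ k) * cnjF D (Y $ k $ i))
      = (\<Sum>k\<in>UNIV. cnjF D (Y $ (1 - k) $ i) * cnjF D (X $ j $ (1 - k)))" for i j
    by (subst sum_star[of "\<lambda>k. cnjF D (Y $ k $ i) * cnjF D (X $ j $ k)"])
      (simp add: mult.commute)
  then show ?thesis
    by (simp add: vec_eq_iff sigma_nth matrix_mult_nth cnjF_sum cnjF_mult)
qed

lemma sigma_add: "sigma D (X + Y) = sigma D X + sigma D Y"
  by (simp add: vec_eq_iff sigma_nth cnjF_add)

lemma sigma_diff: "sigma D (X - Y) = sigma D X - sigma D Y"
  by (simp add: vec_eq_iff sigma_nth cnjF_diff)

lemma sigma_sigma [simp]: "sigma D (sigma D X) = X"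
  by (simp add: vec_eq_iff sigma_nth)

lemma sigma_one [simp]: "sigma D (mat 1) = mat 1"
  by (simp add: vec_eq_iff sigma_nth mat_def)

lemma trace_sigma: "trace (sigma D X) = cnjF D (trace X)"
  using sum_star[of "\<lambda>k. cnjF D (X $ k $ k)"] by (simp add: trace_def sigma_nth cnjF_sum)

lemma lie_iff: "X \<in> lie_U22 D \<longleftrightarrow> sigma D X = - X"
  by (simp add: lie_U22_def eq_neg_iff_add_eq_0 add.commute)

lemma U22_I:
  assumes "g ** h = mat 1" "sigma D g = h"
  shows "g \<in> U22 D"
  using assms matrix_left_right_inverse[of g h] by (auto simp: U22_def invertible_def)

lemma U22_inverse:
  assumes "g \<in> U22 D"
  shows "g ** sigma D g = mat 1" "sigma D g ** g = mat 1" "matrix_inv g = sigma D g"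
proof -
  show gg: "g ** sigma D g = mat 1" using assms by (simp add: U22_def)
  show "sigma D g ** g = mat 1" using gg matrix_left_right_inverse by blast
  show "matrix_inv g = sigma D g" using gg by (rule matrix_inv_unique)
qed

lemma U22_one: "mat 1 \<in> U22 D"
  by (rule U22_I[of _ "mat 1"]) simp_all

lemma U22_sigma: "g \<in> U22 D \<Longrightarrow> sigma D g \<in> U22 D"
  by (rule U22_I[of _ g]) (simp_all add: U22_inverse)

lemma U22_mult: "g \<in> U22 D \<Longrightarrow> h \<in> U22 D \<Longrightarrow> g ** h \<in> U22 D"
proof (rule U22_I[of _ "sigma D h ** sigma D g"])
  assume gh: "g \<in> U22 D" "h \<in> U22 D"
  have "g ** h ** (sigma D h ** sigma D g) = g ** (h ** sigma D h) ** sigma D g"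
    by (simp add: matrix_mul_assoc)
  then show "g ** h ** (sigma D h ** sigma D g) = mat 1" using gh by (simp add: U22_inverse)
qed (simp add: sigma_mult)

lemma herm_eq: "herm D x y = (\<Sum>i\<in>UNIV. cnjF D (x $ i) * y $ (1 - i))"
  by (simp add: herm_def matH_nth if_distrib[of "\<lambda>x. _ * x"] if_distrib[of "\<lambda>x. x * _"]
      cong: if_cong)

lemma herm_mult_left: "herm D (X *v x) y = herm D x (sigma D X *v y)"
proof -
  have "herm D (X *v x) y
      = (\<Sum>i\<in>UNIV. \<Sum>k\<in>UNIV. cnjF D (X $ i $ k) * cnjF D (x $ k) * y $ (1 - i))"
    by (simp add: herm_eq matrix_vector_nth cnjF_sum cnjF_mult sum_distrib_right)
  also have "\<dots> = (\<Sum>k\<in>UNIV. \<Sum>i\<in>UNIV. cnjF D (X $ i $ k) * cnjF D (x $ k) * y $ (1 - i))"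
    by (rule sum.swap)
  also have "\<dots> = (\<Sum>k\<in>UNIV. \<Sum>i\<in>UNIV. cnjF D (X $ (1 - i) $ k) * cnjF D (x $ k) * y $ i)"
    using sum_star[of "\<lambda>i. cnjF D (X $ (1 - i) $ k) * cnjF D (x $ k) * y $ i" for k] by simp
  also have "\<dots> = herm D x (sigma D X *v y)"
    by (simp add: herm_eq matrix_vector_nth sigma_nth sum_distrib_left mult_ac)
  finally show ?thesis .
qed

lemma herm_U22: "g \<in> U22 D \<Longrightarrow> herm D (g *v x) (g *v y) = herm D x y"
  by (simp add: herm_mult_left matrix_vector_mul_assoc U22_inverse)

end

section \<open>Lattice sequences that are split by the standard basis\<close>

text \<open>
  Both lattice sequences of the theorem have period 3 and are split by the standard basis: the basis
  vector \<open>e\<^sub>i\<close> enters at a place \<open>sl i\<close>. Self-duality says that the places of the two members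
  of a hyperbolic pair have a constant sum. Measuring valuations in thirds, as \<open>thirds\<close> does, turns
  membership in lattices and in the filtration of the matrix algebra into entrywise conditions
  without rounding.
\<close>

locale split_sequence = unram_setting D for D :: "('a::field, 'f::field) unram_data" +
  fixes \<Lambda> :: "int \<Rightarrow> ('f^4) set" and sl :: "4 \<Rightarrow> int" and S :: int
  assumes Lambda: "\<Lambda> m = {x. \<forall>i. x $ i \<in> th (m - sl i)}"
    and sl_dual: "sl i + sl (1 - i) = S"
begin

lemma Lambda_mono: "a \<le> b \<Longrightarrow> \<Lambda> b \<subseteq> \<Lambda> a"
  unfolding Lambda by clarify (meson F.thirds_mono diff_right_mono)

lemma Lambda_ex: "\<exists>m. x \<in> \<Lambda> m"
proof -
  have "\<forall>i. \<exists>a. x $ i \<in> th a" using F.thirds_ex by blast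
  then obtain a where a: "\<And>i. x $ i \<in> th (a i)" by metis
  define m where "m = Min ((\<lambda>i. a i + sl i) ` UNIV)"
  have "m - sl i \<le> a i" for i
  proof -
    have "m \<le> a i + sl i" unfolding m_def by (rule Min_le) auto
    then show ?thesis by simp
  qed
  then have "x \<in> \<Lambda> m" unfolding Lambda using a F.thirds_mono by blast
  then show ?thesis ..
qed

lemma Lambda_eq_0:
  assumes "\<And>m. m \<ge> m0 \<Longrightarrow> x \<in> \<Lambda> m"
  shows "x = 0"
proof -
  have "x $ i \<in> th a" for i a
  proof -
    have "x \<in> \<Lambda> (max m0 (a + sl i))" using assms by simp
    then have "x $ i \<in> th (max m0 (a + sl i) - sl i)" by (simp add: Lambda)
    then show ?thesis by (rule F.thirds_mono) simp
  qed
  then have "x $ i = 0" for i by (rule F.thirds_eq_0)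
  then show ?thesis by (simp add: vec_eq_iff)
qed

lemma filt_iff: "X \<in> filt \<Lambda> k \<longleftrightarrow> (\<forall>i j. X $ i $ j \<in> th (k + sl j - sl i))"
proof
  assume X: "X \<in> filt \<Lambda> k"
  show "\<forall>i j. X $ i $ j \<in> th (k + sl j - sl i)"
  proof (intro allI)
    fix i j
    have "axis j 1 \<in> \<Lambda> (sl j)" unfolding Lambda by (auto simp: axis_def thirds_def)
    then have "X *v axis j 1 \<in> \<Lambda> (sl j + k)" using X unfolding filt_def by blast
    then have "(X *v axis j 1) $ i \<in> th (sl j + k - sl i)" unfolding Lambda by blast
    moreover have "(X *v axis j 1) $ i = X $ i $ j"
      by (simp add: matrix_vector_nth axis_def if_distrib[of "\<lambda>x. _ * x"] cong: if_cong)
    ultimately show "X $ i $ j \<in> th (k + sl j - sl i)" by (simp add: add.commute)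
  qed
next
  assume X: "\<forall>i j. X $ i $ j \<in> th (k + sl j - sl i)"
  show "X \<in> filt \<Lambda> k"
    unfolding filt_def
  proof (clarify)
    fix m x assume "x \<in> \<Lambda> m"
    then have "x $ j \<in> th (m - sl j)" for j unfolding Lambda by blast
    then have "(X *v x) $ i \<in> th (m + k - sl i)" for i
      unfolding matrix_vector_nth
      by (intro F.thirds_sum F.thirds_mult'[OF X[rule_format]]) auto
    then show "X *v x \<in> \<Lambda> (m + k)" unfolding Lambda by blast
  qed
qed

lemma filt_vector: "X \<in> filt \<Lambda> k \<Longrightarrow> x \<in> \<Lambda> m \<Longrightarrow> X *v x \<in> \<Lambda> (m + k)"
  unfolding filt_def by blast

lemma filt_mono: "X \<in> filt \<Lambda> b \<Longrightarrow> a \<le> b \<Longrightarrow> X \<in> filt \<Lambda> a"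
  unfolding filt_iff
  by (meson F.thirds_mono add_le_cancel_right diff_right_mono)

lemma filt_add: "X \<in> filt \<Lambda> k \<Longrightarrow> Y \<in> filt \<Lambda> k \<Longrightarrow> X + Y \<in> filt \<Lambda> k"
  unfolding filt_iff by (auto intro: F.thirds_add)

lemma filt_diff: "X \<in> filt \<Lambda> k \<Longrightarrow> Y \<in> filt \<Lambda> k \<Longrightarrow> X - Y \<in> filt \<Lambda> k"
  unfolding filt_iff by (auto intro: F.thirds_diff)

lemma filt_uminus: "X \<in> filt \<Lambda> k \<Longrightarrow> - X \<in> filt \<Lambda> k"
  unfolding filt_iff by auto

lemma filt_one: "mat 1 \<in> filt \<Lambda> 0"
  unfolding filt_def by (auto simp: image_def)

lemma filt_mult: "X \<in> filt \<Lambda> a \<Longrightarrow> Y \<in> filt \<Lambda> b \<Longrightarrow> X ** Y \<in> filt \<Lambda> (a + b)"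
  unfolding filt_def by (auto simp flip: matrix_vector_mul_assoc simp: image_subset_iff add_ac)
    (metis add.assoc add.commute)

lemma filt_mult': "X \<in> filt \<Lambda> a \<Longrightarrow> Y \<in> filt \<Lambda> b \<Longrightarrow> c \<le> a + b \<Longrightarrow> X ** Y \<in> filt \<Lambda> c"
  using filt_mult filt_mono by blast

lemma filt_sigma: "X \<in> filt \<Lambda> k \<Longrightarrow> sigma D X \<in> filt \<Lambda> k"
  unfolding filt_iff
proof (intro allI)
  fix i j assume X: "\<forall>i j. X $ i $ j \<in> th (k + sl j - sl i)"
  have "k + sl (1 - i) - sl (1 - j) = k + sl j - sl i" using sl_dual[of i] sl_dual[of j] by simp
  then show "sigma D X $ i $ j \<in> th (k + sl j - sl i)"
    unfolding sigma_nth thirds_cnjF using X by metis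
qed

lemma trace_filt: "X \<in> filt \<Lambda> 1 \<Longrightarrow> trace X \<in> th 1"
  unfolding trace_def filt_iff by (intro F.thirds_sum) (metis add_diff_cancel_right')

lemma herm_Lambda: "x \<in> \<Lambda> a \<Longrightarrow> y \<in> \<Lambda> b \<Longrightarrow> herm D x y \<in> th (a + b - S)"
  unfolding herm_eq
proof (rule F.thirds_sum)
  fix i assume "x \<in> \<Lambda> a" "y \<in> \<Lambda> b"
  then have "cnjF D (x $ i) \<in> th (a - sl i)" "y $ (1 - i) \<in> th (b - sl (1 - i))"
    unfolding Lambda by auto
  then show "cnjF D (x $ i) * y $ (1 - i) \<in> th (a + b - S)"
    using sl_dual[of i] by (auto intro: F.thirds_mult')
qed

abbreviation "P \<equiv> grp_filt D \<Lambda>"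

lemma P_0_iff: "g \<in> P 0 \<longleftrightarrow> g \<in> U22 D \<and> g \<in> filt \<Lambda> 0"
  by (simp add: grp_filt_def)

lemma P_Suc_iff: "g \<in> P (Suc r) \<longleftrightarrow> g \<in> U22 D \<and> g - mat 1 \<in> filt \<Lambda> (int (Suc r))"
proof -
  have "(\<exists>X. g = mat 1 + X \<and> X \<in> filt \<Lambda> k) \<longleftrightarrow> g - mat 1 \<in> filt \<Lambda> k" for k
    by (metis add_diff_cancel_left' add.commute diff_add_cancel)
  then show ?thesis by (auto simp: grp_filt_def)
qed

lemma P_subset_P0: "P (Suc r) \<subseteq> P 0"
proof
  fix g assume "g \<in> P (Suc r)"
  then have g: "g \<in> U22 D" "g - mat 1 \<in> filt \<Lambda> (int (Suc r))" by (auto simp: P_Suc_iff)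
  have "(g - mat 1) + mat 1 \<in> filt \<Lambda> 0"
    by (intro filt_add filt_one filt_mono[OF g(2)]) simp
  then show "g \<in> P 0" using g by (simp add: P_0_iff)
qed

lemma P0_sigma: "g \<in> P 0 \<Longrightarrow> sigma D g \<in> P 0"
  by (simp add: P_0_iff U22_sigma filt_sigma)

lemma P_mult: "g \<in> P (Suc r) \<Longrightarrow> h \<in> P (Suc r) \<Longrightarrow> g ** h \<in> P (Suc r)"
proof -
  assume gh: "g \<in> P (Suc r)" "h \<in> P (Suc r)"
  then have "g \<in> filt \<Lambda> 0" using P_subset_P0 P_0_iff by blast
  then have "g ** (h - mat 1) + (g - mat 1) \<in> filt \<Lambda> (int (Suc r))"
    using gh by (intro filt_add) (auto simp: P_Suc_iff intro: filt_mult')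
  moreover have "g ** (h - mat 1) + (g - mat 1) = g ** h - mat 1" by (simp add: matrix_distribs)
  ultimately show ?thesis using gh by (simp add: P_Suc_iff U22_mult)
qed

lemma P_sigma: "g \<in> P (Suc r) \<Longrightarrow> sigma D g \<in> P (Suc r)"
  using filt_sigma[of "g - mat 1"] by (simp add: P_Suc_iff U22_sigma sigma_diff)

lemma P_conj:
  assumes g: "g \<in> P 0" and x: "x \<in> P (Suc r)"
  shows "sigma D g ** x ** g \<in> P (Suc r)"
proof -
  have "sigma D g ** (x - mat 1) ** g \<in> filt \<Lambda> (int (Suc r))"
  proof (rule filt_mult')
    show "sigma D g ** (x - mat 1) \<in> filt \<Lambda> (int (Suc r))"
      using P0_sigma[OF g] x by (intro filt_mult'[of _ 0 _ "int (Suc r)"]) (auto simp: P_0_iff P_Suc_iff)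
    show "g \<in> filt \<Lambda> 0" using g by (simp add: P_0_iff)
  qed simp
  moreover have "sigma D g ** (x - mat 1) ** g = sigma D g ** x ** g - mat 1"
    using g by (simp add: matrix_distribs P_0_iff U22_inverse)
  ultimately show ?thesis using g x by (simp add: P_0_iff P_Suc_iff U22_mult U22_sigma)
qed

text \<open>
  If \<open>y\<close> raises the filtration then \<open>1 - y\<close> is injective, because \<open>v = y v\<close> forces \<open>v\<close> down the whole
  sequence; and its inverse preserves the filtration, because a solution of \<open>v = u + y v\<close> climbs
  to the level of \<open>u\<close>. This replaces the geometric series.
\<close>

lemma one_minus_invertible:
  assumes y: "y \<in> filt \<Lambda> 1"
  obtains z where "z ** (mat 1 - y) = mat 1"
proof -
  have "v = 0" if v: "(mat 1 - y) *v v = 0" for v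
  proof -
    have fix_v: "v = y *v v" using v by (simp add: matrix_vector_mult_diff_rdistrib)
    obtain m where m: "v \<in> \<Lambda> m" using Lambda_ex by blast
    have climb: "v \<in> \<Lambda> (m + int k)" for k
    proof (induction k)
      case (Suc k)
      have "y *v v \<in> \<Lambda> (m + int k + 1)" using filt_vector[OF y Suc] .
      then have "v \<in> \<Lambda> (m + int k + 1)" by (subst fix_v)
      then show ?case by (simp only: of_nat_Suc add.assoc) (simp only: add.commute)
    qed (use m in simp)
    have "v \<in> \<Lambda> k" if "k \<ge> m" for k
      using climb[of "nat (k - m)"] that by simp
    then show "v = 0" by (rule Lambda_eq_0)
  qed
  then have "\<exists>z. z ** (mat 1 - y) = mat 1"
    unfolding matrix_left_invertible_ker by (intro allI impI)
  then show thesis using that by (elim exE)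
qed

lemma one_minus_inverse_filt:
  assumes y: "y \<in> filt \<Lambda> 1" and z: "z ** (mat 1 - y) = mat 1"
  shows "z \<in> filt \<Lambda> 0"
  unfolding filt_def
proof (clarify)
  fix i u assume u: "u \<in> \<Lambda> i"
  define w where "w = z *v u"
  have "(mat 1 - y) ** z = mat 1" using z matrix_left_right_inverse by blast
  then have "(mat 1 - y) *v w = u" by (simp add: w_def matrix_vector_mul_assoc)
  then have w_eq: "w = u + y *v w" by (simp add: matrix_vector_mult_diff_rdistrib algebra_simps)
  have climb: "w \<in> \<Lambda> (i - int k) \<Longrightarrow> w \<in> \<Lambda> i" for k
  proof (induction k)
    case (Suc k)
    have "y *v w \<in> \<Lambda> (i - int k)" using filt_vector[OF y Suc.prems] by simp
    moreover have "u \<in> \<Lambda> (i - int k)" using u Lambda_mono[of "i - int k" i] by auto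
    ultimately have "u + y *v w \<in> \<Lambda> (i - int k)" unfolding Lambda by (auto intro: F.thirds_add)
    then show ?case using Suc.IH w_eq by simp
  qed simp
  obtain m where "w \<in> \<Lambda> m" using Lambda_ex by blast
  then have "w \<in> \<Lambda> (i - int (nat (i - m)))"
    using Lambda_mono[of "i - int (nat (i - m))" m] by auto
  then have "w \<in> \<Lambda> i" by (rule climb)
  then show "z *v u \<in> \<Lambda> (i + 0)" by (simp add: w_def)
qed

text \<open>
  The Cayley transform \<open>(1 - y)\<inverse> (1 + y) = 1 + (1 - y)\<inverse> 2 y\<close> carries the Lie algebra to
  the group, and to first order it is \<open>1 + 2 y\<close>.
\<close>

lemma cayley_U22:
  assumes "y \<in> lie_U22 D" and z: "z ** (mat 1 - y) = mat 1"
  shows "mat 1 + z ** (y + y) \<in> U22 D"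
proof (rule U22_I[OF _ refl])
  have p: "mat 1 + z ** (y + y) = z ** (mat 1 + y)"
  proof -
    have "mat 1 + y = (mat 1 - y) + (y + y)" by simp
    then show ?thesis using z by (metis matrix_add_ldistrib)
  qed
  have sy: "sigma D y = - y" using assms lie_iff by blast
  have s1: "sigma D (mat 1 + y) = mat 1 - y" by (simp add: sigma_add sy)
  have "sigma D (z ** (mat 1 - y)) = mat 1" by (simp only: z sigma_one)
  then have sz: "(mat 1 + y) ** sigma D z = mat 1" by (simp add: sigma_mult sigma_diff sy)
  have "z ** (mat 1 + y) ** ((mat 1 - y) ** sigma D z)
      = z ** ((mat 1 + y) ** (mat 1 - y)) ** sigma D z" by (simp add: matrix_mul_assoc)
  also have "(mat 1 + y) ** (mat 1 - y) = (mat 1 - y) ** (mat 1 + y)"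
    by (simp add: matrix_distribs)
  also have "z ** ((mat 1 - y) ** (mat 1 + y)) ** sigma D z
      = (z ** (mat 1 - y)) ** ((mat 1 + y) ** sigma D z)" by (simp add: matrix_mul_assoc)
  finally show "(mat 1 + z ** (y + y)) ** sigma D (mat 1 + z ** (y + y)) = mat 1"
    by (simp only: p sigma_mult s1 z sz matrix_mul_lid)
qed

lemma psi_cayley:
  assumes y: "y \<in> filt \<Lambda> (int (Suc r))" and z: "z ** (mat 1 - y) = mat 1"
    and \<beta>: "\<beta> \<in> filt \<Lambda> (- int n)" and n: "n \<le> 2 * r + 1"
  shows "psi D \<beta> (mat 1 + z ** (y + y)) = Omega D (traceF D (trace (\<beta> ** (y + y))))"
proof -
  have zf: "z \<in> filt \<Lambda> 0" using one_minus_inverse_filt[OF filt_mono[OF y] z] by simp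
  have "z ** (y + y) = (y + y) + z ** y ** (y + y)"
  proof -
    have "z ** (mat 1 - y) ** (y + y) = y + y" by (simp add: z)
    then show ?thesis by (simp add: matrix_distribs algebra_simps)
  qed
  then have "trace (\<beta> ** (z ** (y + y))) - trace (\<beta> ** (y + y))
      = trace (\<beta> ** (z ** y ** (y + y)))" by (simp add: matrix_add_ldistrib trace_add)
  also have "\<dots> \<in> th 1"
  proof (rule trace_filt)
    have "z ** y \<in> filt \<Lambda> (int (Suc r))" using filt_mult[OF zf y] by simp
    then have "z ** y ** (y + y) \<in> filt \<Lambda> (2 * int (Suc r))"
      using filt_add[OF y y] by (rule filt_mult') simp
    with \<beta> show "\<beta> ** (z ** y ** (y + y)) \<in> filt \<Lambda> 1" by (rule filt_mult') (use n in simp)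
  qed
  finally show ?thesis unfolding psi_def by (intro Omega_traceF_cong) simp
qed

text \<open>
  For \<open>n \<le> 2 r + 1\<close> the product of two elements of degree \<open>r + 1\<close> pairs with \<open>\<beta>\<close> into the maximal ideal, so
  that \<open>\<psi>\<^sub>\<beta>\<close> is multiplicative.
\<close>

lemma psi_mult:
  assumes \<beta>: "\<beta> \<in> filt \<Lambda> (- int n)" and n: "n \<le> 2 * r + 1"
    and gh: "g \<in> P (Suc r)" "h \<in> P (Suc r)"
  shows "psi D \<beta> (g ** h) = psi D \<beta> g * psi D \<beta> h"
proof -
  have "g ** h - mat 1 = (g - mat 1) + (h - mat 1) + (g - mat 1) ** (h - mat 1)"
    by (simp add: matrix_distribs)
  then have "trace (\<beta> ** (g ** h - mat 1)) - (trace (\<beta> ** (g - mat 1)) + trace (\<beta> ** (h - mat 1)))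
      = trace (\<beta> ** ((g - mat 1) ** (h - mat 1)))"
    by (simp only: matrix_add_ldistrib trace_add) simp
  also have "\<dots> \<in> th 1"
  proof (rule trace_filt)
    have "(g - mat 1) ** (h - mat 1) \<in> filt \<Lambda> (2 * int (Suc r))"
      using gh by (intro filt_mult'[of _ "int (Suc r)" _ "int (Suc r)"]) (auto simp: P_Suc_iff)
    with \<beta> show "\<beta> ** ((g - mat 1) ** (h - mat 1)) \<in> filt \<Lambda> 1"
      by (rule filt_mult') (use n in simp)
  qed
  finally show ?thesis
    unfolding psi_def Omega_add[symmetric] traceF_add[symmetric] by (rule Omega_traceF_cong)
qed

end

section \<open>Leading terms\<close>

context discrete_valuation
begin

text \<open>
  Congruence modulo \<open>thirds v (a + 1)\<close> for elements of \<open>thirds v a\<close> is equality of leading terms; it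
  is compatible with products.
\<close>

lemma thirds_mult_cong:
  assumes "x - x' \<in> thirds v (a + 1)" "y - y' \<in> thirds v (b + 1)"
    and "x' \<in> thirds v a" "y \<in> thirds v b"
  shows "x * y - x' * y' \<in> thirds v (a + b + 1)"
proof -
  have "(x - x') * y + x' * (y - y') \<in> thirds v (a + b + 1)"
    using assms by (intro thirds_add) (auto intro: thirds_mult')
  then show ?thesis by (simp add: algebra_simps)
qed

lemma thirds_cong_iff:
  assumes "x - y \<in> thirds v a"
  shows "x \<in> thirds v a \<longleftrightarrow> y \<in> thirds v a"
  using thirds_add[OF assms, of y] thirds_diff[OF _ assms, of x] by auto

lemma thirds_dvd: "x \<in> thirds v a \<Longrightarrow> x \<notin> thirds v (a + 1) \<Longrightarrow> 3 dvd a"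
  using thirds_Suc by blast

end

text \<open>
  Modulo 3 the places of the basis vectors run through a cycle: \<open>p\<close> and \<open>1 - p\<close> share a
  class, which the form makes a hyperbolic plane, and \<open>l\<close>, \<open>1 - l\<close> are isotropic lines in duality.
  An element of degree \<open>-n\<close> of the filtration acts to leading order as
  line \<open>l\<close> \<open>\<rightarrow>\<close> plane \<open>\<rightarrow>\<close> line \<open>1 - l\<close> \<open>\<rightarrow>\<close> line \<open>l\<close>. Which of the two lines is \<open>l\<close> depends on \<open>n\<close> modulo 3,
  and which hyperbolic pair is the plane depends on the lattice sequence.
\<close>

locale cyclic_sequence = split_sequence D \<Lambda> sl S
  for D :: "('a::field, 'f::field) unram_data" and \<Lambda> sl S +
  fixes n :: nat and p l :: 4
  assumes UNIV_eq: "UNIV = {p, 1 - p, l, 1 - l}"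
    and dist: "p \<noteq> 1 - p" "p \<noteq> l" "p \<noteq> 1 - l" "1 - p \<noteq> l" "1 - p \<noteq> 1 - l" "l \<noteq> 1 - l"
    and plane: "3 dvd sl p - sl (1 - p)"
    and step: "3 dvd sl l - int n - sl p"
    and n3: "\<not> 3 dvd int n"
begin

lemma sum_UNIV: "(\<Sum>i\<in>UNIV. f i) = f p + f (1 - p) + f l + f (1 - l)"
  unfolding UNIV_eq using dist by (simp add: add.assoc)

lemma index_cases: "i = p \<or> i = 1 - p \<or> i = l \<or> i = 1 - l"
  using UNIV_eq by blast

lemma herm_split:
  "herm D x y = cnjF D (x $ p) * y $ (1 - p) + cnjF D (x $ (1 - p)) * y $ p
     + (cnjF D (x $ l) * y $ (1 - l) + cnjF D (x $ (1 - l)) * y $ l)"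
  by (simp add: herm_eq sum_UNIV add.assoc)

definition cycle_pos :: "4 \<Rightarrow> int" where
  "cycle_pos j = (if j = l then 1 else if j = 1 - l then - 1 else 0)"

lemma cycle_pos_simps: "cycle_pos p = 0" "cycle_pos (1 - p) = 0" "cycle_pos l = 1" "cycle_pos (1 - l) = - 1"
  using dist by (auto simp: cycle_pos_def)

text \<open>
  Modulo 3 the place of \<open>e\<^sub>j\<close> is \<open>sl p + cycle_pos j * n\<close>; as \<open>n\<close> is invertible, congruences between places
  are congruences between positions.
\<close>

lemma dvd_place_iff: "3 dvd sl j - sl i - d * int n \<longleftrightarrow> 3 dvd cycle_pos j - cycle_pos i - d"
proof -
  obtain a where a: "sl p - sl (1 - p) = 3 * a" using plane by (rule dvdE)
  obtain b where b: "sl l - int n - sl p = 3 * b" using step by (rule dvdE)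
  have place: "3 dvd sl k - sl p - cycle_pos k * int n" for k
  proof -
    consider "k = p" | "k = 1 - p" | "k = l" | "k = 1 - l" using index_cases by blast
    then show ?thesis
    proof cases
      case 2
      have "sl k - sl p - cycle_pos k * int n = 3 * - a" using a by (simp add: 2 cycle_pos_simps)
      then show ?thesis by (rule dvdI)
    next
      case 3
      have "sl k - sl p - cycle_pos k * int n = 3 * b" using b by (simp add: 3 cycle_pos_simps)
      then show ?thesis by (rule dvdI)
    next
      case 4
      have "sl k - sl p - cycle_pos k * int n = 3 * (- a - b)"
        using a b sl_dual[of p] sl_dual[of l] by (simp add: 4 cycle_pos_simps)
      then show ?thesis by (rule dvdI)
    qed (simp add: cycle_pos_simps)
  qed
  have "sl j - sl i - d * int n
      = (cycle_pos j - cycle_pos i - d) * int n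
        + ((sl j - sl p - cycle_pos j * int n) - (sl i - sl p - cycle_pos i * int n))"
    by (simp add: algebra_simps)
  then have "3 dvd sl j - sl i - d * int n \<longleftrightarrow> 3 dvd (cycle_pos j - cycle_pos i - d) * int n"
    using place by (simp only: dvd_add_left_iff dvd_diff)
  also have "\<dots> \<longleftrightarrow> 3 dvd cycle_pos j - cycle_pos i - d"
    using n3 by (simp add: prime_dvd_mult_iff)
  finally show ?thesis .
qed

lemma not_dvd:
  "i = p \<or> i = 1 - p \<Longrightarrow> j \<noteq> l \<Longrightarrow> \<not> 3 dvd sl j - sl i - int n"
  "j \<noteq> 1 - l \<Longrightarrow> \<not> 3 dvd sl j - sl l - int n"
  "j \<noteq> p \<Longrightarrow> j \<noteq> 1 - p \<Longrightarrow> \<not> 3 dvd sl j - sl (1 - l) - int n"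
  using index_cases[of j]
    dvd_place_iff[of j i 1] dvd_place_iff[of j l 1] dvd_place_iff[of j "1 - l" 1]
  by (elim disjE; simp add: cycle_pos_simps)+

lemma same_class:
  assumes "3 dvd sl j - sl i"
  shows "i = j \<or> (i \<in> {p, 1 - p} \<and> j \<in> {p, 1 - p})"
  using index_cases[of i] index_cases[of j] assms dvd_place_iff[of j i 0]
  by (elim disjE) (simp_all add: cycle_pos_simps)

text \<open>
  Entries of \<open>\<gamma>\<close> whose place is not in the class that degree \<open>-n\<close> requires gain a third, and so do all
  entries of \<open>c - \<gamma>\<close>.
\<close>

lemma leading_term:
  assumes c: "c - \<gamma> \<in> filt \<Lambda> (1 - int n)" and \<gamma>: "\<gamma> \<in> filt \<Lambda> (- int n)" and w: "w \<in> \<Lambda> m"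
    and J: "\<And>j. j \<notin> J \<Longrightarrow> \<not> 3 dvd sl j - sl i - int n"
  shows "(c *v w) $ i - (\<Sum>j\<in>J. \<gamma> $ i $ j * w $ j) \<in> th (m - int n - sl i + 1)"
proof -
  have "(c *v w) $ i - (\<gamma> *v w) $ i = ((c - \<gamma>) *v w) $ i"
    by (simp add: matrix_vector_mult_diff_rdistrib)
  also have "\<dots> \<in> th (m - int n - sl i + 1)"
    using filt_vector[OF c w] unfolding Lambda by (auto simp: algebra_simps)
  finally have 1: "(c *v w) $ i - (\<gamma> *v w) $ i \<in> th (m - int n - sl i + 1)" .
  have "(\<gamma> *v w) $ i = (\<Sum>j\<in>J. \<gamma> $ i $ j * w $ j) + (\<Sum>j\<in>- J. \<gamma> $ i $ j * w $ j)"
    using sum.subset_diff[of J UNIV "\<lambda>j. \<gamma> $ i $ j * w $ j"]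
    by (simp add: matrix_vector_nth Compl_eq_Diff_UNIV add.commute)
  moreover have "(\<Sum>j\<in>- J. \<gamma> $ i $ j * w $ j) \<in> th (m - int n - sl i + 1)"
  proof (rule F.thirds_sum)
    fix j assume "j \<in> - J"
    then have "\<not> 3 dvd - int n + sl j - sl i" using J[of j] by (simp add: algebra_simps)
    then have "\<gamma> $ i $ j \<in> th (- int n + sl j - sl i + 1)"
      using \<gamma> unfolding filt_iff by (intro F.thirds_Suc) auto
    moreover have "w $ j \<in> th (m - sl j)" using w unfolding Lambda by blast
    ultimately show "\<gamma> $ i $ j * w $ j \<in> th (m - int n - sl i + 1)" by (rule F.thirds_mult') simp
  qed
  ultimately have 2: "(\<gamma> *v w) $ i - (\<Sum>j\<in>J. \<gamma> $ i $ j * w $ j) \<in> th (m - int n - sl i + 1)"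
    by simp
  from F.thirds_add[OF 1 2] show ?thesis by simp
qed

end

text \<open>
  To leading order \<open>\<gamma>\<close> is given by a scalar \<open>\<gamma>\<^sub>l\<^sub>,\<^sub>1\<^sub>-\<^sub>l\<close> and by the vector \<open>B = (\<gamma>\<^sub>p\<^sub>,\<^sub>l, \<gamma>\<^sub>1\<^sub>-\<^sub>p\<^sub>,\<^sub>l)\<close> of
  the plane; the remaining component is minus the adjoint of \<open>B\<close>. The scalar \<open>nu\<close> is the value of
  the hermitian form at \<open>B\<close>.
\<close>

locale skew_leading = cyclic_sequence D \<Lambda> sl S n p l
  for D :: "('a::field, 'f::field) unram_data" and \<Lambda> sl S n p l +
  fixes \<gamma> :: "'f^4^4"
  assumes \<gamma>_filt: "\<gamma> \<in> filt \<Lambda> (- int n)" and \<gamma>_lie: "\<gamma> \<in> lie_U22 D"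
begin

definition nu :: 'f where
  "nu = cnjF D (\<gamma> $ p $ l) * \<gamma> $ (1 - p) $ l + cnjF D (\<gamma> $ (1 - p) $ l) * \<gamma> $ p $ l"

definition nondegenerate :: bool where
  "nondegenerate \<longleftrightarrow> nu \<notin> th (2 * (sl l - int n) - S + 1)
     \<and> \<gamma> $ l $ (1 - l) \<notin> th (sl (1 - l) - sl l - int n + 1)"

lemma \<gamma>_entry: "\<gamma> $ i $ j \<in> th (sl j - sl i - int n)"
  using \<gamma>_filt unfolding filt_iff by (simp add: algebra_simps)

lemma \<gamma>_skew: "\<gamma> $ i $ j = - cnjF D (\<gamma> $ (1 - j) $ (1 - i))"
proof -
  have "(sigma D \<gamma>) $ i $ j = (- \<gamma>) $ i $ j" using \<gamma>_lie lie_iff by simp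
  then show ?thesis by (simp add: sigma_nth minus_equation_iff[of "\<gamma> $ i $ j"])
qed

lemma leading_terms:
  assumes "c - \<gamma> \<in> filt \<Lambda> (1 - int n)" and "w \<in> \<Lambda> m"
  shows "i = p \<or> i = 1 - p \<Longrightarrow> (c *v w) $ i - \<gamma> $ i $ l * w $ l \<in> th (m - int n - sl i + 1)"
    and "(c *v w) $ l - \<gamma> $ l $ (1 - l) * w $ (1 - l) \<in> th (m - int n - sl l + 1)"
    and "(c *v w) $ (1 - l)
           + (cnjF D (\<gamma> $ (1 - p) $ l) * w $ p + cnjF D (\<gamma> $ p $ l) * w $ (1 - p))
         \<in> th (m - int n - sl (1 - l) + 1)"
proof -
  note lt = leading_term[OF assms(1) \<gamma>_filt assms(2)]
  show "(c *v w) $ i - \<gamma> $ i $ l * w $ l \<in> th (m - int n - sl i + 1)" if "i = p \<or> i = 1 - p"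
    using lt[of "{l}" i] not_dvd(1)[OF that] by simp
  show "(c *v w) $ l - \<gamma> $ l $ (1 - l) * w $ (1 - l) \<in> th (m - int n - sl l + 1)"
    using lt[of "{1 - l}" l] not_dvd(2) by simp
  show "(c *v w) $ (1 - l)
           + (cnjF D (\<gamma> $ (1 - p) $ l) * w $ p + cnjF D (\<gamma> $ p $ l) * w $ (1 - p))
         \<in> th (m - int n - sl (1 - l) + 1)"
    using lt[of "{p, 1 - p}" "1 - l"] not_dvd(3) dist
      \<gamma>_skew[of "1 - l" p] \<gamma>_skew[of "1 - l" "1 - p"] by (simp add: algebra_simps)
qed

lemma filt_c: "c - \<gamma> \<in> filt \<Lambda> (1 - int n) \<Longrightarrow> c \<in> filt \<Lambda> (- int n)"
  using filt_add[OF filt_mono[of "c - \<gamma>" "1 - int n" "- int n"] \<gamma>_filt] by simp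

text \<open>
  A vector on the line \<open>l\<close> goes to its multiple of \<open>B\<close>, whose norm is that of the coordinate times \<open>nu\<close>.
\<close>

lemma plane_norm_from_line:
  assumes c: "c - \<gamma> \<in> filt \<Lambda> (1 - int n)" and w: "w \<in> \<Lambda> m"
    and wl: "w $ l \<notin> th (m - sl l + 1)" and nd: nondegenerate
  shows "herm D (c *v w) (c *v w) \<notin> th (2 * (m - int n) - S + 1)"
proof -
  define u where "u = c *v w"
  have u: "u $ i \<in> th (m - int n - sl i)" for i
    using filt_vector[OF filt_c[OF c] w] unfolding Lambda u_def by (auto simp: algebra_simps)
  have wl': "w $ l \<in> th (m - sl l)" using w unfolding Lambda by blast
  have m: "3 dvd m - sl l" using F.thirds_dvd wl wl' by blast
  have ul: "u $ l \<in> th (m - int n - sl l + 1)"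
  proof -
    have "\<not> 3 dvd (m - sl l) - int n" using m n3 by presburger
    then have "\<not> 3 dvd m - int n - sl l" by (simp add: algebra_simps)
    with u show ?thesis by (rule F.thirds_Suc)
  qed
  have main: "u $ i - \<gamma> $ i $ l * w $ l \<in> th (m - int n - sl i + 1)" "\<gamma> $ i $ l * w $ l \<in> th (m - int n - sl i)"
    if "i = p \<or> i = 1 - p" for i
    using leading_terms(1)[OF c w that] F.thirds_mult'[OF \<gamma>_entry[of i l] wl'] unfolding u_def by auto
  have prod: "cnjF D (u $ i) * u $ (1 - i) - cnjF D (\<gamma> $ i $ l * w $ l) * (\<gamma> $ (1 - i) $ l * w $ l)
       \<in> th (2 * (m - int n) - S + 1)" if "i = p \<or> i = 1 - p" for i
  proof -
    have "1 - i = p \<or> 1 - i = 1 - p" using that by auto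
    note m' = main[OF this]
    have "cnjF D (u $ i) - cnjF D (\<gamma> $ i $ l * w $ l) \<in> th (m - int n - sl i + 1)"
      using main(1)[OF that] by (simp flip: cnjF_diff)
    from F.thirds_mult_cong[OF this m'(1) _ u] main(2)[OF that]
    have "cnjF D (u $ i) * u $ (1 - i) - cnjF D (\<gamma> $ i $ l * w $ l) * (\<gamma> $ (1 - i) $ l * w $ l)
       \<in> th ((m - int n - sl i) + (m - int n - sl (1 - i)) + 1)" by simp
    then show ?thesis by (rule F.thirds_mono) (use sl_dual[of i] in simp)
  qed
  have lines: "cnjF D (u $ l) * u $ (1 - l) + cnjF D (u $ (1 - l)) * u $ l
      \<in> th (2 * (m - int n) - S + 1)"
    using sl_dual[of l] ul u[of "1 - l"]
    by (intro F.thirds_add F.thirds_mult'[of _ "m - int n - sl l + 1" _ "m - int n - sl (1 - l)"]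
        F.thirds_mult'[of _ "m - int n - sl (1 - l)" _ "m - int n - sl l + 1"]) auto
  have p1: "1 - (1 - p) = p" by simp
  have "herm D u u - cnjF D (w $ l) * w $ l * nu \<in> th (2 * (m - int n) - S + 1)"
    using F.thirds_add[OF F.thirds_add[OF prod[of p] prod[of "1 - p"]] lines]
    unfolding p1 by (simp add: herm_split nu_def cnjF_mult algebra_simps)
  moreover have "cnjF D (w $ l) * w $ l * nu \<notin> th (2 * (m - int n) - S + 1)"
  proof -
    have "cnjF D (w $ l) * w $ l \<notin> th ((m - sl l) + (m - sl l) + 1)"
      using wl by (intro F.thirds_mult_notin) auto
    from F.thirds_mult_notin[OF this, of nu "2 * (sl l - int n) - S"] nd
    show ?thesis by (simp add: nondegenerate_def algebra_simps)
  qed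
  ultimately show ?thesis unfolding u_def using F.thirds_cong_iff by blast
qed

lemma line_from_dual_line:
  assumes c: "c - \<gamma> \<in> filt \<Lambda> (1 - int n)" and w: "w \<in> \<Lambda> m"
    and wl: "w $ (1 - l) \<notin> th (m - sl (1 - l) + 1)" and nd: nondegenerate
  shows "(c *v w) $ l \<notin> th (m - int n - sl l + 1)"
proof -
  have "\<gamma> $ l $ (1 - l) * w $ (1 - l) \<notin> th ((sl (1 - l) - sl l - int n) + (m - sl (1 - l)) + 1)"
    using wl nd by (intro F.thirds_mult_notin) (auto simp: nondegenerate_def)
  then show ?thesis
    using F.thirds_cong_iff[OF leading_terms(2)[OF c w]] by (simp add: algebra_simps)
qed

text \<open>
  In a hyperbolic plane the orthogonal complement of an anisotropic vector \<open>B\<close> is anisotropic, so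
  an isotropic vector \<open>w\<close> with \<open>f(B, w) = 0\<close> vanishes. Multiplying by the norm of a coordinate of
  \<open>B\<close> turns this into an identity without division, which can be read to leading order.
\<close>

lemma dual_line_from_plane:
  assumes c: "c - \<gamma> \<in> filt \<Lambda> (1 - int n)" and w: "w \<in> \<Lambda> m"
    and i: "i = p \<or> i = 1 - p" and wi: "w $ i \<notin> th (m - sl i + 1)" and nd: nondegenerate
    and iso: "herm D w w \<in> th (2 * m - S + 1)"
  shows "(c *v w) $ (1 - l) \<notin> th (m - int n - sl (1 - l) + 1)"
proof
  assume *: "(c *v w) $ (1 - l) \<in> th (m - int n - sl (1 - l) + 1)"
  have w': "w $ j \<in> th (m - sl j)" for j using w unfolding Lambda by blast
  define B where "B j = \<gamma> $ j $ l" for j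
  have B: "B j \<in> th (sl l - sl j - int n)" for j unfolding B_def by (rule \<gamma>_entry)
  define Q where "Q = cnjF D (B (1 - i)) * w $ i + cnjF D (B i) * w $ (1 - i)"
  define h where "h = cnjF D (w $ i) * w $ (1 - i) + cnjF D (w $ (1 - i)) * w $ i"
  have "Q = cnjF D (\<gamma> $ (1 - p) $ l) * w $ p + cnjF D (\<gamma> $ p $ l) * w $ (1 - p)"
    using i by (auto simp: Q_def B_def add.commute)
  then have Q: "Q \<in> th (m - int n - sl (1 - l) + 1)"
    using F.thirds_diff[OF leading_terms(3)[OF c w] *] by simp
  have m: "3 dvd m - sl i" using F.thirds_dvd[OF w' wi] .
  have "\<not> 3 dvd m - sl j" if "j = l \<or> j = 1 - l" for j
  proof
    assume "3 dvd m - sl j"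
    with m have "3 dvd (m - sl i) - (m - sl j)" by (rule dvd_diff)
    then have "3 dvd sl j - sl i" by simp
    from same_class[OF this] show False using i that dist by auto
  qed
  then have "w $ l \<in> th (m - sl l + 1)" "w $ (1 - l) \<in> th (m - sl (1 - l) + 1)"
    using F.thirds_Suc[OF w'] by blast+
  then have "cnjF D (w $ l) * w $ (1 - l) + cnjF D (w $ (1 - l)) * w $ l \<in> th (2 * m - S + 1)"
    using sl_dual[of l] w'
    by (intro F.thirds_add F.thirds_mult'[of _ "m - sl l + 1" _ "m - sl (1 - l)"]
        F.thirds_mult'[of _ "m - sl (1 - l) + 1" _ "m - sl l"]) auto
  from F.thirds_diff[OF iso this] have h: "h \<in> th (2 * m - S + 1)"
    using i by (auto simp: h_def herm_split add.commute)
  have nu_eq: "nu = cnjF D (B i) * B (1 - i) + cnjF D (B (1 - i)) * B i"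
    using i by (auto simp: nu_def B_def add.commute)
  have "cnjF D (w $ i) * w $ i * nu
      = B i * cnjF D (w $ i) * Q + cnjF D (B i) * w $ i * cnjF D Q - B i * cnjF D (B i) * h"
    by (simp add: nu_eq Q_def h_def cnjF_add cnjF_mult algebra_simps)
  also have "\<dots> \<in> th (2 * (m - sl i) + (2 * (sl l - int n) - S) + 1)"
  proof (intro F.thirds_diff F.thirds_add)
    have Bw: "B i * cnjF D (w $ i) \<in> th ((sl l - sl i - int n) + (m - sl i))"
      "cnjF D (B i) * w $ i \<in> th ((sl l - sl i - int n) + (m - sl i))"
      by (intro F.thirds_mult; simp add: B w')+
    show "B i * cnjF D (w $ i) * Q \<in> th (2 * (m - sl i) + (2 * (sl l - int n) - S) + 1)"
      "cnjF D (B i) * w $ i * cnjF D Q \<in> th (2 * (m - sl i) + (2 * (sl l - int n) - S) + 1)"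
      using F.thirds_mult'[OF Bw(1) Q] F.thirds_mult'[OF Bw(2), of "cnjF D Q"] Q sl_dual[of l] by auto
    have "B i * cnjF D (B i) \<in> th ((sl l - sl i - int n) + (sl l - sl i - int n))"
      by (intro F.thirds_mult; simp add: B)
    from F.thirds_mult'[OF this h]
    show "B i * cnjF D (B i) * h \<in> th (2 * (m - sl i) + (2 * (sl l - int n) - S) + 1)" by auto
  qed
  finally have "cnjF D (w $ i) * w $ i * nu \<in> th (2 * (m - sl i) + (2 * (sl l - int n) - S) + 1)" .
  moreover have "cnjF D (w $ i) * w $ i \<notin> th (2 * (m - sl i) + 1)"
    using F.thirds_mult_notin[of "cnjF D (w $ i)" "m - sl i" "w $ i" "m - sl i"] wi by simp
  ultimately show False
    using F.thirds_mult_notin[of _ "2 * (m - sl i)" nu "2 * (sl l - int n) - S"] nd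
    by (auto simp: nondegenerate_def)
qed

text \<open>
  The leading term of any vector can be moved round the cycle, without loss, until it is an
  anisotropic vector of the plane: a vector on line \<open>l\<close> is sent to a multiple of \<open>B\<close>, and an isotropic
  vector of the plane is not orthogonal to \<open>B\<close> and so survives to the line \<open>1 - l\<close>. There the value of
  the hermitian form has the least valuation that the level of the vector permits; thus the
  level is determined by the form.
\<close>

lemma extremal_norm:
  assumes c: "c - \<gamma> \<in> filt \<Lambda> (1 - int n)" and nd: nondegenerate
    and w: "w \<in> \<Lambda> m" "w \<notin> \<Lambda> (m + 1)"
  shows "\<exists>k. herm D (((*v) c ^^ k) w) (((*v) c ^^ k) w) \<notin> th (2 * (m - int k * int n) - S + 1)"
proof -
  have cw: "c *v x \<in> \<Lambda> (a - int n)" if "x \<in> \<Lambda> a" for x a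
    using filt_vector[OF filt_c[OF c] that] by simp
  have from_l: "herm D (c *v x) (c *v x) \<notin> th (2 * (a - int n) - S + 1)"
    if "x \<in> \<Lambda> a" "x $ l \<notin> th (a - sl l + 1)" for x a
    using plane_norm_from_line[OF c that nd] .
  have from_l': "herm D (c *v (c *v x)) (c *v (c *v x)) \<notin> th (2 * (a - 2 * int n) - S + 1)"
    if "x \<in> \<Lambda> a" "x $ (1 - l) \<notin> th (a - sl (1 - l) + 1)" for x a
    using from_l[OF cw[OF that(1)] line_from_dual_line[OF c that nd]] by (simp add: algebra_simps)
  obtain i where i: "w $ i \<notin> th (m - sl i + 1)" using w(2) unfolding Lambda by (auto simp: algebra_simps)
  consider "i = p \<or> i = 1 - p" | "i = l" | "i = 1 - l" using index_cases by blast
  then show ?thesis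
  proof cases
    case 1
    show ?thesis
    proof (cases "herm D w w \<in> th (2 * m - S + 1)")
      case False
      then show ?thesis by (intro exI[of _ 0]) simp
    next
      case True
      from from_l'[OF cw[OF w(1)] dual_line_from_plane[OF c w(1) 1 i nd True]]
      show ?thesis by (intro exI[of _ 3]) (simp add: numeral_3_eq_3 algebra_simps)
    qed
  next
    case 2
    then show ?thesis using from_l[OF w(1)] i by (intro exI[of _ 1]) simp
  next
    case 3
    then show ?thesis
      using from_l'[OF w(1)] i by (intro exI[of _ 2]) (simp add: numeral_2_eq_2)
  qed
qed

text \<open>
  Hence an isometry that carries an operator \<open>b\<close> of degree \<open>-n\<close> to \<open>c\<close> cannot lower the level of any
  vector: it commutes with the passage round the cycle and preserves the form.
\<close>

theorem intertwiner_preserves_sequence: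
  assumes c: "c - \<gamma> \<in> filt \<Lambda> (1 - int n)" and nd: nondegenerate
    and b: "b \<in> filt \<Lambda> (- int n)" and g: "g \<in> U22 D" and eq: "c ** g = g ** b"
  shows "g \<in> filt \<Lambda> 0"
  unfolding filt_def
proof (clarify)
  fix j x assume x: "x \<in> \<Lambda> j"
  have climb: "g *v x \<in> \<Lambda> (m + 1)" if m: "m < j" "g *v x \<in> \<Lambda> m" for m
  proof (rule ccontr)
    assume "g *v x \<notin> \<Lambda> (m + 1)"
    from extremal_norm[OF c nd m(2) this] obtain k where
      k: "herm D (((*v) c ^^ k) (g *v x)) (((*v) c ^^ k) (g *v x))
            \<notin> th (2 * (m - int k * int n) - S + 1)" by blast
    have comm: "((*v) c ^^ k) (g *v x) = g *v (((*v) b ^^ k) x)" for k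
      by (induction k) (simp_all add: matrix_vector_mul_assoc eq)
    have bk: "((*v) b ^^ k) x \<in> \<Lambda> (j - int k * int n)" for k
    proof (induction k)
      case (Suc k)
      then show ?case using filt_vector[OF b Suc] by (simp add: algebra_simps)
    qed (use x in simp)
    have "herm D (((*v) b ^^ k) x) (((*v) b ^^ k) x) \<in> th (2 * (m - int k * int n) - S + 1)"
      by (rule F.thirds_mono[OF herm_Lambda[OF bk bk]]) (use m in simp)
    then show False using k g by (simp add: comm herm_U22)
  qed
  have "g *v x \<in> \<Lambda> (j - int k) \<Longrightarrow> g *v x \<in> \<Lambda> j" for k
  proof (induction k)
    case (Suc k)
    then show ?case using climb[OF _ Suc.prems] by simp
  qed simp
  moreover obtain m where "g *v x \<in> \<Lambda> m" using Lambda_ex by blast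
  moreover have "\<Lambda> m \<subseteq> \<Lambda> (j - int (nat (j - m)))" by (rule Lambda_mono) simp
  ultimately show "g *v x \<in> \<Lambda> (j + 0)" by fastforce
qed

end

section \<open>Fundamental strata and their leading terms\<close>

context cyclic_sequence
begin

lemma scale_Lambda: "scale_set (unifF D) (\<Lambda> m) = \<Lambda> (m + 3)"
proof -
  have iff: "unifF D * x \<in> th (a + 3) \<longleftrightarrow> x \<in> th a" for x a
    using unifF by (cases "x = 0") (simp_all add: thirds_def F.v_mult)
  have shift: "m + 3 - sl i = (m - sl i) + 3" for i by simp
  have "x \<in> scale_set (unifF D) (\<Lambda> m)" if "x \<in> \<Lambda> (m + 3)" for x
  proof -
    define y where "y = inverse (unifF D) *s x"
    have x: "x = unifF D *s y" using unifF by (simp add: y_def vec_eq_iff)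
    have "y \<in> \<Lambda> m" using that unfolding x Lambda shift by (simp add: iff)
    then show ?thesis unfolding x scale_set_def by blast
  qed
  moreover have "x \<in> \<Lambda> (m + 3)" if "x \<in> scale_set (unifF D) (\<Lambda> m)" for x
    using that unfolding scale_set_def Lambda shift by (auto simp: iff)
  ultimately show ?thesis by blast
qed

lemma ex_class: "\<exists>i. 3 dvd m - sl i"
proof -
  have "3 dvd (m - sl p) \<or> 3 dvd (m - sl p) - int n \<or> 3 dvd (m - sl p) + int n"
    using n3 by presburger
  moreover have "3 dvd sl l - sl p - 1 * int n" "3 dvd sl (1 - l) - sl p - - 1 * int n"
    by (simp_all only: dvd_place_iff cycle_pos_simps) simp_all
  ultimately have "3 dvd (m - sl p) \<or> 3 dvd (m - sl p - int n) - (sl l - sl p - 1 * int n)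
      \<or> 3 dvd (m - sl p + int n) - (sl (1 - l) - sl p - - 1 * int n)"
    using dvd_diff by blast
  then have "3 dvd m - sl p \<or> 3 dvd m - sl l \<or> 3 dvd m - sl (1 - l)" by simp
  then show ?thesis by blast
qed

lemma Lambda_strict: "\<Lambda> m \<noteq> \<Lambda> (m + 1)"
proof -
  obtain i where "3 dvd m - sl i" using ex_class by blast
  then obtain k where k: "m - sl i = 3 * k" by (rule dvdE)
  have c: "unifF D powi k \<noteq> 0" "vF (unifF D powi k) = k"
    using unifF by (simp_all add: F.v_power_int)
  have "axis i (unifF D powi k) \<in> \<Lambda> m" using k c unfolding Lambda by (auto simp: axis_def thirds_def)
  moreover have "axis i (unifF D powi k) \<notin> \<Lambda> (m + 1)"
  proof
    assume "axis i (unifF D powi k) \<in> \<Lambda> (m + 1)"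
    then have "axis i (unifF D powi k) $ i \<in> th (m + 1 - sl i)" unfolding Lambda by blast
    then show False using k c by (simp add: axis_def thirds_def)
  qed
  ultimately show ?thesis by blast
qed

lemma Lambda_inj: "\<Lambda> a = \<Lambda> b \<Longrightarrow> a = b"
proof (induction a b rule: linorder_wlog)
  case (le a b)
  show ?case
  proof (rule ccontr)
    assume "a \<noteq> b"
    then have "a + 1 \<le> b" "a \<le> a + 1" using le by simp_all
    then have "\<Lambda> b \<subseteq> \<Lambda> (a + 1)" "\<Lambda> (a + 1) \<subseteq> \<Lambda> a" by (simp_all only: Lambda_mono)
    then show False using le Lambda_strict by blast
  qed
qed simp

text \<open>
  The definite description in \<open>period\<close> needs strictness of the sequence: every class modulo 3
  contains the place of some basis vector, so each step is proper.
\<close>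

lemma period_3: "period D \<Lambda> = 3"
  unfolding period_def
proof (rule the_equality)
  show "is_period D \<Lambda> 3" by (simp add: is_period_def scale_Lambda)
  fix e assume "is_period D \<Lambda> e"
  then have "\<Lambda> (0 + int e) = \<Lambda> (0 + 3)" unfolding is_period_def scale_Lambda by metis
  then have "0 + int e = 0 + 3" by (rule Lambda_inj)
  then show "e = 3" by simp
qed

end

context unram_setting
begin

definition poly_thirds :: "int \<Rightarrow> 'f poly set" where
  "poly_thirds a = {q. \<forall>k. coeff q k \<in> th a}"

lemma poly_thirds_const [simp]: "[:x:] \<in> poly_thirds a \<longleftrightarrow> x \<in> th a"
  unfolding poly_thirds_def by (auto simp: coeff_pCons split: nat.split)

lemma poly_thirds_1: "1 \<in> poly_thirds 0"
  unfolding one_pCons poly_thirds_const by (simp add: thirds_def)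

lemma poly_thirds_X: "[:0, 1:] \<in> poly_thirds 0"
  unfolding poly_thirds_def by (auto simp: coeff_pCons thirds_def split: nat.split)

lemma poly_thirds_add: "q \<in> poly_thirds a \<Longrightarrow> r \<in> poly_thirds a \<Longrightarrow> q + r \<in> poly_thirds a"
  unfolding poly_thirds_def by (auto intro: F.thirds_add)

lemma poly_thirds_uminus: "q \<in> poly_thirds a \<Longrightarrow> - q \<in> poly_thirds a"
  unfolding poly_thirds_def by auto

lemma poly_thirds_diff: "q \<in> poly_thirds a \<Longrightarrow> r \<in> poly_thirds a \<Longrightarrow> q - r \<in> poly_thirds a"
  unfolding poly_thirds_def by (auto intro: F.thirds_diff)

lemma poly_thirds_0: "0 \<in> poly_thirds a"
  unfolding poly_thirds_def by auto

lemma poly_thirds_sum: "(\<And>i. i \<in> I \<Longrightarrow> f i \<in> poly_thirds a) \<Longrightarrow> sum f I \<in> poly_thirds a"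
  by (induction I rule: infinite_finite_induct) (auto intro: poly_thirds_add poly_thirds_0)

lemma poly_thirds_mult: "q \<in> poly_thirds a \<Longrightarrow> r \<in> poly_thirds b \<Longrightarrow> q * r \<in> poly_thirds (a + b)"
  unfolding poly_thirds_def by (auto simp: coeff_mult intro!: F.thirds_sum F.thirds_mult)

lemma poly_thirds_prod:
  "finite I \<Longrightarrow> (\<And>i. i \<in> I \<Longrightarrow> f i \<in> poly_thirds (a i)) \<Longrightarrow> prod f I \<in> poly_thirds (sum a I)"
  by (induction I rule: finite_induct) (auto intro: poly_thirds_mult poly_thirds_1)

lemma poly_thirds_mult_cong:
  assumes "q - q' \<in> poly_thirds 1" "r - r' \<in> poly_thirds 1" "q' \<in> poly_thirds 0" "r \<in> poly_thirds 0"
  shows "q * r - q' * r' \<in> poly_thirds 1"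
proof -
  have "(q - q') * r + q' * (r - r') \<in> poly_thirds 1"
    using assms poly_thirds_mult[of "q - q'" 1 r 0] poly_thirds_mult[of q' 0 "r - r'" 1] by (auto intro: poly_thirds_add)
  then show ?thesis by (simp add: algebra_simps)
qed

lemma reduction_cong:
  assumes "q - r \<in> poly_thirds 1"
  shows "reduction D q = reduction D r"
proof -
  have "coeff q i - coeff r i \<in> frac_ideal vF 1" for i
    using assms unfolding poly_thirds_def F.thirds_frac_1[symmetric] by auto
  then show ?thesis unfolding reduction_def by (auto intro!: F.res_class_eq)
qed

end

context cyclic_sequence
begin

lemma prod_UNIV: "(\<Prod>i\<in>UNIV. f i) = f p * f (1 - p) * f l * f (1 - l)"
  unfolding UNIV_eq using dist by (simp add: mult.assoc)

lemma class_permutation: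
  assumes \<pi>: "\<pi> permutes UNIV" and cls: "\<And>i. 3 dvd sl (\<pi> i) - sl i"
  shows "\<pi> = id \<or> \<pi> = Transposition.transpose p (1 - p)"
proof -
  have inj: "\<pi> i = \<pi> j \<longleftrightarrow> i = j" for i j using permutes_inj[OF \<pi>] by (simp add: inj_eq)
  have pl: "\<pi> l = l" "\<pi> (1 - l) = 1 - l" using same_class[OF cls] dist by (metis insert_iff singletonD)+
  have pp: "\<pi> p \<in> {p, 1 - p}" "\<pi> (1 - p) \<in> {p, 1 - p}"
    using same_class[OF cls[of p]] same_class[OF cls[of "1 - p"]] by auto
  have ext: "\<pi> = f" if "\<pi> p = f p" "\<pi> (1 - p) = f (1 - p)" "\<pi> l = f l" "\<pi> (1 - l) = f (1 - l)" for f
  proof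
    fix i
    show "\<pi> i = f i" using that index_cases[of i] by auto
  qed
  show ?thesis
  proof (cases "\<pi> p = p")
    case True
    then have "\<pi> (1 - p) = 1 - p" using pp inj[of "1 - p" p] dist by auto
    then show ?thesis using True pl ext[of id] by simp
  next
    case False
    then have 1: "\<pi> p = 1 - p" using pp by simp
    then have 2: "\<pi> (1 - p) = p" using pp inj[of "1 - p" p] dist by auto
    show ?thesis
      using 1 2 pl dist ext[of "Transposition.transpose p (1 - p)"]
      by (simp add: Transposition.transpose_def)
  qed
qed

text \<open>
  Of the 24 terms of the determinant only those whose permutation preserves the classes of places
  modulo 3 survive the reduction: in any other term some factor gains a fractional power of the
  uniformizer, and along a permutation these fractions add up to an integer.
\<close>

lemma det_class_blocks:
  fixes Z :: "'f poly^4^4"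
  assumes Z: "\<And>i j. Z $ i $ j \<in> poly_thirds (sl j - sl i)"
    and Z': "\<And>i j. \<not> 3 dvd sl j - sl i \<Longrightarrow> Z $ i $ j \<in> poly_thirds (sl j - sl i + 1)"
  shows "det Z - (Z $ p $ p * Z $ (1 - p) $ (1 - p) - Z $ p $ (1 - p) * Z $ (1 - p) $ p)
      * Z $ l $ l * Z $ (1 - l) $ (1 - l) \<in> poly_thirds 1"
proof -
  define t where "t \<pi> = of_int (sign \<pi>) * (\<Prod>i\<in>UNIV. Z $ i $ \<pi> i)" for \<pi> :: "4 \<Rightarrow> 4"
  define sw where "sw = Transposition.transpose p (1 - p)"
  let ?Perm = "{\<pi>. \<pi> permutes (UNIV :: 4 set)}"
  have neq: "id \<noteq> sw" using dist by (metis sw_def id_apply transpose_apply_first)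
  have sub: "{id, sw} \<subseteq> ?Perm"
    by (auto simp: sw_def permutes_id intro: permutes_swap_id)
  have rest: "t \<pi> \<in> poly_thirds 1" if \<pi>: "\<pi> \<in> ?Perm - {id, sw}" for \<pi>
  proof -
    obtain i0 where i0: "\<not> 3 dvd sl (\<pi> i0) - sl i0"
      using class_permutation[of \<pi>] \<pi> unfolding sw_def by blast
    define a where "a i = sl (\<pi> i) - sl i + (if i = i0 then 1 else 0)" for i
    have "(\<Prod>i\<in>UNIV. Z $ i $ \<pi> i) \<in> poly_thirds (sum a UNIV)"
      using Z Z'[OF i0] by (intro poly_thirds_prod) (auto simp: a_def)
    moreover have "sum a UNIV = 1"
    proof -
      have "(\<Sum>i\<in>UNIV. sl (\<pi> i)) = (\<Sum>i\<in>UNIV. sl i)"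
        using \<pi> sum.permute[of \<pi> UNIV sl] by (simp add: comp_def)
      then show ?thesis by (simp add: a_def sum.distrib sum_subtractf)
    qed
    ultimately show ?thesis
      unfolding t_def by (cases rule: sign_cases[of \<pi>]) (auto intro: poly_thirds_uminus)
  qed
  have "det Z = sum t ?Perm" by (simp add: det_def t_def)
  also have "\<dots> = sum t (?Perm - {id, sw}) + sum t {id, sw}"
    by (rule sum.subset_diff[OF sub]) (simp add: finite_permutations)
  also have "sum t {id, sw} = t id + t sw" using neq by simp
  also have "t id = Z $ p $ p * Z $ (1 - p) $ (1 - p) * Z $ l $ l * Z $ (1 - l) $ (1 - l)"
    by (simp add: t_def prod_UNIV sign_id)
  also have "t sw = - (Z $ p $ (1 - p) * Z $ (1 - p) $ p * Z $ l $ l * Z $ (1 - l) $ (1 - l))"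
    using dist by (simp add: t_def prod_UNIV sw_def sign_swap_id Transposition.transpose_def)
  finally have "det Z = sum t (?Perm - {id, sw})
      + (Z $ p $ p * Z $ (1 - p) $ (1 - p) - Z $ p $ (1 - p) * Z $ (1 - p) $ p)
      * Z $ l $ l * Z $ (1 - l) $ (1 - l)"
    by (simp only: left_diff_distrib diff_conv_add_uminus[of "_ * _ * _ * _"])
  moreover have "sum t (?Perm - {id, sw}) \<in> poly_thirds 1" using rest by (rule poly_thirds_sum)
  ultimately show ?thesis by simp
qed

text \<open>
  The reduction of the characteristic polynomial is the product of those of the diagonal blocks: the
  two lines, and the plane with its trace and determinant.
\<close>

lemma charpoly_reduction:
  assumes Y: "Y \<in> filt \<Lambda> 0"
    and lines: "Y $ l $ l \<in> th 1" "Y $ (1 - l) $ (1 - l) \<in> th 1"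
    and tr: "Y $ p $ p + Y $ (1 - p) $ (1 - p) \<in> th 1"
    and dt: "Y $ p $ p * Y $ (1 - p) $ (1 - p) - Y $ p $ (1 - p) * Y $ (1 - p) $ p \<in> th 1"
  shows "reduction D (charpoly Y) = reduction D (monom 1 4)"
proof (rule reduction_cong)
  define Z :: "'f poly^4^4" where "Z = mat [:0, 1:] - map_matrix (\<lambda>x. [:x:]) Y"
  have Z: "Z $ i $ j = (if i = j then [:0, 1:] else 0) - [:Y $ i $ j:]" for i j
    by (simp add: Z_def map_matrix_def mat_def)
  have Yij: "Y $ i $ j \<in> th (sl j - sl i)" for i j using Y unfolding filt_iff by simp
  have Z0: "Z $ i $ j \<in> poly_thirds (sl j - sl i)" for i j
    unfolding Z using Yij[of i j] by (intro poly_thirds_diff) (auto intro: poly_thirds_X poly_thirds_0)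
  have Z1: "Z $ i $ j \<in> poly_thirds (sl j - sl i + 1)" if "\<not> 3 dvd sl j - sl i" for i j
  proof -
    have "i \<noteq> j" using that by auto
    then show ?thesis
      unfolding Z using F.thirds_Suc[OF Yij that] by (intro poly_thirds_diff) (auto intro: poly_thirds_0)
  qed
  have X0: "[:0, 1:] \<in> poly_thirds 0" by (rule poly_thirds_X)
  have XX0: "[:0, 1:] * [:0, 1:] \<in> poly_thirds 0" using poly_thirds_mult[OF X0 X0] by simp
  define Zp where "Zp = Z $ p $ p * Z $ (1 - p) $ (1 - p) - Z $ p $ (1 - p) * Z $ (1 - p) $ p"
  have "Zp - [:0, 1:] * [:0, 1:] = [:Y $ p $ p * Y $ (1 - p) $ (1 - p)
      - Y $ p $ (1 - p) * Y $ (1 - p) $ p:] - [:Y $ p $ p + Y $ (1 - p) $ (1 - p):] * [:0, 1:]"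
    using dist by (simp add: Zp_def Z algebra_simps)
  also have "\<dots> \<in> poly_thirds 1"
    using tr dt poly_thirds_mult[of "[:Y $ p $ p + Y $ (1 - p) $ (1 - p):]" 1, OF _ X0]
    by (intro poly_thirds_diff) auto
  finally have Zp: "Zp - [:0, 1:] * [:0, 1:] \<in> poly_thirds 1" .
  have Zl: "Z $ i $ i - [:0, 1:] \<in> poly_thirds 1" if "Y $ i $ i \<in> th 1" for i
    using that poly_thirds_uminus[of "[:Y $ i $ i:]" 1] by (simp add: Z)
  have Zl0: "Z $ i $ i \<in> poly_thirds 0" for i using Z0[of i i] by simp
  note A = poly_thirds_mult_cong[OF Zp Zl[OF lines(1)] XX0 Zl0]
  have XXX0: "[:0, 1:] * [:0, 1:] * [:0, 1:] \<in> poly_thirds 0" using poly_thirds_mult[OF XX0 X0] by simp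
  note B = poly_thirds_mult_cong[OF A Zl[OF lines(2)] XXX0 Zl0]
  have "det Z - Zp * Z $ l $ l * Z $ (1 - l) $ (1 - l) \<in> poly_thirds 1"
    unfolding Zp_def using det_class_blocks[OF Z0 Z1] by blast
  from poly_thirds_add[OF this B]
  have "det Z - [:0, 1:] * [:0, 1:] * [:0, 1:] * [:0, 1:] \<in> poly_thirds 1"
    by (simp only: add_diff_eq diff_add_cancel)
  moreover have "[:0, 1:] * [:0, 1:] * [:0, 1:] * [:0, 1:] = (monom 1 4 :: 'f poly)"
    by (simp add: monom_altdef power4_eq_xxxx)
  moreover have "charpoly Y = det Z" by (simp add: charpoly_def Z_def)
  ultimately show "charpoly Y - monom 1 4 \<in> poly_thirds 1" by (simp only:)
qed

end

context skew_leading
begin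

lemma mult_axis: "(X *v axis j 1) $ i = (X $ i $ j :: 'f)"
  by (simp add: matrix_vector_nth axis_def if_distrib[of "\<lambda>x. _ * x"] cong: if_cong)

lemma axis_Lambda: "axis j 1 \<in> \<Lambda> (sl j)"
  unfolding Lambda by (auto simp: axis_def thirds_def)

text \<open>
  Going once round the cycle multiplies each line by \<open>-\<gamma>\<^sub>l\<^sub>,\<^sub>1\<^sub>-\<^sub>l nu\<close> and acts on the plane by the
  operator \<open>w \<mapsto> -\<gamma>\<^sub>l\<^sub>,\<^sub>1\<^sub>-\<^sub>l f(B, w) B\<close>, of rank one and with the same trace.
\<close>

lemma cube_leading_terms:
  fixes Z defines "Z \<equiv> mat_pow \<gamma> 3"
  shows "Z $ l $ l + \<gamma> $ l $ (1 - l) * nu \<in> th (1 - 3 * int n)"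
    and "Z $ (1 - l) $ (1 - l) + \<gamma> $ l $ (1 - l) * nu \<in> th (1 - 3 * int n)"
    and "\<And>i j. i \<in> {p, 1 - p} \<Longrightarrow> j \<in> {p, 1 - p} \<Longrightarrow>
      Z $ i $ j + \<gamma> $ i $ l * \<gamma> $ l $ (1 - l) * cnjF D (\<gamma> $ (1 - j) $ l)
        \<in> th (sl j - sl i - 3 * int n + 1)"
proof -
  have Z: "Z $ i $ j = (\<gamma> *v (\<gamma> *v (\<gamma> *v axis j 1))) $ i" for i j
    by (simp add: Z_def numeral_3_eq_3 matrix_vector_mul_assoc mult_axis matrix_mul_assoc)
  have \<gamma>\<gamma>: "\<gamma> - \<gamma> \<in> filt \<Lambda> (1 - int n)" unfolding filt_iff by simp
  have u1: "\<gamma> *v axis j 1 \<in> \<Lambda> (sl j - int n)" for j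
    using filt_vector[OF \<gamma>_filt axis_Lambda] by simp
  have u2: "\<gamma> *v (\<gamma> *v axis j 1) \<in> \<Lambda> (sl j - int n - int n)" for j
    using filt_vector[OF \<gamma>_filt u1] by simp
  note lt1 = leading_terms[OF \<gamma>\<gamma> u1]
  note lt2 = leading_terms[OF \<gamma>\<gamma> u2]
  let ?a = "\<gamma> $ l $ (1 - l)"
  show "Z $ l $ l + ?a * nu \<in> th (1 - 3 * int n)"
  proof -
    have "(\<gamma> *v (\<gamma> *v axis l 1)) $ (1 - l) + nu \<in> th (sl l - int n - int n - sl (1 - l) + 1)"
      using lt1(3)[of l] by (simp add: mult_axis nu_def algebra_simps)
    from F.thirds_mult'[OF \<gamma>_entry[of l "1 - l"] this, of "1 - 3 * int n"]
    have "?a * ((\<gamma> *v (\<gamma> *v axis l 1)) $ (1 - l) + nu) \<in> th (1 - 3 * int n)" by simp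
    from F.thirds_add[OF _ this, of "Z $ l $ l - ?a * (\<gamma> *v (\<gamma> *v axis l 1)) $ (1 - l)"]
      lt2(2)[of l]
    show ?thesis by (simp add: Z algebra_simps)
  qed
  show "Z $ (1 - l) $ (1 - l) + ?a * nu \<in> th (1 - 3 * int n)"
  proof -
    let ?u = "\<gamma> *v (\<gamma> *v axis (1 - l) 1)"
    have d: "?u $ i - \<gamma> $ i $ l * ?a \<in> th (sl (1 - l) - int n - int n - sl i + 1)"
      if "i = p \<or> i = 1 - p" for i
      using lt1(1)[OF that, of "1 - l"] by (simp add: mult_axis)
    have e: "cnjF D (\<gamma> $ (1 - i) $ l) * (?u $ i - \<gamma> $ i $ l * ?a) \<in> th (1 - 3 * int n)"
      if "i = p \<or> i = 1 - p" for i
    proof -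
      have "cnjF D (\<gamma> $ (1 - i) $ l) \<in> th (sl l - sl (1 - i) - int n)" using \<gamma>_entry by simp
      then show ?thesis
        using d[OF that] by (rule F.thirds_mult') (use sl_dual[of i] sl_dual[of l] in simp)
    qed
    have "Z $ (1 - l) $ (1 - l) + (cnjF D (\<gamma> $ (1 - p) $ l) * ?u $ p + cnjF D (\<gamma> $ p $ l) * ?u $ (1 - p))
        \<in> th (1 - 3 * int n)"
      using lt2(3)[of "1 - l"] by (simp add: Z algebra_simps)
    from F.thirds_diff[OF F.thirds_diff[OF this e[of p]] e[of "1 - p"]]
    show ?thesis by (simp add: nu_def algebra_simps)
  qed
  show "Z $ i $ j + \<gamma> $ i $ l * ?a * cnjF D (\<gamma> $ (1 - j) $ l) \<in> th (sl j - sl i - 3 * int n + 1)"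
    if "i \<in> {p, 1 - p}" "j \<in> {p, 1 - p}" for i j
  proof -
    let ?u = "\<gamma> *v (\<gamma> *v axis j 1)"
    have i: "i = p \<or> i = 1 - p" using that by simp
    have "?u $ l + ?a * cnjF D (\<gamma> $ (1 - j) $ l) \<in> th (sl j - int n - int n - sl l + 1)"
      using lt1(2)[of j] \<gamma>_skew[of "1 - l" j] by (simp add: mult_axis)
    from F.thirds_mult'[OF \<gamma>_entry[of i l] this, of "sl j - sl i - 3 * int n + 1"]
    have "\<gamma> $ i $ l * (?u $ l + ?a * cnjF D (\<gamma> $ (1 - j) $ l)) \<in> th (sl j - sl i - 3 * int n + 1)"
      by simp
    from F.thirds_add[OF _ this, of "Z $ i $ j - \<gamma> $ i $ l * ?u $ l"] lt2(1)[OF i, of j]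
    show ?thesis by (simp add: Z algebra_simps)
  qed
qed

text \<open>
  If one of the two leading coefficients vanished, so would the product \<open>\<gamma>\<^sub>l\<^sub>,\<^sub>1\<^sub>-\<^sub>l nu\<close>, and with it the
  entries on the lines and the trace on the plane; the determinant on the plane vanishes
  because the operator there has rank one.
\<close>

theorem fundamental_nondegenerate:
  assumes "fundamental D \<Lambda> n \<gamma>"
  shows nondegenerate
proof (rule ccontr)
  assume deg: "\<not> nondegenerate"
  let ?a = "\<gamma> $ l $ (1 - l)"
  define Z where "Z = mat_pow \<gamma> 3"
  define t where "t = unifF D ^ n"
  define Y where "Y = mat t ** Z"
  have t: "t \<in> th (3 * int n)" using unifF by (simp add: t_def thirds_def F.v_power)
  have Y_nth: "Y $ i $ j = t * Z $ i $ j" for i j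
    by (simp add: Y_def matrix_mult_nth mat_def if_distrib[of "\<lambda>x. x * _"] cong: if_cong)
  have "coprime (3::int) (int n)" using n3 by (intro prime_imp_coprime) simp_all
  then have "coprime 3 n" using coprime_int_iff[of 3 n] by simp
  then have "stratum_y D \<Lambda> n \<gamma> = Y"
    by (simp add: stratum_y_def period_3 Y_def Z_def t_def Let_def coprime_iff_gcd_eq_1)
  moreover have "reduction D (charpoly Y) = reduction D (monom 1 4)"
  proof (rule charpoly_reduction)
    have tt: "t * x \<in> th (a + 3 * int n)" if "x \<in> th a" for x a
      using F.thirds_mult[OF t that] by (simp add: add.commute)
    have "Z \<in> filt \<Lambda> (- 3 * int n)"
    proof -
      have "\<gamma> ** (\<gamma> ** \<gamma>) \<in> filt \<Lambda> (- int n + (- int n + - int n))"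
        by (intro filt_mult \<gamma>_filt)
      then show ?thesis by (simp add: Z_def numeral_3_eq_3)
    qed
    then have "Z $ i $ j \<in> th (sl j - sl i - 3 * int n)" for i j
      unfolding filt_iff by (simp add: algebra_simps)
    from tt[OF this] have Y0: "Y $ i $ j \<in> th (sl j - sl i)" for i j by (simp add: Y_nth)
    then show "Y \<in> filt \<Lambda> 0" unfolding filt_iff by simp
    have nu: "nu \<in> th (2 * (sl l - int n) - S)"
      unfolding nu_def using \<gamma>_entry[of _ l] sl_dual[of p]
      by (intro F.thirds_add F.thirds_mult'[of _ "sl l - sl p - int n" _ "sl l - sl (1 - p) - int n"]
          F.thirds_mult'[of _ "sl l - sl (1 - p) - int n" _ "sl l - sl p - int n"]) auto
    have "?a * nu \<in> th (1 - 3 * int n)"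
    proof (cases "nu \<in> th (2 * (sl l - int n) - S + 1)")
      case True
      from F.thirds_mult'[OF \<gamma>_entry[of l "1 - l"] this] show ?thesis using sl_dual[of l] by simp
    next
      case False
      then have "?a \<in> th (sl (1 - l) - sl l - int n + 1)" using deg by (simp add: nondegenerate_def)
      from F.thirds_mult'[OF this nu] show ?thesis using sl_dual[of l] by simp
    qed
    from tt[OF this] have tnu: "t * (?a * nu) \<in> th 1" by simp
    have "t * (Z $ i $ i + ?a * nu) \<in> th 1" if "i = l \<or> i = 1 - l" for i
      using that tt[OF cube_leading_terms(1)] tt[OF cube_leading_terms(2)] by (auto simp: Z_def)
    from F.thirds_diff[OF this tnu]
    show "Y $ l $ l \<in> th 1" "Y $ (1 - l) $ (1 - l) \<in> th 1" by (simp_all add: Y_nth algebra_simps)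
    \<comment> \<open>the leading terms of the plane block, a matrix of rank one\<close>
    define X where "X i j = - (t * (\<gamma> $ i $ l * ?a * cnjF D (\<gamma> $ (1 - j) $ l)))" for i j
    have YX: "Y $ i $ j - X i j \<in> th (sl j - sl i + 1)" if "i \<in> {p, 1 - p}" "j \<in> {p, 1 - p}" for i j
      using tt[OF cube_leading_terms(3)[OF that]] by (simp add: Y_nth X_def Z_def algebra_simps)
    have X: "X i j \<in> th (sl j - sl i)" if "i \<in> {p, 1 - p}" "j \<in> {p, 1 - p}" for i j
      using F.thirds_diff[OF Y0[of i j] F.thirds_mono[OF YX[OF that]]] by simp
    have YXp: "Y $ i $ i - X i i \<in> th 1" if "i \<in> {p, 1 - p}" for i using YX[OF that that] by simp
    have "X p p + X (1 - p) (1 - p) = - (t * (?a * nu))"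
      by (simp add: X_def nu_def algebra_simps)
    then have "X p p + X (1 - p) (1 - p) \<in> th 1" using tnu by simp
    from F.thirds_add[OF F.thirds_add[OF YXp[of p] YXp[of "1 - p"]] this]
    show "Y $ p $ p + Y $ (1 - p) $ (1 - p) \<in> th 1" by simp
    have prod: "Y $ i $ j * Y $ (1 - i) $ (1 - j) - X i j * X (1 - i) (1 - j) \<in> th 1"
      if "i \<in> {p, 1 - p}" "j \<in> {p, 1 - p}" for i j
    proof -
      have that': "1 - i \<in> {p, 1 - p}" "1 - j \<in> {p, 1 - p}" using that by auto
      from F.thirds_mult_cong[OF YX[OF that] YX[OF that'] X[OF that] Y0]
      show ?thesis using sl_dual[of i] sl_dual[of j] by (auto elim: F.thirds_mono)
    qed
    have XX: "X p p * X (1 - p) (1 - p) = X p (1 - p) * X (1 - p) p" by (simp add: X_def)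
    from F.thirds_diff[OF prod[of p p] prod[of p "1 - p"]]
    show "Y $ p $ p * Y $ (1 - p) $ (1 - p) - Y $ p $ (1 - p) * Y $ (1 - p) $ p \<in> th 1"
      by (simp add: XX)
  qed
  ultimately show False using assms by (simp add: fundamental_def)
qed

end

section \<open>Duality for lattices\<close>

context unram_setting
begin

text \<open>
  A vector outside a bounded submodule of the standard space is separated from it by a linear form
  with values in the maximal ideal on the submodule. The induction on the coordinates is
  triangular reduction: an element of the submodule with \<open>j\<close>-th coordinate of least
  valuation clears that coordinate of all others, and the coefficient of the linear form at \<open>j\<close> is then
  chosen to make the form vanish on it.
\<close>

lemma dual_separation:
  fixes M :: "('i \<Rightarrow> 'f) set"
  assumes "finite I"
    and "(\<lambda>_. 0) \<in> M"
    and "\<And>m m'. m \<in> M \<Longrightarrow> m' \<in> M \<Longrightarrow> (\<lambda>i. m i + m' i) \<in> M"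
    and "\<And>a m. a \<in> th 0 \<Longrightarrow> m \<in> M \<Longrightarrow> (\<lambda>i. a * m i) \<in> M"
    and "\<And>m i. m \<in> M \<Longrightarrow> i \<notin> I \<Longrightarrow> m i = 0"
    and "\<And>m i. m \<in> M \<Longrightarrow> m i \<in> th b"
    and "\<And>i. i \<notin> I \<Longrightarrow> d i = 0" and "d \<notin> M"
  shows "\<exists>x. (\<forall>m\<in>M. (\<Sum>i\<in>I. x i * m i) \<in> th 1) \<and> (\<Sum>i\<in>I. x i * d i) \<notin> th 1"
  using assms
proof (induction I arbitrary: M d rule: finite_induct)
  case empty
  then have "d = (\<lambda>_. 0)" by auto
  then show ?case using empty by simp
next
  case (insert j I)
  note zero = insert.prems(1) and add = insert.prems(2) and scale = insert.prems(3)
    and supp = insert.prems(4) and bdd = insert.prems(5) and dsupp = insert.prems(6)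
    and dM = insert.prems(7)
  define M0 where "M0 = {m \<in> M. m j = 0}"
  have IH: "\<exists>x. (\<forall>m\<in>M0. (\<Sum>i\<in>I. x i * m i) \<in> th 1) \<and> (\<Sum>i\<in>I. x i * d' i) \<notin> th 1"
    if "d' \<notin> M0" "\<And>i. i \<notin> I \<Longrightarrow> d' i = 0" for d'
  proof (rule insert.IH)
    show "m i = 0" if "m \<in> M0" "i \<notin> I" for m i
      using that supp[of m i] by (cases "i = j") (auto simp: M0_def)
  qed (use that zero add scale bdd in \<open>auto simp: M0_def\<close>)
  have sum_insert: "(\<Sum>i\<in>insert j I. f i) = f j + (\<Sum>i\<in>I. f i)" for f :: "'i \<Rightarrow> 'f"
    using insert.hyps by simp
  show ?case
  proof (cases "\<forall>m\<in>M. m j = 0")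
    case True
    show ?thesis
    proof (cases "d j = 0")
      case d0: True
      then have "\<exists>x. (\<forall>m\<in>M0. (\<Sum>i\<in>I. x i * m i) \<in> th 1) \<and> (\<Sum>i\<in>I. x i * d i) \<notin> th 1"
        using dM dsupp d0 by (intro IH) (auto simp: M0_def, metis)
      then obtain x where x: "\<And>m. m \<in> M0 \<Longrightarrow> (\<Sum>i\<in>I. x i * m i) \<in> th 1"
        "(\<Sum>i\<in>I. x i * d i) \<notin> th 1" by blast
      show ?thesis
        unfolding sum_insert using True d0 x by (intro exI[of _ x]) (auto simp: M0_def)
    next
      case False
      define x where "x i = (if i = j then 1 / d j else 0)" for i
      have x: "(\<Sum>i\<in>I. x i * f i) = 0" for f
        using insert.hyps by (intro sum.neutral) (auto simp: x_def)
      show ?thesis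
        unfolding sum_insert using True False
        by (intro exI[of _ x]) (auto simp: x, auto simp: x_def thirds_def)
    qed
  next
    case False
    then obtain m1 where m1: "m1 \<in> M" "m1 j \<noteq> 0" by blast
    obtain e where e: "e \<in> M" "e j \<noteq> 0"
      and least: "\<And>m. m \<in> M \<Longrightarrow> m j \<noteq> 0 \<Longrightarrow> vF (e j) \<le> vF (m j)"
    proof -
      from ex_has_least_nat[of "\<lambda>m. m \<in> M \<and> m j \<noteq> 0" m1 "\<lambda>m. nat (3 * vF (m j) - b)"] m1
      obtain e where "e \<in> M" "e j \<noteq> 0"
        "\<And>m. m \<in> M \<Longrightarrow> m j \<noteq> 0 \<Longrightarrow> nat (3 * vF (e j) - b) \<le> nat (3 * vF (m j) - b)"
        by blast
      moreover have "b \<le> 3 * vF (m j)" if "m \<in> M" "m j \<noteq> 0" for m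
        using bdd[OF that(1), of j] that by (simp add: thirds_def)
      ultimately show thesis by (intro that) (auto simp: nat_le_eq_zle)
    qed
    have quot: "m j / e j \<in> th 0" if "m \<in> M" for m
      using least[OF that] e by (cases "m j = 0") (simp_all add: thirds_def F.v_divide)
    have reduce: "(\<lambda>i. m i - m j / e j * e i) \<in> M0" if "m \<in> M" for m
    proof -
      have "- (m j / e j) \<in> th 0" using quot[OF that] by simp
      from add[OF that scale[OF this e(1)]] show ?thesis using e by (simp add: M0_def)
    qed
    show ?thesis
    proof (cases "d j / e j \<in> th 0")
      case True
      define d' where "d' i = d i - d j / e j * e i" for i
      have "d' \<notin> M0"
      proof
        assume "d' \<in> M0"
        then have "(\<lambda>i. d' i + d j / e j * e i) \<in> M" using scale[OF True e(1)] by (intro add) (auto simp: M0_def)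
        then show False using dM by (simp add: d'_def)
      qed
      moreover have "d' i = 0" if "i \<notin> I" for i
        using that e supp[OF e(1)] dsupp by (cases "i = j") (auto simp: d'_def)
      ultimately obtain x where x: "\<And>m. m \<in> M0 \<Longrightarrow> (\<Sum>i\<in>I. x i * m i) \<in> th 1"
        "(\<Sum>i\<in>I. x i * d' i) \<notin> th 1" using IH by blast
      define y where "y = x (j := - (\<Sum>i\<in>I. x i * e i) / e j)"
      have y: "(\<Sum>i\<in>insert j I. y i * m i) = (\<Sum>i\<in>I. x i * (m i - m j / e j * e i))" for m
      proof -
        have "(\<Sum>i\<in>I. y i * m i) = (\<Sum>i\<in>I. x i * m i)"
          using insert.hyps by (intro sum.cong) (auto simp: y_def)
        moreover have "(\<Sum>i\<in>I. x i * (m i - m j / e j * e i))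
            = (\<Sum>i\<in>I. x i * m i) - m j / e j * (\<Sum>i\<in>I. x i * e i)"
          by (simp add: right_diff_distrib sum_subtractf sum_distrib_left mult_ac)
        ultimately show ?thesis unfolding sum_insert by (simp add: y_def)
      qed
      show ?thesis
        using x(1)[OF reduce] x(2) unfolding d'_def by (intro exI[of _ y]) (simp add: y)
    next
      case False
      define x where "x i = (if i = j then unifF D / e j else 0)" for i
      have x: "(\<Sum>i\<in>insert j I. x i * m i) = unifF D * (m j / e j)" for m
      proof -
        have "(\<Sum>i\<in>I. x i * m i) = 0" using insert.hyps by (intro sum.neutral) (auto simp: x_def)
        then show ?thesis unfolding sum_insert by (simp add: x_def)
      qed
      have "unifF D * y \<in> th 1 \<longleftrightarrow> y \<in> th 0" for y
        using unifF by (cases "y = 0") (auto simp: thirds_def F.v_mult)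
      then have "(\<forall>m\<in>M. (\<Sum>i\<in>insert j I. x i * m i) \<in> th 1)
          \<and> (\<Sum>i\<in>insert j I. x i * d i) \<notin> th 1"
        unfolding x using quot False by blast
      then show ?thesis by (intro exI[of _ x])
    qed
  qed
qed

end

context split_sequence
begin

lemma trace_mult_eq: "trace (X ** Y) = (\<Sum>i\<in>UNIV. \<Sum>j\<in>UNIV. X $ i $ j * Y $ j $ i)"
  by (simp add: trace_def matrix_mult_nth)

lemma mat_mult_nth: "(mat a ** X) $ i $ j = a * (X $ i $ j :: 'f)"
  by (simp add: matrix_mult_nth mat_def if_distrib[of "\<lambda>x. x * _"] cong: if_cong)

lemma filt_mat_scale: "a \<in> th 0 \<Longrightarrow> X \<in> filt \<Lambda> k \<Longrightarrow> mat a ** X \<in> filt \<Lambda> k"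
  unfolding filt_iff using F.thirds_mult[of a 0]
  by (simp add: mat_mult_nth)

lemma mat_central: "mat a ** X = X ** mat (a :: 'f)"
  by (simp add: vec_eq_iff matrix_mult_nth mat_def if_distrib[of "\<lambda>x. x * _"]
      if_distrib[of "\<lambda>x. _ * x"] mult.commute cong: if_cong)

lemma trace_mat_mult: "trace (mat a ** X) = a * trace (X :: 'f^4^4)"
  by (simp add: trace_def mat_mult_nth sum_distrib_left)

text \<open>
  Under the trace form the steps \<open>-r\<close> and \<open>r + 1\<close> of the filtration are dual to each other; multiples of
  matrix units suffice as tests.
\<close>

lemma filt_dual:
  assumes X: "\<And>U. U \<in> filt \<Lambda> (- int r) \<Longrightarrow> trace (X ** U) \<in> th 1"
  shows "X \<in> filt \<Lambda> (int (Suc r))"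
  unfolding filt_iff
proof (intro allI)
  fix i j
  define a where "a = - int r + sl i - sl j"
  show "X $ i $ j \<in> th (int (Suc r) + sl j - sl i)"
  proof (cases "X $ i $ j = 0")
    case False
    \<comment> \<open>the exponent is the rounding up of \<open>a / 3\<close>\<close>
    define k where "k = - ((- a) div 3)"
    have k: "a \<le> 3 * k" "3 * k < a + 3" unfolding k_def by presburger+
    define c where "c = unifF D powi k"
    have c: "c \<noteq> 0" "vF c = k" using unifF by (simp_all add: c_def F.v_power_int)
    define U :: "'f^4^4" where "U = (\<chi> i' j'. if i' = j \<and> j' = i then c else 0)"
    have "U \<in> filt \<Lambda> (- int r)"
      unfolding filt_iff U_def using k c by (auto simp: a_def thirds_def)
    moreover have "trace (X ** U) = X $ i $ j * c"
    proof -
      have "X $ i' $ j' * U $ j' $ i' = (if j' = j then if i' = i then X $ i' $ j' * c else 0 else 0)" for i' j'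
        by (simp add: U_def)
      then show ?thesis unfolding trace_mult_eq by simp
    qed
    ultimately have "X $ i $ j * c \<in> th 1" using X by metis
    then have "1 \<le> 3 * (vF (X $ i $ j) + k)" using False c by (simp add: thirds_def F.v_mult)
    then have "1 \<le> vF (X $ i $ j) + k" by presburger
    then show ?thesis using k by (simp add: thirds_def a_def)
  qed simp
qed

lemma filt_bounded: "\<exists>b. \<forall>X\<in>filt \<Lambda> k. \<forall>i j. X $ i $ j \<in> th b"
proof -
  define b where "b = Min ((\<lambda>(i, j). k + sl j - sl i) ` UNIV)"
  have "b \<le> k + sl j - sl i" for i j
    unfolding b_def by (rule Min_le) (auto intro!: image_eqI[of _ _ "(i, j)"])
  then have "\<forall>X\<in>filt \<Lambda> k. \<forall>i j. X $ i $ j \<in> th b"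
    using F.thirds_mono unfolding Ball_def filt_iff by blast
  then show ?thesis ..
qed

text \<open>
  Dually, an element that pairs trivially with the intersection of two filtration lattices lies in the
  sum of their duals.
\<close>

lemma trace_dual_intersection:
  assumes gh: "g ** h = mat 1" "h ** g = (mat 1 :: 'f^4^4)"
    and \<Delta>: "\<And>X. X \<in> filt \<Lambda> (int (Suc r)) \<Longrightarrow> h ** X ** g \<in> filt \<Lambda> (int (Suc r)) \<Longrightarrow>
      trace (X ** \<Delta>) \<in> th 1"
  obtains U U' where "U \<in> filt \<Lambda> (- int r)" "U' \<in> filt \<Lambda> (- int r)" "\<Delta> = U + g ** U' ** h"
proof (rule ccontr)
  assume no: "\<not> thesis"
  let ?F = "filt \<Lambda> (- int r)"
  \<comment> \<open>matrices as functions on pairs of indices, to which \<open>dual_separation\<close> applies\<close>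
  define fn where "fn X = (\<lambda>(i, j). X $ i $ j)" for X :: "'f^4^4"
  define sm where "sm = {U + g ** U' ** h | U U'. U \<in> ?F \<and> U' \<in> ?F}"
  have fn_inj: "fn X = fn Y \<longleftrightarrow> X = Y" for X Y
    unfolding fn_def fun_eq_iff by (auto simp: vec_eq_iff)
  have smI: "U \<in> ?F \<Longrightarrow> U' \<in> ?F \<Longrightarrow> U + g ** U' ** h \<in> sm" for U U' unfolding sm_def by blast
  have F0: "0 \<in> ?F" unfolding filt_iff by simp
  have "\<exists>x. (\<forall>m\<in>fn ` sm. (\<Sum>i\<in>UNIV. x i * m i) \<in> th 1) \<and> (\<Sum>i\<in>UNIV. x i * fn \<Delta> i) \<notin> th 1"
  proof -
    obtain b where b: "\<And>X i j. X \<in> ?F \<Longrightarrow> X $ i $ j \<in> th b" using filt_bounded by metis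
    obtain a where a: "g \<in> filt \<Lambda> a" "h \<in> filt \<Lambda> a"
    proof -
      have "\<forall>i j. \<exists>c. g $ i $ j \<in> th c" "\<forall>i j. \<exists>c. h $ i $ j \<in> th c"
        using F.thirds_ex by blast+
      then obtain bg bh where bg: "\<And>i j. g $ i $ j \<in> th (bg i j)"
        and bh: "\<And>i j. h $ i $ j \<in> th (bh i j)" by metis
      define a where "a = Min ((\<lambda>(i, j). min (bg i j) (bh i j) - sl j + sl i) ` UNIV)"
      have a: "a \<le> min (bg i j) (bh i j) - sl j + sl i" for i j
        unfolding a_def by (rule Min_le) (auto intro!: image_eqI[of _ _ "(i, j)"])
      have "a + sl j - sl i \<le> bg i j" "a + sl j - sl i \<le> bh i j" for i j
        using a[of i j] by linarith+
      then have "g \<in> filt \<Lambda> a" "h \<in> filt \<Lambda> a"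
        unfolding filt_iff using bg bh F.thirds_mono by blast+
      then show thesis by (rule that)
    qed
    obtain b' where b': "\<And>X i j. X \<in> filt \<Lambda> (a + - int r + a) \<Longrightarrow> X $ i $ j \<in> th b'"
      using filt_bounded by metis
    show ?thesis
    proof (rule dual_separation[where b = "min b b'"])
      show "(\<lambda>_. 0) \<in> fn ` sm" using smI[OF F0 F0] by (auto simp: fn_def image_iff intro!: bexI)
      show "(\<lambda>i. m i + m' i) \<in> fn ` sm" if "m \<in> fn ` sm" "m' \<in> fn ` sm" for m m'
      proof -
        obtain U U' V V' where *: "m = fn (U + g ** U' ** h)" "m' = fn (V + g ** V' ** h)"
          "U \<in> ?F" "U' \<in> ?F" "V \<in> ?F" "V' \<in> ?F" using \<open>m \<in> _\<close> \<open>m' \<in> _\<close> unfolding sm_def by blast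
        have "(\<lambda>i. m i + m' i) = fn ((U + V) + g ** (U' + V') ** h)"
          unfolding *(1,2) fn_def by (auto simp: matrix_distribs fun_eq_iff)
        moreover have "(U + V) + g ** (U' + V') ** h \<in> sm" using * by (intro smI filt_add)
        ultimately show ?thesis by blast
      qed
      show "(\<lambda>i. a * m i) \<in> fn ` sm" if "a \<in> th 0" "m \<in> fn ` sm" for a m
      proof -
        obtain U U' where *: "m = fn (U + g ** U' ** h)" "U \<in> ?F" "U' \<in> ?F"
          using \<open>m \<in> _\<close> unfolding sm_def by blast
        have "mat a ** U + g ** (mat a ** U') ** h = mat a ** (U + g ** U' ** h)"
          by (simp add: matrix_distribs matrix_mul_assoc mat_central[of a g])
        moreover have "(\<lambda>i. a * m i) = fn (mat a ** (U + g ** U' ** h))"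
          unfolding * fn_def
          by (auto simp: fun_eq_iff mat_mult_nth)
        moreover have "mat a ** U + g ** (mat a ** U') ** h \<in> sm"
          using * \<open>a \<in> th 0\<close> by (intro smI filt_mat_scale)
        ultimately show ?thesis by (metis imageI)
      qed
      show "m i \<in> th (min b b')" if "m \<in> fn ` sm" for m i
      proof -
        obtain U U' where *: "m = fn (U + g ** U' ** h)" "U \<in> ?F" "U' \<in> ?F"
          using \<open>m \<in> _\<close> unfolding sm_def by blast
        have "g ** U' ** h \<in> filt \<Lambda> (a + - int r + a)" using a * by (intro filt_mult)
        then have "(g ** U' ** h) $ k $ j \<in> th (min b b')" for k j
          by (intro F.thirds_mono[OF b']) auto
        moreover have "U $ k $ j \<in> th (min b b')" for k j
          using b[OF *(2), of k j] by (rule F.thirds_mono) simp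
        ultimately have "(U + g ** U' ** h) $ k $ j \<in> th (min b b')" for k j
          by (simp add: F.thirds_add)
        then show ?thesis unfolding * fn_def by (cases i) simp
      qed
      show "fn \<Delta> \<notin> fn ` sm"
      proof
        assume "fn \<Delta> \<in> fn ` sm"
        then have "\<Delta> \<in> sm" using fn_inj by auto
        then show False using no that unfolding sm_def by blast
      qed
    qed auto
  qed
  then obtain x where x: "\<And>m. m \<in> sm \<Longrightarrow> (\<Sum>i\<in>UNIV. x i * fn m i) \<in> th 1"
    "(\<Sum>i\<in>UNIV. x i * fn \<Delta> i) \<notin> th 1" by auto
  \<comment> \<open>the transpose makes the linear form the trace pairing with \<open>X\<close>\<close>
  define X :: "'f^4^4" where "X = (\<chi> j i. x (i, j))"
  have tr: "trace (X ** m) = (\<Sum>i\<in>UNIV. x i * fn m i)" for m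
  proof -
    have "trace (X ** m) = (\<Sum>j\<in>UNIV. \<Sum>i\<in>UNIV. x (i, j) * m $ i $ j)"
      by (simp add: trace_mult_eq X_def)
    also have "\<dots> = (\<Sum>i\<in>UNIV. \<Sum>j\<in>UNIV. x (i, j) * m $ i $ j)" by (rule sum.swap)
    also have "\<dots> = (\<Sum>z\<in>UNIV \<times> UNIV. x z * fn m z)"
      by (simp add: sum.cartesian_product fn_def case_prod_beta)
    finally show ?thesis by simp
  qed
  have "trace (X ** \<Delta>) \<in> th 1"
  proof (rule \<Delta>)
    show "X \<in> filt \<Lambda> (int (Suc r))"
    proof (rule filt_dual)
      fix U assume "U \<in> ?F"
      then show "trace (X ** U) \<in> th 1" using x(1)[OF smI[OF _ F0]] by (simp add: tr)
    qed
    show "h ** X ** g \<in> filt \<Lambda> (int (Suc r))"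
    proof (rule filt_dual)
      fix U assume "U \<in> ?F"
      then have "trace (X ** (g ** U ** h)) \<in> th 1" using x(1)[OF smI[OF F0, of U]] by (simp add: tr)
      moreover have "trace (X ** (g ** U ** h)) = trace (h ** X ** g ** U)"
        using trace_mul_sym[of "X ** g ** U" h] by (simp add: matrix_mul_assoc)
      ultimately show "trace (h ** X ** g ** U) \<in> th 1" by simp
    qed
  qed
  then show False using x(2) by (simp add: tr)
qed

text \<open>
  The characters are defined on the unitary group, but by the Cayley transform their agreement on an
  intersection is a statement on the Lie algebra, and the skew part \<open>X - \<sigma>(X)\<close> of an arbitrary matrix
  has the same pairing with a skew element as the matrix itself, up to the factor 2.
\<close>

lemma intertwining_elements:
  assumes \<beta>: "\<beta> \<in> filt \<Lambda> (- int n)" "\<beta> \<in> lie_U22 D"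
    and \<gamma>: "\<gamma> \<in> filt \<Lambda> (- int n)" "\<gamma> \<in> lie_U22 D"
    and n: "n \<le> 2 * r + 1" and g: "g \<in> U22 D"
    and agree: "\<And>x. x \<in> P (Suc r) \<Longrightarrow> sigma D g ** x ** g \<in> P (Suc r) \<Longrightarrow>
      psi D \<gamma> x = psi D \<beta> (sigma D g ** x ** g)"
  obtains U U' where "U \<in> filt \<Lambda> (- int r)" "U' \<in> filt \<Lambda> (- int r)"
    "(\<gamma> - U) ** g = g ** (\<beta> + U')"
proof -
  let ?F = "filt \<Lambda> (int (Suc r))"
  let ?h = "sigma D g"
  note gh = U22_inverse(1,2)[OF g]
  define \<Delta> where "\<Delta> = \<gamma> - g ** \<beta> ** ?h"
  have \<Delta>_skew: "sigma D \<Delta> = - \<Delta>"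
  proof -
    have "sigma D \<gamma> = - \<gamma>" "sigma D \<beta> = - \<beta>" using \<beta>(2) \<gamma>(2) by (simp_all add: lie_iff)
    moreover have "g ** (- \<beta>) ** ?h = - (g ** \<beta> ** ?h)"
      using matrix_diff_ldistrib[of g 0 \<beta>] matrix_diff_rdistrib[of 0 "g ** \<beta>" ?h] by simp
    ultimately show ?thesis by (simp add: \<Delta>_def sigma_diff sigma_mult matrix_mul_assoc)
  qed
  have skew_pairing: "Omega D (traceF D (trace (\<Delta> ** ((W - sigma D W) + (W - sigma D W))))) = 1"
    if W: "W \<in> ?F" and W': "?h ** W ** g \<in> ?F" for W
  proof -
    define y where "y = W - sigma D W"
    define y' where "y' = ?h ** y ** g"
    have y: "y \<in> ?F" unfolding y_def using W by (intro filt_diff filt_sigma)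
    have "y' = ?h ** W ** g - sigma D (?h ** W ** g)"
      by (simp add: y'_def y_def matrix_distribs sigma_mult matrix_mul_assoc)
    then have y': "y' \<in> ?F" using W' by (simp only:) (intro filt_diff filt_sigma)
    have y_lie: "y \<in> lie_U22 D" by (simp add: y_def lie_iff sigma_diff)
    obtain z where z: "z ** (mat 1 - y) = mat 1" using filt_mono[OF y, of 1] by (auto elim: one_minus_invertible)
    define z' where "z' = ?h ** z ** g"
    have z': "z' ** (mat 1 - y') = mat 1"
    proof -
      have "mat 1 - y' = ?h ** (mat 1 - y) ** g" using gh by (simp add: y'_def matrix_distribs)
      then have "z' ** (mat 1 - y') = ?h ** z ** (g ** ?h) ** (mat 1 - y) ** g"
        by (simp only: z'_def matrix_mul_assoc)
      also have "\<dots> = ?h ** (z ** (mat 1 - y)) ** g" by (simp add: gh matrix_mul_assoc)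
      finally show ?thesis using z gh by simp
    qed
    \<comment> \<open>the Cayley transform of \<open>y\<close>; that of \<open>y'\<close> is its conjugate\<close>
    define x where "x = mat 1 + z ** (y + y)"
    have x'_eq: "?h ** x ** g = mat 1 + z' ** (y' + y')"
    proof -
      have "z' ** (y' + y') = ?h ** z ** (g ** ?h) ** (y + y) ** g"
        unfolding z'_def y'_def by (simp only: matrix_add_ldistrib matrix_add_rdistrib matrix_mul_assoc)
      then show ?thesis using gh by (simp add: x_def matrix_distribs matrix_mul_assoc)
    qed
    have zf: "z \<in> filt \<Lambda> 0" "z' \<in> filt \<Lambda> 0"
      using one_minus_inverse_filt[OF filt_mono[OF y] z] one_minus_inverse_filt[OF filt_mono[OF y'] z']
      by simp_all
    have xP: "x \<in> P (Suc r)"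
      using cayley_U22[OF y_lie z] filt_mult[OF zf(1) filt_add[OF y y]] by (simp add: P_Suc_iff x_def)
    moreover have x'P: "?h ** x ** g \<in> P (Suc r)"
    proof -
      have "?h ** x ** g \<in> U22 D" using xP g by (simp add: P_Suc_iff U22_mult U22_sigma)
      then show ?thesis
        using filt_mult[OF zf(2) filt_add[OF y' y']] by (simp add: P_Suc_iff x'_eq)
    qed
    ultimately have "psi D \<gamma> x = psi D \<beta> (?h ** x ** g)" by (rule agree)
    then have "Omega D (traceF D (trace (\<gamma> ** (y + y)))) = Omega D (traceF D (trace (\<beta> ** (y' + y'))))"
      using psi_cayley[OF y z \<gamma>(1) n] psi_cayley[OF y' z' \<beta>(1) n] by (simp only: x'_eq) (simp only: x_def)
    moreover have "trace (\<beta> ** (y' + y')) = trace (g ** \<beta> ** ?h ** (y + y))"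
      using trace_mul_sym[of "\<beta> ** ?h ** (y + y)" g]
      unfolding y'_def by (simp only: matrix_add_ldistrib matrix_add_rdistrib matrix_mul_assoc)
    moreover have "trace (\<gamma> ** (y + y)) = trace (\<Delta> ** (y + y)) + trace (g ** \<beta> ** ?h ** (y + y))"
      by (simp add: \<Delta>_def matrix_diff_rdistrib trace_sub)
    ultimately show ?thesis by (simp add: traceF_add Omega_add y_def)
  qed
  have pairing: "trace (W ** \<Delta>) \<in> th 1" if W: "W \<in> ?F" "?h ** W ** g \<in> ?F" for W
  proof -
    let ?T = "trace (W ** \<Delta>)"
    \<comment> \<open>one factor 2 comes from the Cayley transform, the other from the skew part\<close>
    have "Omega D (traceF D (a * (2 * 2 * ?T))) = 1" if a: "a \<in> th 0" for a
    proof -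
      define aW where "aW = mat a ** W"
      have T: "trace (\<Delta> ** aW) = a * ?T"
        using trace_mul_sym[of \<Delta> aW] by (simp add: aW_def trace_mat_mult flip: matrix_mul_assoc)
      have "trace (\<Delta> ** sigma D aW) = - trace (sigma D (aW ** \<Delta>))"
        using matrix_diff_rdistrib[of 0 \<Delta> "sigma D aW"] trace_sub[of 0 "\<Delta> ** sigma D aW"]
        by (simp add: sigma_mult \<Delta>_skew trace_def)
      also have "trace (sigma D (aW ** \<Delta>)) = cnjF D (a * ?T)"
        using T trace_mul_sym[of \<Delta> aW] by (simp add: trace_sigma)
      finally have "trace (\<Delta> ** ((aW - sigma D aW) + (aW - sigma D aW)))
          = 2 * (a * ?T + cnjF D (a * ?T))"
        using T by (simp only: matrix_add_ldistrib matrix_diff_ldistrib trace_add trace_sub) simp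
      also have "traceF D \<dots> = traceF D (a * (2 * 2 * ?T))"
      proof (rule emb_eqI)
        have "cnjF D 2 = 2" using cnjF_emb[of 2] by (simp add: emb_two)
        moreover from this have "cnjF D 4 = 4" using cnjF_mult[of 2 2] by simp
        ultimately show "emb D (traceF D (2 * (a * ?T + cnjF D (a * ?T)))) = emb D (traceF D (a * (2 * 2 * ?T)))"
          by (simp add: emb_traceF cnjF_add cnjF_mult algebra_simps)
      qed
      moreover have "aW \<in> ?F" using W(1) a by (simp add: aW_def filt_mat_scale)
      moreover have "?h ** aW ** g \<in> ?F"
      proof -
        have "?h ** aW ** g = mat a ** (?h ** W ** g)"
          by (simp add: aW_def matrix_mul_assoc mat_central[of a ?h])
        then show ?thesis using W(2) a by (simp add: filt_mat_scale)
      qed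
      ultimately show ?thesis using skew_pairing[of aW] by simp
    qed
    from Omega_traceF_nondegenerate[OF this] have "2 * 2 * ?T \<in> th 1" .
    then have "2 * 2 * ?T / 2 / 2 \<in> th 1" by (simp only: thirds_half)
    moreover have "2 * 2 * ?T / 2 / 2 = ?T" 
      by (simp only: mult.assoc nonzero_mult_div_cancel_left[OF F_two(1)])
    ultimately show "?T \<in> th 1" by (simp only:)
  qed
  obtain U U' where U: "U \<in> filt \<Lambda> (- int r)" "U' \<in> filt \<Lambda> (- int r)" and eq: "\<Delta> = U + g ** U' ** ?h"
    using trace_dual_intersection[OF gh pairing] by blast
  have "\<gamma> - U = g ** (\<beta> + U') ** ?h" using eq by (simp add: \<Delta>_def matrix_distribs algebra_simps)
  then have "(\<gamma> - U) ** g = g ** (\<beta> + U') ** (?h ** g)" by (simp add: matrix_mul_assoc)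
  then show thesis using U that gh by simp
qed

end

section \<open>Representations that contain two characters\<close>

context unram_setting
begin

lemma finite_representatives_base:
  "\<exists>T. finite T \<and> (\<forall>x\<in>frac_ideal v0 0. \<exists>t\<in>T. x - t \<in> frac_ideal v0 (int k))"
proof (induction k)
  case 0
  show ?case by (rule exI[of _ "{0}"]) simp
next
  case (Suc k)
  then obtain T where T: "finite T" "\<And>x. x \<in> frac_ideal v0 0 \<Longrightarrow> \<exists>t\<in>T. x - t \<in> frac_ideal v0 (int k)"
    by blast
  define R where "R = (\<lambda>C. SOME x. x \<in> C) ` residue_field v0"
  have R: "\<exists>t\<in>R. z - t \<in> frac_ideal v0 1" if "z \<in> frac_ideal v0 0" for z
  proof -
    define t where "t = (SOME x. x \<in> res_class v0 z)"
    have "z \<in> res_class v0 z" by (simp add: res_class_def)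
    then have "t \<in> res_class v0 z" unfolding t_def by (rule someI)
    then have "- (t - z) \<in> frac_ideal v0 1" unfolding res_class_def by (intro frac_uminus) simp
    moreover have "t \<in> R" using that by (auto simp: R_def t_def residue_field_def)
    ultimately show ?thesis by auto
  qed
  define T' where "T' = (\<lambda>(t, r). t + unif D ^ k * r) ` (T \<times> R)"
  have "finite T'" using T finite_residue_field by (simp add: T'_def R_def)
  moreover have "\<exists>t\<in>T'. x - t \<in> frac_ideal v0 (int (Suc k))" if x: "x \<in> frac_ideal v0 0" for x
  proof -
    obtain t where t: "t \<in> T" "x - t \<in> frac_ideal v0 (int k)" using T x by blast
    define z where "z = (x - t) / unif D ^ k"
    have xz: "x - t = unif D ^ k * z" using unif by (simp add: z_def)
    have "z \<in> frac_ideal v0 0"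
      using t(2) unif by (cases "x - t = 0") (simp_all add: z_def frac_ideal_def v_divide v_power)
    then obtain r where r: "r \<in> R" "z - r \<in> frac_ideal v0 1" using R by blast
    have "unif D ^ k \<in> frac_ideal v0 (int k)" using unif by (simp add: frac_ideal_def v_power)
    from frac_mult[OF this r(2)] have "x - (t + unif D ^ k * r) \<in> frac_ideal v0 (int (Suc k))"
      using xz by (simp add: algebra_simps)
    moreover have "t + unif D ^ k * r \<in> T'" using t r by (auto simp: T'_def)
    ultimately show ?thesis by blast
  qed
  ultimately show ?case by blast
qed

lemma finite_representatives: "\<exists>T. finite T \<and> (\<forall>x\<in>th c. \<exists>t\<in>T. x - t \<in> th m)"
proof -
  define N where "N = nat \<bar>c\<bar>"
  define k where "k = nat (int N + \<bar>m\<bar>)"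
  obtain T where T: "finite T" "\<forall>x\<in>frac_ideal v0 0. \<exists>t\<in>T. x - t \<in> frac_ideal v0 (int k)"
    using finite_representatives_base[of k] by (elim exE conjE)
  define u where "u = unifF D ^ N"
  have u: "u \<noteq> 0" "vF u = int N" using unifF by (simp_all add: u_def F.v_power)
  define T' where "T' = (\<lambda>(a, b). (emb D a + emb D b * s) / u) ` (T \<times> T)"
  have "\<exists>t\<in>T'. x - t \<in> th m" if x: "x \<in> th c" for x
  proof -
    obtain a b where ab: "u * x = emb D a + emb D b * s" using F_coords by metis
    have "u * x \<in> frac_ideal vF 0"
      using x u unfolding F.thirds_frac_0[symmetric]
      by (cases "x = 0") (auto simp: thirds_def F.v_mult N_def)
    then have "a \<in> frac_ideal v0 0" "b \<in> frac_ideal v0 0" unfolding ab frac_coords by blast+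
    then obtain t t' where t: "t \<in> T" "t' \<in> T" "a - t \<in> frac_ideal v0 (int k)"
      "b - t' \<in> frac_ideal v0 (int k)" using T(2)[rule_format] by meson
    define y where "y = emb D (a - t) + emb D (b - t') * s"
    have "y \<in> frac_ideal vF (int k)" unfolding y_def frac_coords using t by simp
    then have "y / u \<in> th m"
      using u by (cases "y = 0") (auto simp: frac_ideal_def thirds_def F.v_divide k_def)
    moreover have "y / u = x - (emb D t + emb D t' * s) / u"
      using u ab by (simp add: y_def emb_diff field_simps)
    moreover have "(emb D t + emb D t' * s) / u \<in> T'" using t by (auto simp: T'_def)
    ultimately show ?thesis by force
  qed
  moreover have "finite T'" using T by (simp add: T'_def)
  ultimately show ?thesis by blast
qed

end

context split_sequence
begin

lemma finite_filt_representatives: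
  "\<exists>T. finite T \<and> (\<forall>X\<in>filt \<Lambda> 0. \<exists>t\<in>T. X - t \<in> filt \<Lambda> m)"
proof -
  have "\<forall>i j. \<exists>T. finite T \<and> (\<forall>x\<in>th (sl j - sl i). \<exists>t\<in>T. x - t \<in> th (m + sl j - sl i))"
    using finite_representatives by blast
  then obtain T where T: "\<And>i j. finite (T i j)"
    "\<And>i j x. x \<in> th (sl j - sl i) \<Longrightarrow> \<exists>t\<in>T i j. x - t \<in> th (m + sl j - sl i)" by metis
  define U where "U = (\<Union>i. \<Union>j. T i j)"
  define TT where "TT = (\<lambda>f :: 4 \<times> 4 \<Rightarrow> 'f. (\<chi> i j. f (i, j)) :: 'f^4^4) ` (UNIV \<rightarrow>\<^sub>E U)"
  have "finite U" using T by (simp add: U_def)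
  then have "finite TT" unfolding TT_def by (intro finite_imageI finite_PiE) auto
  moreover have "\<exists>t\<in>TT. X - t \<in> filt \<Lambda> m" if "X \<in> filt \<Lambda> 0" for X
  proof -
    have "\<forall>i j. \<exists>t. t \<in> T i j \<and> X $ i $ j - t \<in> th (m + sl j - sl i)"
      using that T(2) unfolding filt_iff by (metis add_0)
    then obtain t where t: "\<And>i j. t i j \<in> T i j" "\<And>i j. X $ i $ j - t i j \<in> th (m + sl j - sl i)"
      by metis
    have "(\<lambda>(i, j). t i j) \<in> UNIV \<rightarrow>\<^sub>E U" using t by (auto simp: U_def PiE_UNIV_domain)
    then have "(\<chi> i j. t i j) \<in> TT" unfolding TT_def by (rule rev_image_eqI) simp
    moreover have "X - (\<chi> i j. t i j) \<in> filt \<Lambda> m" unfolding filt_iff using t by simp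
    ultimately show ?thesis by blast
  qed
  ultimately show ?thesis by blast
qed

lemma finite_cosets: "finite ((\<lambda>x. {y \<in> P (Suc r). y - x \<in> filt \<Lambda> m}) ` P (Suc r))"
proof -
  obtain T where T: "finite T" "\<And>X. X \<in> filt \<Lambda> 0 \<Longrightarrow> \<exists>t\<in>T. X - t \<in> filt \<Lambda> m"
    using finite_filt_representatives by metis
  have "{y \<in> P (Suc r). y - x \<in> filt \<Lambda> m} \<in> (\<lambda>t. {y \<in> P (Suc r). y - t \<in> filt \<Lambda> m}) ` T"
    if "x \<in> P (Suc r)" for x
  proof -
    have "x \<in> filt \<Lambda> 0" using that P_subset_P0 P_0_iff by blast
    then obtain t where t: "t \<in> T" "x - t \<in> filt \<Lambda> m" using T by blast
    have "y - x \<in> filt \<Lambda> m \<longleftrightarrow> y - t \<in> filt \<Lambda> m" for y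
      using filt_add[OF _ t(2), of "y - x"] filt_diff[OF _ t(2), of "y - t"] by auto
    then show ?thesis using t(1) by blast
  qed
  then show ?thesis using T(1) by (meson finite_surj image_subsetI)
qed

text \<open>
  If no element intertwined the two characters, the averaging operator of \<open>\<psi>\<^sub>\<gamma>\<close> would kill every
  translate of a vector of type \<open>\<psi>\<^sub>\<beta>\<close>: such a translate is an eigenvector of a conjugate group, and
  averaging compares its eigenvalue with \<open>\<psi>\<^sub>\<gamma>\<close> on the intersection. By irreducibility the translates
  span the space, but averaging multiplies a vector of type \<open>\<psi>\<^sub>\<gamma>\<close> by a positive number. A smooth
  vector is fixed by all elements congruent to 1 to some level \<open>m\<close>, so that the average is a
  finite sum over classes modulo that level.
\<close>

lemma common_representation_intertwines:
  fixes smul :: "complex \<Rightarrow> 'v::ab_group_add \<Rightarrow> 'v"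
  assumes irr: "irreducible_smooth_rep D smul \<pi>"
    and \<gamma>: "\<gamma> \<in> filt \<Lambda> (- int n)" and n: "n \<le> 2 * r + 1"
    and w: "w \<noteq> 0" "\<And>x. x \<in> P (Suc r) \<Longrightarrow> \<pi> x w = smul (psi D \<beta> x) w"
    and w': "w' \<noteq> 0" "\<And>x. x \<in> P (Suc r) \<Longrightarrow> \<pi> x w' = smul (psi D \<gamma> x) w'"
  shows "\<exists>g\<in>U22 D. \<forall>x\<in>P (Suc r). sigma D g ** x ** g \<in> P (Suc r) \<longrightarrow>
      psi D \<gamma> x = psi D \<beta> (sigma D g ** x ** g)"
proof (rule ccontr)
  assume none: "\<not> ?thesis"
  have no: "\<exists>x\<in>P (Suc r). sigma D g ** x ** g \<in> P (Suc r) \<and> psi D \<gamma> x \<noteq> psi D \<beta> (sigma D g ** x ** g)"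
    if "g \<in> U22 D" for g using that none by blast
  let ?K = "P (Suc r)"
  have smooth: "smooth_rep D smul \<pi>"
    and irred: "\<And>W. module.subspace smul W \<Longrightarrow> (\<And>g. g \<in> U22 D \<Longrightarrow> \<pi> g ` W \<subseteq> W) \<Longrightarrow> W = {0} \<or> W = UNIV"
    using irr unfolding irreducible_smooth_rep_def by blast+
  interpret vector_space smul using smooth unfolding smooth_rep_def by blast
  have \<pi>_add: "\<pi> g (x + y) = \<pi> g x + \<pi> g y" and \<pi>_scale: "\<pi> g (smul c x) = smul c (\<pi> g x)"
    if "g \<in> U22 D" for g x y c
  proof -
    interpret L: Vector_Spaces.linear smul smul "\<pi> g"
      using smooth that unfolding smooth_rep_def by blast
    show "\<pi> g (x + y) = \<pi> g x + \<pi> g y" "\<pi> g (smul c x) = smul c (\<pi> g x)"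
      by (rule L.add, rule L.scale)
  qed
  have \<pi>_one: "\<pi> (mat 1) x = x" and \<pi>_mult: "g \<in> U22 D \<Longrightarrow> h \<in> U22 D \<Longrightarrow> \<pi> g (\<pi> h x) = \<pi> (g ** h) x" for g h x
    using smooth unfolding smooth_rep_def by auto
  have KU: "x \<in> U22 D" and K0: "x \<in> filt \<Lambda> 0" if "x \<in> ?K" for x
    using that P_subset_P0 P_0_iff by blast+
  have one: "mat 1 \<in> ?K" by (simp add: P_Suc_iff U22_one filt_iff)
  define cls where "cls m x = {y \<in> ?K. y - x \<in> filt \<Lambda> (int m)}" for m x
  define E where "E m = cls m ` ?K" for m
  define rp where "rp C = (SOME x. x \<in> C)" for C :: "('f^4^4) set"
  define f where "f v x = smul (inverse (psi D \<gamma> x)) (\<pi> x v)" for v x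
  \<comment> \<open>the averaging operator of level \<open>m\<close>, up to a constant factor\<close>
  define e where "e m v = (\<Sum>C\<in>E m. f v (rp C))" for m v
  \<comment> \<open>\<open>n < m\<close> makes \<open>\<psi>\<^sub>\<gamma>\<close> trivial on the elements of level \<open>m\<close>\<close>
  define fixed where "fixed m v \<longleftrightarrow> n < m \<and> (\<forall>q\<in>?K. q - mat 1 \<in> filt \<Lambda> (int m) \<longrightarrow> \<pi> q v = v)" for m v
  have finE: "finite (E m)" for m unfolding E_def cls_def by (rule finite_cosets)
  have psi_nz: "psi D \<gamma> x \<noteq> 0" for x by (simp add: psi_def)
  have cls_self: "x \<in> cls m x" if "x \<in> ?K" for m x using that by (simp add: cls_def filt_iff)
  have rp_cls: "rp (cls m x) \<in> ?K" "rp (cls m x) - x \<in> filt \<Lambda> (int m)" if "x \<in> ?K" for m x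
  proof -
    have "rp (cls m x) \<in> cls m x" unfolding rp_def using cls_self[OF that] by (rule someI)
    then show "rp (cls m x) \<in> ?K" "rp (cls m x) - x \<in> filt \<Lambda> (int m)" by (simp_all add: cls_def)
  qed
  have cls_eq: "cls m x = cls m y" if "x - y \<in> filt \<Lambda> (int m)" for m x y
  proof -
    have "z - x \<in> filt \<Lambda> (int m) \<longleftrightarrow> z - y \<in> filt \<Lambda> (int m)" for z
      using filt_add[OF _ that, of "z - x"] filt_diff[OF _ that, of "z - y"] by auto
    then show ?thesis by (simp add: cls_def)
  qed
  have rpE: "rp C \<in> ?K" "cls m (rp C) = C" if "C \<in> E m" for m C
    using that rp_cls cls_eq unfolding E_def by blast+
  have f_const: "f v y = f v x" if xy: "x \<in> ?K" "y \<in> ?K" "y - x \<in> filt \<Lambda> (int m)" and v: "fixed m v" for m v x y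
  proof -
    define q where "q = sigma D x ** y"
    have q: "q \<in> ?K" unfolding q_def using xy by (intro P_mult P_sigma)
    have "q - mat 1 = sigma D x ** (y - x)" using KU[OF xy(1)] by (simp add: q_def matrix_distribs U22_inverse)
    then have q1: "q - mat 1 \<in> filt \<Lambda> (int m)"
      using filt_mult[OF filt_sigma[OF K0[OF xy(1)]] xy(3)] by simp
    have y: "y = x ** q" using KU[OF xy(1)] by (simp add: q_def matrix_mul_assoc U22_inverse)
    have "\<gamma> ** (q - mat 1) \<in> filt \<Lambda> 1"
      using v by (intro filt_mult'[OF \<gamma> q1]) (simp add: fixed_def)
    then have "psi D \<gamma> q = 1" unfolding psi_def by (intro Omega_traceF_trivial trace_filt)
    then have "psi D \<gamma> y = psi D \<gamma> x" unfolding y using psi_mult[OF \<gamma> n xy(1) q] by simp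
    moreover have "\<pi> y v = \<pi> x v"
    proof -
      have "\<pi> q v = v" using v q q1 by (simp add: fixed_def)
      then show ?thesis using \<pi>_mult[OF KU[OF xy(1)] KU[OF q], of v] by (simp add: y)
    qed
    ultimately show ?thesis by (simp add: f_def)
  qed
  have e_translate: "e m (\<pi> k v) = smul (psi D \<gamma> k) (e m v)" if k: "k \<in> ?K" and v: "fixed m v" for m v k
  proof -
    \<comment> \<open>right translation by \<open>k\<close> permutes the classes\<close>
    define \<tau> where "\<tau> C = cls m (rp C ** k)" for C
    have rk: "rp C ** k \<in> ?K" if "C \<in> E m" for C using P_mult rpE that k by blast
    have "f (\<pi> k v) (rp C) = smul (psi D \<gamma> k) (f v (rp (\<tau> C)))" if C: "C \<in> E m" for C
    proof -
      have "f (\<pi> k v) (rp C) = smul (psi D \<gamma> k) (f v (rp C ** k))"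
        using psi_mult[OF \<gamma> n rpE(1)[OF C] k] psi_nz \<pi>_mult[OF KU[OF rpE(1)[OF C]] KU[OF k]]
        by (simp add: f_def)
      also have "f v (rp C ** k) = f v (rp (\<tau> C))"
        using f_const[OF rk[OF C] rp_cls[OF rk[OF C]] v] by (simp add: \<tau>_def)
      finally show ?thesis .
    qed
    then have "e m (\<pi> k v) = smul (psi D \<gamma> k) (\<Sum>C\<in>E m. f v (rp (\<tau> C)))"
      by (simp add: e_def scale_sum_right)
    also have "(\<Sum>C\<in>E m. f v (rp (\<tau> C))) = (\<Sum>C\<in>E m. f v (rp C))"
    proof -
      have inj: "inj_on \<tau> (E m)"
      proof (rule inj_onI)
        fix C C' assume C: "C \<in> E m" "C' \<in> E m" and eq: "\<tau> C = \<tau> C'"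
        have "rp C ** k \<in> \<tau> C'" using cls_self[OF rk[OF C(1)], of m] eq unfolding \<tau>_def by simp
        then have "rp C ** k - rp C' ** k \<in> filt \<Lambda> (int m)" by (simp add: \<tau>_def cls_def)
        then have "(rp C ** k - rp C' ** k) ** sigma D k \<in> filt \<Lambda> (int m)"
          using filt_mult[OF _ filt_sigma[OF K0[OF k]]] by fastforce
        moreover have "(rp C ** k - rp C' ** k) ** sigma D k = rp C - rp C'"
          using KU[OF k] by (simp add: matrix_diff_rdistrib U22_inverse flip: matrix_mul_assoc)
        ultimately have "cls m (rp C) = cls m (rp C')" using cls_eq by simp
        then show "C = C'" using rpE C by simp
      qed
      moreover have "\<tau> ` E m \<subseteq> E m" using rk by (auto simp: \<tau>_def E_def)
      ultimately have "\<tau> ` E m = E m" using endo_inj_surj[OF finE] by blast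
      then show ?thesis using sum.reindex[OF inj, of "\<lambda>C. f v (rp C)"] by (simp add: comp_def)
    qed
    finally show ?thesis by (simp add: e_def)
  qed
  have e_add: "e m (u + v) = e m u + e m v" and e_scale: "e m (smul c v) = smul c (e m v)" for m u v c
  proof -
    have f: "f (u + v) (rp C) = f u (rp C) + f v (rp C)" "f (smul c v) (rp C) = smul c (f v (rp C))"
      if "C \<in> E m" for C
      using KU[OF rpE(1)[OF that]] by (simp_all add: f_def \<pi>_add \<pi>_scale scale_right_distrib mult.commute)
    show "e m (u + v) = e m u + e m v" by (simp add: e_def f sum.distrib)
    show "e m (smul c v) = smul c (e m v)" by (simp add: e_def f scale_sum_right)
  qed
  have ex_fixed: "\<exists>m0. \<forall>m\<ge>m0. fixed m v" for v
  proof -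
    have "open_in_U22 D {g \<in> U22 D. \<pi> g v = v}" using smooth unfolding smooth_rep_def by blast
    moreover have "mat 1 \<in> {g \<in> U22 D. \<pi> g v = v}" by (simp add: U22_one \<pi>_one)
    ultimately obtain a where a: "\<And>h. h \<in> U22 D \<Longrightarrow>
        (\<And>i j. h $ i $ j - mat 1 $ i $ j \<in> frac_ideal vF a) \<Longrightarrow> \<pi> h v = v"
      unfolding open_in_U22_def by (metis (mono_tags, lifting) mem_Collect_eq)
    define b where "b = Max ((\<lambda>(i, j). 3 * a - sl j + sl i) ` UNIV)"
    have b: "3 * a - sl j + sl i \<le> b" for i j
      unfolding b_def by (rule Max_ge) (auto intro!: image_eqI[of _ _ "(i, j)"])
    have "fixed m v" if m: "m \<ge> Suc n + nat b" for m
      unfolding fixed_def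
    proof (intro conjI ballI impI)
      show "n < m" using m by simp
      fix q assume q: "q \<in> ?K" "q - mat 1 \<in> filt \<Lambda> (int m)"
      have "q $ i $ j - mat 1 $ i $ j \<in> frac_ideal vF a" for i j
      proof -
        have "q $ i $ j - mat 1 $ i $ j \<in> th (int m + sl j - sl i)" using q(2) unfolding filt_iff by simp
        then have "q $ i $ j - mat 1 $ i $ j \<in> th (3 * a)"
          by (rule F.thirds_mono) (use m b[of j i] in linarith)
        then show ?thesis by (simp add: F.thirds_frac)
      qed
      then show "\<pi> q v = v" using a KU[OF q(1)] by blast
    qed
    then show ?thesis by blast
  qed
  \<comment> \<open>the level from which on a vector is killed depends on the vector\<close>
  define N where "N = {v. \<exists>m0. \<forall>m\<ge>m0. e m v = 0}"
  have N_subspace: "subspace N"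
    unfolding subspace_def
  proof (intro conjI ballI allI)
    have "e m 0 = 0" for m using e_scale[of m 0 0] by simp
    then show "0 \<in> N" by (simp add: N_def)
    fix x y assume "x \<in> N" "y \<in> N"
    then obtain a b where "\<And>m. m \<ge> a \<Longrightarrow> e m x = 0" "\<And>m. m \<ge> b \<Longrightarrow> e m y = 0" by (auto simp: N_def)
    then show "x + y \<in> N" unfolding N_def by (auto simp: e_add intro!: exI[of _ "max a b"])
  next
    fix c x assume "x \<in> N"
    then show "smul c x \<in> N" by (auto simp: N_def e_scale)
  qed
  have translates: "\<pi> g w \<in> N" if g: "g \<in> U22 D" for g
  proof -
    obtain x where x: "x \<in> ?K" and x': "sigma D g ** x ** g \<in> ?K"
      and ne: "psi D \<gamma> x \<noteq> psi D \<beta> (sigma D g ** x ** g)" using no[OF g] by blast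
    define c where "c = psi D \<beta> (sigma D g ** x ** g)"
    have "g ** (sigma D g ** x ** g) = x ** g" using g by (simp add: matrix_mul_assoc U22_inverse)
    then have "\<pi> x (\<pi> g w) = \<pi> g (\<pi> (sigma D g ** x ** g) w)"
      using g x x' KU by (simp add: \<pi>_mult)
    also have "\<dots> = smul c (\<pi> g w)" using w(2)[OF x'] g by (simp add: \<pi>_scale c_def)
    finally have eig: "\<pi> x (\<pi> g w) = smul c (\<pi> g w)" .
    obtain m0 where m0: "\<And>m. m \<ge> m0 \<Longrightarrow> fixed m (\<pi> g w)" using ex_fixed by blast
    have "e m (\<pi> g w) = 0" if "m \<ge> m0" for m
    proof -
      have "smul (psi D \<gamma> x) (e m (\<pi> g w)) = smul c (e m (\<pi> g w))"
        using e_translate[OF x m0[OF that]] eig e_scale[of m c "\<pi> g w"] by (simp only:)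
      then have "smul (psi D \<gamma> x - c) (e m (\<pi> g w)) = 0"
        by (simp only: scale_left_diff_distrib diff_self)
      then show ?thesis using ne by (simp add: scale_eq_0_iff c_def)
    qed
    then show ?thesis by (auto simp: N_def)
  qed
  define W where "W = span ((\<lambda>g. \<pi> g w) ` U22 D)"
  have "\<pi> h ` W \<subseteq> W" if h: "h \<in> U22 D" for h
  proof -
    have zero: "\<pi> h 0 = 0" using \<pi>_scale[OF h, of 0 0] by simp
    have "subspace {v. \<pi> h v \<in> W}"
      unfolding subspace_def W_def
      by (auto simp: \<pi>_add[OF h] \<pi>_scale[OF h] zero span_zero intro: span_add span_scale)
    moreover have "(\<lambda>g. \<pi> g w) ` U22 D \<subseteq> {v. \<pi> h v \<in> W}"
      using h by (auto simp: W_def \<pi>_mult intro!: span_base U22_mult)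
    ultimately have "W \<subseteq> {v. \<pi> h v \<in> W}" unfolding W_def using span_minimal by blast
    then show ?thesis by blast
  qed
  then have "W = {0} \<or> W = UNIV" by (intro irred) (auto simp: W_def)
  moreover have "w \<in> W"
    unfolding W_def using U22_one \<pi>_one by (metis (mono_tags, lifting) imageI span_base)
  ultimately have "W = UNIV" using w(1) by auto
  moreover have "W \<subseteq> N" unfolding W_def by (rule span_minimal) (use translates N_subspace in auto)
  ultimately have "w' \<in> N" by blast
  then obtain m where "e m w' = 0" by (auto simp: N_def)
  moreover have "e m w' = smul (of_nat (card (E m))) w'"
  proof -
    have "f w' (rp C) = w'" if "C \<in> E m" for C
      using w'(2)[OF rpE(1)[OF that]] psi_nz by (simp add: f_def)
    then have "e m w' = (\<Sum>C\<in>E m. w')" by (simp add: e_def)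
    then show ?thesis by (simp add: sum_constant_scale)
  qed
  moreover have "card (E m) \<noteq> 0" using finE one by (auto simp: E_def)
  ultimately show False using w'(1) by simp
qed

end


section \<open>Conjugacy\<close>

context cyclic_sequence
begin

theorem common_representation_conjugate:
  fixes smul :: "complex \<Rightarrow> 'v::ab_group_add \<Rightarrow> 'v"
  assumes \<beta>: "skew_stratum D \<Lambda> n (n div 2) \<beta>"
    and \<gamma>: "skew_stratum D \<Lambda> n (n div 2) \<gamma>" and fund: "fundamental D \<Lambda> n \<gamma>"
    and irr: "irreducible_smooth_rep D smul \<pi>"
    and cb: "contains_stratum D smul \<pi> \<Lambda> n (n div 2) \<beta>"
    and cg: "contains_stratum D smul \<pi> \<Lambda> n (n div 2) \<gamma>"
  shows "\<exists>g\<in>P 0. \<forall>x\<in>P (n div 2 + 1). psi D \<gamma> x = psi D \<beta> (g ** x ** matrix_inv g)"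
proof -
  let ?r = "n div 2"
  have \<beta>': "\<beta> \<in> filt \<Lambda> (- int n)" "\<beta> \<in> lie_U22 D" and \<gamma>': "\<gamma> \<in> filt \<Lambda> (- int n)" "\<gamma> \<in> lie_U22 D"
    and r: "?r < n"
    using \<beta> \<gamma> by (auto simp: skew_stratum_def stratum_def lie_filt_def)
  have n: "n \<le> 2 * ?r + 1" by simp
  have \<gamma>_leading: "skew_leading D \<Lambda> sl S n p l \<gamma>"
    by (rule skew_leading.intro[OF cyclic_sequence_axioms skew_leading_axioms.intro[OF \<gamma>']])
  note nd = skew_leading.fundamental_nondegenerate[OF \<gamma>_leading fund]
  obtain w w' where w: "w \<noteq> 0" "\<And>x. x \<in> P (Suc ?r) \<Longrightarrow> \<pi> x w = smul (psi D \<beta> x) w"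
    and w': "w' \<noteq> 0" "\<And>x. x \<in> P (Suc ?r) \<Longrightarrow> \<pi> x w' = smul (psi D \<gamma> x) w'"
    using cb cg by (auto simp: contains_stratum_def)
  from common_representation_intertwines[OF irr \<gamma>'(1) n w w'] obtain g where
    g: "g \<in> U22 D" and agree: "\<And>x. x \<in> P (Suc ?r) \<Longrightarrow> sigma D g ** x ** g \<in> P (Suc ?r) \<Longrightarrow>
      psi D \<gamma> x = psi D \<beta> (sigma D g ** x ** g)" by blast
  obtain U U' where U: "U \<in> filt \<Lambda> (- int ?r)" "U' \<in> filt \<Lambda> (- int ?r)"
    and eq: "(\<gamma> - U) ** g = g ** (\<beta> + U')"
    using intertwining_elements[OF \<beta>' \<gamma>' n g agree] by blast
  have "g \<in> filt \<Lambda> 0"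
  proof (rule skew_leading.intertwiner_preserves_sequence[OF \<gamma>_leading _ nd _ g eq])
    have "- U \<in> filt \<Lambda> (1 - int n)" by (intro filt_uminus filt_mono[OF U(1)]) (use r in simp)
    then show "\<gamma> - U - \<gamma> \<in> filt \<Lambda> (1 - int n)" by simp
    show "\<beta> + U' \<in> filt \<Lambda> (- int n)" by (intro filt_add \<beta>' filt_mono[OF U(2)]) (use r in simp)
  qed
  then have g0: "g \<in> P 0" using g by (simp add: P_0_iff)
  show ?thesis
  proof (intro bexI[OF _ P0_sigma[OF g0]] ballI)
    fix x assume "x \<in> P (?r + 1)"
    then have x: "x \<in> P (Suc ?r)" by simp
    have "matrix_inv (sigma D g) = g" using U22_inverse(3)[OF U22_sigma[OF g]] by simp
    then show "psi D \<gamma> x = psi D \<beta> (sigma D g ** x ** matrix_inv (sigma D g))"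
      using agree[OF x P_conj[OF g0 x]] by simp
  qed
qed

end

context unram_setting
begin

lemma thirds_round: "3 * k - 3 < a \<Longrightarrow> a \<le> 3 * k \<Longrightarrow> th a = th (3 * k)"
  by (auto simp: thirds_def)

lemma scale_split_lattice:
  assumes "\<forall>j. 3 * (c j + k) - 3 < a j \<and> a j \<le> 3 * (c j + k)"
  shows "scale_set (unifF D powi k) {x. \<forall>j. x $ j \<in> th (3 * c j)} = {x. \<forall>j. x $ j \<in> th (a j)}"
proof -
  define u where "u = unifF D powi k"
  have u: "u \<noteq> 0" "vF u = k" using unifF by (simp_all add: u_def F.v_power_int)
  have iff: "u * x \<in> th (3 * (d + k)) \<longleftrightarrow> x \<in> th (3 * d)" for x d
    using u by (cases "x = 0") (simp_all add: thirds_def F.v_mult)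
  have a: "th (a j) = th (3 * (c j + k))" for j using assms by (intro thirds_round) auto
  have "x \<in> scale_set u {x. \<forall>j. x $ j \<in> th (3 * c j)} \<longleftrightarrow> (\<forall>j. x $ j \<in> th (3 * (c j + k)))" for x
  proof
    assume "x \<in> scale_set u {x. \<forall>j. x $ j \<in> th (3 * c j)}"
    then obtain y where y: "x = u *s y" "\<forall>j. y $ j \<in> th (3 * c j)" unfolding scale_set_def by blast
    have "u * y $ j \<in> th (3 * (c j + k))" for j using y(2) iff by blast
    then show "\<forall>j. x $ j \<in> th (3 * (c j + k))" unfolding y(1) by simp
  next
    assume x: "\<forall>j. x $ j \<in> th (3 * (c j + k))"
    define y where "y = inverse u *s x"
    have xy: "x = u *s y" using u by (simp add: y_def vec_eq_iff)
    have "u * y $ j \<in> th (3 * (c j + k))" for j using x unfolding xy by simp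
    then have "\<forall>j. y $ j \<in> th (3 * c j)" using iff by blast
    then show "x \<in> scale_set u {x. \<forall>j. x $ j \<in> th (3 * c j)}" unfolding xy scale_set_def by blast
  qed
  then show ?thesis unfolding a u_def[symmetric] by blast
qed

lemma oF_thirds: "oF D = th 0" and pF_thirds: "pF D = th 3"
  using F.thirds_frac[of 0] F.thirds_frac[of 1] by (simp_all add: oF_def pF_def)

lemma N0_split: "N0 D = {x. \<forall>j. x $ j \<in> th (3 * 0)}"
  by (simp add: N0_def forall_4 oF_thirds)

lemma N1_split: "N1 D = {x. \<forall>j. x $ j \<in> th (3 * (if j = 4 then 1 else 0))}"
  by (simp add: N1_def forall_4 oF_thirds pF_thirds)

lemma N2_split: "N2 D = {x. \<forall>j. x $ j \<in> th (3 * (if j = 3 \<or> j = 4 then 1 else 0))}"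
  by (simp add: N2_def forall_4 oF_thirds pF_thirds)

lemma dual_N1_split: "lattice_dual D (N1 D) = {x. \<forall>j. x $ j \<in> th (3 * (if j = 1 then - 1 else 0))}"
proof -
  define c :: "4 \<Rightarrow> int" where "c j = (if j = 4 then 1 else 0)" for j
  have N1: "N1 D = {x. \<forall>j. x $ j \<in> th (3 * c j)}" by (simp add: N1_split c_def)
  have c: "(if j = 1 then - 1 else 0) = - c (1 - j)" for j
    using exhaust_4[of j] by (auto simp: c_def)
  have "x \<in> lattice_dual D (N1 D) \<longleftrightarrow> (\<forall>j. x $ j \<in> th (3 * - c (1 - j)))" for x
  proof
    assume x: "x \<in> lattice_dual D (N1 D)"
    show "\<forall>j. x $ j \<in> th (3 * - c (1 - j))"
    proof
      fix j
      define u where "u = unifF D powi c (1 - j)"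
      have u: "u \<noteq> 0" "vF u = c (1 - j)" using unifF by (simp_all add: u_def F.v_power_int)
      have "axis (1 - j) u \<in> N1 D" unfolding N1 using u by (auto simp: axis_def thirds_def)
      then have "herm D x (axis (1 - j) u) \<in> th 0" using x by (simp add: lattice_dual_def oF_thirds)
      moreover have "herm D x (axis (1 - j) u) = cnjF D (x $ j) * u"
      proof -
        have "(1 - i = 1 - j) = (i = j)" for i by simp
        then show ?thesis
          by (simp add: herm_eq axis_def if_distrib[of "\<lambda>x. _ * x"] cong: if_cong)
      qed
      ultimately have "cnjF D (x $ j) * u \<in> th 0" by simp
      then show "x $ j \<in> th (3 * - c (1 - j))"
        using u by (cases "x $ j = 0") (simp_all add: thirds_def F.v_mult)
    qed
  next
    assume x: "\<forall>j. x $ j \<in> th (3 * - c (1 - j))"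
    have "herm D x y \<in> th 0" if "y \<in> N1 D" for y
      unfolding herm_eq
    proof (rule F.thirds_sum)
      fix i
      have "cnjF D (x $ i) \<in> th (3 * - c (1 - i))" "y $ (1 - i) \<in> th (3 * c (1 - i))"
        using x that unfolding N1 by auto
      then show "cnjF D (x $ i) * y $ (1 - i) \<in> th 0" by (rule F.thirds_mult') simp
    qed
    then show "x \<in> lattice_dual D (N1 D)" by (simp add: lattice_dual_def oF_thirds)
  qed
  then show ?thesis unfolding c by blast
qed

text \<open>
  The places of \<open>e\<^sub>1, e\<^sub>2, e\<^sub>3, e\<^sub>4\<close> are \<open>2, 1, 1, 0\<close> in the first sequence, where \<open>e\<^sub>2, e\<^sub>3\<close> share a
  class modulo 3, and \<open>2, 1, 0, -1\<close> in the second, where \<open>e\<^sub>1, e\<^sub>4\<close> do.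
\<close>

lemma first_sequence_split:
  assumes "\<And>i. \<Lambda> (3 * i) = scale_set (unifF D powi i) (N0 D)"
    and "\<And>i. \<Lambda> (3 * i + 1) = scale_set (unifF D powi i) (N1 D)"
    and "\<And>i. \<Lambda> (3 * i + 2) = scale_set (unifF D powi (i + 1)) (lattice_dual D (N1 D))"
  shows "split_sequence D \<Lambda> (\<lambda>j. if j = 1 then 2 else if j = 4 then 0 else 1) 2"
proof unfold_locales
  fix m :: int
  define i where "i = m div 3"
  have "m = 3 * i \<or> m = 3 * i + 1 \<or> m = 3 * i + 2" unfolding i_def by presburger
  then consider "m = 3 * i" | "m = 3 * i + 1" | "m = 3 * i + 2" by blast
  then show "\<Lambda> m = {x. \<forall>j. x $ j \<in> th (m - (if j = 1 then 2 else if j = 4 then 0 else 1))}"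
    by cases (simp_all only: assms, simp_all only: dual_N1_split,
      simp_all only: N0_split N1_split, (rule scale_split_lattice, simp add: forall_4)+)
next
  fix i :: 4
  show "(if i = 1 then 2 else if i = 4 then 0 else 1)
      + (if 1 - i = 1 then 2 else if 1 - i = 4 then 0 else 1) = (2 :: int)"
    using exhaust_4[of i] by (elim disjE) simp_all
qed

lemma second_sequence_split:
  assumes "\<And>i. \<Lambda> (3 * i) = scale_set (unifF D powi i) (N1 D)"
    and "\<And>i. \<Lambda> (3 * i + 1) = scale_set (unifF D powi i) (N2 D)"
    and "\<And>i. \<Lambda> (3 * i + 2) = scale_set (unifF D powi (i + 1)) (lattice_dual D (N1 D))"
  shows "split_sequence D \<Lambda> (\<lambda>j. if j = 1 then 2 else if j = 2 then 1 else if j = 3 then 0 else - 1) 1"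
proof unfold_locales
  fix m :: int
  define i where "i = m div 3"
  have "m = 3 * i \<or> m = 3 * i + 1 \<or> m = 3 * i + 2" unfolding i_def by presburger
  then consider "m = 3 * i" | "m = 3 * i + 1" | "m = 3 * i + 2" by blast
  then show "\<Lambda> m = {x. \<forall>j. x $ j \<in> th (m - (if j = 1 then 2 else if j = 2 then 1 else if j = 3 then 0 else - 1))}"
    by cases (simp_all only: assms, simp_all only: dual_N1_split,
      simp_all only: N1_split N2_split, (rule scale_split_lattice, simp add: forall_4)+)
next
  fix i :: 4
  show "(if i = 1 then 2 else if i = 2 then 1 else if i = 3 then 0 else - 1)
      + (if 1 - i = 1 then 2 else if 1 - i = 2 then 1 else if 1 - i = 3 then 0 else - 1) = (1 :: int)"
    using exhaust_4[of i] by (elim disjE) simp_all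
qed

end

text \<open>
  The line that an element of degree \<open>-n\<close> maps to the plane is \<open>e\<^sub>1\<close> or \<open>e\<^sub>4\<close> in the first sequence, and \<open>e\<^sub>3\<close> or \<open>e\<^sub>2\<close> in the
  second, according to \<open>n\<close> modulo 3.
\<close>

theorem theorem3p6:
  fixes D :: "('a::field, 'f::field) unram_data"
    and \<Lambda> :: "int \<Rightarrow> ('f^4) set"
    and n :: nat
    and \<beta> \<gamma> :: "'f^4^4"
    and smul :: "complex \<Rightarrow> 'v::ab_group_add \<Rightarrow> 'v"
    and \<pi> :: "'f^4^4 \<Rightarrow> 'v \<Rightarrow> 'v"
  assumes "unram_setting D"
    and "(\<forall>i. \<Lambda> (3 * i) = scale_set (unifF D powi i) (N0 D) \<and>
              \<Lambda> (3 * i + 1) = scale_set (unifF D powi i) (N1 D) \<and>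
              \<Lambda> (3 * i + 2) = scale_set (unifF D powi (i + 1)) (lattice_dual D (N1 D))) \<or>
         (\<forall>i. \<Lambda> (3 * i) = scale_set (unifF D powi i) (N1 D) \<and>
              \<Lambda> (3 * i + 1) = scale_set (unifF D powi i) (N2 D) \<and>
              \<Lambda> (3 * i + 2) = scale_set (unifF D powi (i + 1)) (lattice_dual D (N1 D)))"
    and "0 < n" and "coprime n 3"
    and "skew_stratum D \<Lambda> n (n div 2) \<beta>" and "fundamental D \<Lambda> n \<beta>"
    and "skew_stratum D \<Lambda> n (n div 2) \<gamma>" and "fundamental D \<Lambda> n \<gamma>"
    and "irreducible_smooth_rep D smul \<pi>"
    and "contains_stratum D smul \<pi> \<Lambda> n (n div 2) \<beta>"
    and "contains_stratum D smul \<pi> \<Lambda> n (n div 2) \<gamma>"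
  shows "\<exists>g \<in> grp_filt D \<Lambda> 0. \<forall>x \<in> grp_filt D \<Lambda> (n div 2 + 1).
           psi D \<gamma> x = psi D \<beta> (g ** x ** matrix_inv g)"
proof -
  have "\<not> 3 dvd n" using assms(4) by (auto simp: coprime_absorb_right)
  then have n3: "n mod 3 = 1 \<or> n mod 3 = 2" "\<not> 3 dvd int n" by presburger+
  have "\<exists>sl S p l. cyclic_sequence D \<Lambda> sl S n p l"
    using assms(2)
  proof
    define sl :: "4 \<Rightarrow> int" where "sl j = (if j = 1 then 2 else if j = 4 then 0 else 1)" for j
    assume "\<forall>i. \<Lambda> (3 * i) = scale_set (unifF D powi i) (N0 D) \<and>
              \<Lambda> (3 * i + 1) = scale_set (unifF D powi i) (N1 D) \<and>
              \<Lambda> (3 * i + 2) = scale_set (unifF D powi (i + 1)) (lattice_dual D (N1 D))"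
    then have split: "split_sequence D \<Lambda> sl 2"
      unfolding sl_def by (intro unram_setting.first_sequence_split[OF assms(1)]) auto
    define l :: 4 where "l = (if n mod 3 = 1 then 1 else 4)"
    have "cyclic_sequence D \<Lambda> sl 2 n 2 l"
    proof (rule cyclic_sequence.intro[OF split cyclic_sequence_axioms.intro])
      have "j \<in> {2, 1 - 2, l, 1 - l}" for j using exhaust_4[of j] by (auto simp: l_def)
      then show "UNIV = {2, 1 - 2, l, 1 - l}" by (rule UNIV_eq_I)
      have "sl l - sl 2 = (if n mod 3 = 1 then 1 else - 1)" by (simp add: sl_def l_def)
      moreover have "3 dvd (if n mod 3 = 1 then 1 else - 1) - int n" using n3(1) by presburger
      moreover have "sl l - int n - sl 2 = sl l - sl 2 - int n" by simp
      ultimately show "3 dvd sl l - int n - sl 2" by (simp only:)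
    qed (use n3 in \<open>auto simp: sl_def l_def\<close>)
    then show ?thesis by blast
  next
    define sl :: "4 \<Rightarrow> int"
      where "sl j = (if j = 1 then 2 else if j = 2 then 1 else if j = 3 then 0 else - 1)" for j
    assume "\<forall>i. \<Lambda> (3 * i) = scale_set (unifF D powi i) (N1 D) \<and>
              \<Lambda> (3 * i + 1) = scale_set (unifF D powi i) (N2 D) \<and>
              \<Lambda> (3 * i + 2) = scale_set (unifF D powi (i + 1)) (lattice_dual D (N1 D))"
    then have split: "split_sequence D \<Lambda> sl 1"
      unfolding sl_def by (intro unram_setting.second_sequence_split[OF assms(1)]) auto
    define l :: 4 where "l = (if n mod 3 = 1 then 3 else 2)"
    have "cyclic_sequence D \<Lambda> sl 1 n 1 l"
    proof (rule cyclic_sequence.intro[OF split cyclic_sequence_axioms.intro])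
      have "j \<in> {1, 1 - 1, l, 1 - l}" for j using exhaust_4[of j] by (auto simp: l_def)
      then show "UNIV = {1, 1 - 1, l, 1 - l}" by (rule UNIV_eq_I)
      have "sl l - sl 1 = (if n mod 3 = 1 then - 2 else - 1)" by (simp add: sl_def l_def)
      moreover have "3 dvd (if n mod 3 = 1 then - 2 else - 1) - int n" using n3(1) by presburger
      moreover have "sl l - int n - sl 1 = sl l - sl 1 - int n" by simp
      ultimately show "3 dvd sl l - int n - sl 1" by (simp only:)
    qed (use n3 in \<open>auto simp: sl_def l_def\<close>)
    then show ?thesis by blast
  qed
  then obtain sl S p l where "cyclic_sequence D \<Lambda> sl S n p l" by blast
  from cyclic_sequence.common_representation_conjugate[OF this assms(5,7-11)] show ?thesis .
qed

end
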